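(* Let $(Y,Z)$ be a random vector with $Y$ taking values in $\mathbb{R}^d$ and $Z$ taking values in $\mathbb{R}^k$, with joint distribution $F_{YZ}$, marginal distribution $F_Z$ of $Z$, and regular conditional distribution $F_{Y\mid Z}(\cdot,z)$ of $Y$ given $Z=z$. Let $F_U$ be a probability distribution on $\mathbb{R}^d$ which has a density with respect to Lebesgue measure on $\mathbb{R}^d$ and whose support $\mathcal{U}$ is convex. Let $\mathcal{Z}$ denote the support of $F_Z$ and $\mathcal{UZ}$ the support of the product distribution $F_U\otimes F_Z$. Assume the underlying complete probability space is of the product form $(\Omega,\mathcal{A},\mathrm{P})=(\Omega_0,\mathcal{A}_0,\mathrm{P}_0)\times(\Omega_1,\mathcal{A}_1,\mathrm{P}_1)\times((0,1),\mathcal{B}(0,1),\mathrm{Leb})$, where $(\Omega_1,\mathcal{A}_1,\mathrm{P}_1)$ carries $(Y,Z)$, $(\Omega_0,\mathcal{A}_0,\mathrm{P}_0)$ carries random vectors with distribution $F_U$, and the last factor is the unit interval with Borel sets and Lebesgue measure. Then: (i) There exists a measurable map $(u,z)\mapsto Q_{Y\mid Z}(u,z)$ from $\mathcal{UZ}$ to $\mathbb{R}^d$ such that for each $z\in\mathcal{Z}$, the map $u\mapsto Q_{Y\mid Z}(u,z)$ is the unique ($F_U$-almost everywhere) gradient of a convex function with the property that, whenever $V\sim F_U$, the random vector $Q_{Y\mid Z}(V,z)$ has distribution $F_{Y\mid Z}(\cdot,z)$, i.e. $F_{Y\mid Z}(y,z)=\int 1\{Q_{Y\mid Z}(u,z)\le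 y\}\,F_U(du)$ for all $y\in\mathbb{R}^d$ (componentwise inequality). (ii) There exists a random vector $U$ on $(\Omega,\mathcal{A},\mathrm{P})$ such that, $\mathrm{P}$-almost surely, $Y=Q_{Y\mid Z}(U,Z)$, and the conditional distribution of $U$ given $Z$ is $F_U$ (i.e. $U\mid Z\sim F_U$).
   Context: For $y,y'\in\mathbb{R}^d$, $y'\le y$ means componentwise inequality. "Gradient of a convex function" means a map $u\mapsto \nabla_u\varphi(u,z)$ for some convex $\varphi(\cdot,z)$, defined $F_U$-almost everywhere; uniqueness is understood up to $F_U$-null sets. *)

theory Defs
  imports "HOL-Probability.Probability"
begin

definition supp_measure :: "'a::metric_space measure \<Rightarrow> 'a set" where
  "supp_measure M = {x. \<forall>e>0. emeasure M (ball x e) > 0}"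

definition is_cond_distr ::
  "'o measure \<Rightarrow> ('o \<Rightarrow> 'x::topological_space) \<Rightarrow> ('o \<Rightarrow> 'w::topological_space)
     \<Rightarrow> ('w \<Rightarrow> 'x measure) \<Rightarrow> bool" where
  "is_cond_distr M X W K \<longleftrightarrow>
     (\<forall>w. prob_space (K w) \<and> sets (K w) = sets borel) \<and>
     (\<forall>A\<in>sets borel. (\<lambda>w. measure (K w) A) \<in> borel_measurable borel) \<and>
     (\<forall>A\<in>sets borel. \<forall>B\<in>sets borel.
        measure M {\<omega>\<in>space M. X \<omega> \<in> A \<and> W \<omega> \<in> B}
          = (\<integral>w\<in>B. measure (K w) A \<partial>(distr M borel W)))"

definition grad_convex_ae ::
  "(real^'d) measure \<Rightarrow> (real^'d) set \<Rightarrow> (real^'d \<Rightarrow> real^'d) \<Rightarrow> bool" where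
  "grad_convex_ae F C g \<longleftrightarrow>
     (\<exists>\<phi>::real^'d \<Rightarrow> real. convex_on (interior C) \<phi> \<and>
        (AE u in F. u \<in> interior C \<and> (\<phi> has_derivative (\<lambda>h. g u \<bullet> h)) (at u)))"

end

theory Submission
  imports Defs
begin

text \<open>Uniqueness of the transporting gradient and part (ii) both rest on randomization: a random vector
  \<open>X\<close> can be recreated, jointly with \<open>S\<close>, from \<open>S\<close> and an independent uniform variable. For existence, a
  discrete target is handled by a maximum of affine functions whose cells have prescribed masses. For a
  general target \<open>K z\<close> one approximates by discrete targets; tightness alone, without moments, bounds
  the gradients locally, so the potentials converge along subsequences, and by uniqueness the gradients
  converge almost everywhere along the whole sequence. The limit is therefore jointly measurable
  in \<open>(u, z)\<close>.\<close>

section \<open>Randomization\<close>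

text \<open>Without moments, every transport cost may be infinite, so gradients of convex functions
  are produced and identified through subgradient inequalities alone. The difficulty lies in the
  limit. A convergent subsequence of potentials depends on \<open>z\<close>, which would destroy
  measurability in \<open>(u, z)\<close>, so the gradients themselves have to converge along the
  whole sequence. Uniqueness compares two subsequential limits only up to a null set that varies
  with the subsequences, and there are uncountably many of these. The way out is asymmetric: fix one
  limit \<open>\<Phi>\<close> and a point where it is differentiable; any other limit
  \<open>\<Psi>\<close> that shares subgradients with \<open>\<Phi>\<close> on a dense set has no
  other subgradient at that point, whether or not \<open>\<Psi>\<close> is known to be
  differentiable there. Convexity of the support enters through its interior, an open convex set of
  full mass whose nonempty open subsets all have positive mass. For part (ii), the gradient need not
  be injective, so \<open>U\<close> need not be a function of \<open>(Y, Z)\<close>; it is resampled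
  from the law of \<open>u\<close> given \<open>(Q (u, z), z)\<close>.\<close>

abbreviation unit_uniform :: "real measure" where
  "unit_uniform \<equiv> restrict_space lborel {0<..<1}"

lemma prob_space_unit_uniform: "prob_space unit_uniform"
  by (rule prob_spaceI) (simp add: emeasure_restrict_space space_restrict_space)

lemma emeasure_unit_uniform_atMost:
  assumes "0 \<le> c" "c \<le> 1"
  shows "emeasure unit_uniform {t \<in> space unit_uniform. t \<le> c} = ennreal c"
proof -
  have "emeasure unit_uniform {t \<in> space unit_uniform. t \<le> c} = emeasure lborel {t. 0 < t \<and> t < 1 \<and> t \<le> c}"
    by (subst emeasure_restrict_space) (auto simp: space_restrict_space intro!: arg_cong[where f="emeasure lborel"])
  also have "\<dots> = emeasure lborel (if c = 1 then {0<..<1} else {0<..c})"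
    using assms by (intro arg_cong[where f="emeasure lborel"]) auto
  finally show ?thesis using assms by (simp split: if_splits)
qed

text \<open>Test the hypothesis on the set where \<open>g x < f x\<close>. Both integrals over it
  are finite, so they may be subtracted, which extended nonnegative reals do not allow in
  general.\<close>

lemma AE_le_if_nn_set_integral_le:
  fixes f g :: "'a \<Rightarrow> ennreal"
  assumes [measurable]: "f \<in> borel_measurable M" "g \<in> borel_measurable M"
    and fin: "(\<integral>\<^sup>+x. f x \<partial>M) < \<infinity>"
    and le: "\<And>A. A \<in> sets M \<Longrightarrow> (\<integral>\<^sup>+x. f x * indicator A x \<partial>M) \<le> (\<integral>\<^sup>+x. g x * indicator A x \<partial>M)"
  shows "AE x in M. f x \<le> g x"
proof -
  define A where "A = {x \<in> space M. g x < f x}"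
  have [measurable]: "A \<in> sets M" unfolding A_def by measurable
  have gf: "g x * indicator A x \<le> f x * indicator A x" for x
    by (auto simp: A_def indicator_def)
  have "(\<integral>\<^sup>+x. f x * indicator A x \<partial>M) \<le> (\<integral>\<^sup>+x. f x \<partial>M)"
    by (intro nn_integral_mono) (auto simp: indicator_def)
  with fin have fA: "(\<integral>\<^sup>+x. f x * indicator A x \<partial>M) < \<infinity>" by (rule le_less_trans[rotated])
  have gA: "(\<integral>\<^sup>+x. g x * indicator A x \<partial>M) < \<infinity>"
    using nn_integral_mono[of M, OF gf] fA by (rule le_less_trans)
  have "(\<integral>\<^sup>+x. f x * indicator A x - g x * indicator A x \<partial>M)
      = (\<integral>\<^sup>+x. f x * indicator A x \<partial>M) - (\<integral>\<^sup>+x. g x * indicator A x \<partial>M)"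
    using gA by (intro nn_integral_diff) (auto simp: gf)
  also have "\<dots> = 0" using le[of A] fA by (simp add: diff_eq_0_iff_ennreal)
  finally have "AE x in M. f x * indicator A x - g x * indicator A x = 0"
    by (subst (asm) nn_integral_0_iff_AE) auto
  with AE_space show ?thesis
  proof eventually_elim
    case (elim x)
    then show ?case
      by (cases "x \<in> A") (auto simp: diff_eq_0_iff_ennreal A_def)
  qed
qed

text \<open>The law of \<open>S\<close> on the event \<open>X \<omega> \<le> q\<close> is dominated
  by the full law of \<open>S\<close>, and \<open>G q\<close> is the Radon-Nikodym density. Only
  rational \<open>q\<close> are treated, so that all bounds and monotonicity relations hold off a
  single null set.\<close>

lemma conditional_cdf_exists:
  fixes X :: "'a \<Rightarrow> real" and N :: "'s measure"
  assumes "prob_space M" and [measurable]: "X \<in> borel_measurable M" "S \<in> M \<rightarrow>\<^sub>M N"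
  shows "\<exists>G :: real \<Rightarrow> 's \<Rightarrow> real. (\<forall>q\<in>\<rat>. G q \<in> borel_measurable N) \<and>
    (\<forall>q\<in>\<rat>. \<forall>s. 0 \<le> G q s \<and> G q s \<le> 1) \<and>
    (\<forall>q\<in>\<rat>. \<forall>r\<in>\<rat>. \<forall>s. q \<le> r \<longrightarrow> G q s \<le> G r s) \<and>
    (\<forall>q\<in>\<rat>. \<forall>B\<in>sets N. (\<integral>\<^sup>+s. ennreal (G q s) * indicator B s \<partial>distr M N S)
       = emeasure M {\<omega> \<in> space M. X \<omega> \<le> q \<and> S \<omega> \<in> B})"
proof -
  interpret prob_space M by fact
  define \<rho> where "\<rho> = distr M N S"
  interpret R: prob_space \<rho> unfolding \<rho>_def by (rule prob_space_distr) measurable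
  have [measurable_cong, simp]: "sets \<rho> = sets N" by (simp add: \<rho>_def)
  have [simp]: "space \<rho> = space N" by (simp add: \<rho>_def)
  define m where "m q = distr (density M (indicator {\<omega> \<in> space M. X \<omega> \<le> q})) N S" for q
  have sets_m[simp]: "sets (m q) = sets N" for q by (simp add: m_def)
  have em: "emeasure (m q) B = emeasure M {\<omega> \<in> space M. X \<omega> \<le> q \<and> S \<omega> \<in> B}" if [measurable]: "B \<in> sets N" for q B
  proof -
    have "emeasure (m q) B = (\<integral>\<^sup>+\<omega>. indicator {\<omega> \<in> space M. X \<omega> \<le> q} \<omega> * indicator (S -` B \<inter> space M) \<omega> \<partial>M)"
      unfolding m_def by (subst emeasure_distr) (auto simp: emeasure_density)
    also have "\<dots> = (\<integral>\<^sup>+\<omega>. indicator {\<omega> \<in> space M. X \<omega> \<le> q \<and> S \<omega> \<in> B} \<omega> \<partial>M)"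
      by (intro nn_integral_cong) (auto simp: indicator_def)
    finally show ?thesis by simp
  qed
  have er: "emeasure \<rho> B = emeasure M {\<omega> \<in> space M. S \<omega> \<in> B}" if [measurable]: "B \<in> sets N" for B
    unfolding \<rho>_def by (subst emeasure_distr) (auto intro!: arg_cong[where f="emeasure M"])
  have m_le: "emeasure (m q) B \<le> emeasure \<rho> B" if [measurable]: "B \<in> sets N" for q B
    by (simp add: em er that) (rule emeasure_mono, auto)
  have m_mono: "emeasure (m q) B \<le> emeasure (m r) B" if [measurable]: "B \<in> sets N" and "q \<le> r" for q r B
    using that(2) by (simp add: em that(1)) (rule emeasure_mono, auto)
  have ac: "absolutely_continuous \<rho> (m q)" for q
    unfolding absolutely_continuous_def
  proof
    fix B assume "B \<in> null_sets \<rho>"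
    then have "B \<in> sets N" "emeasure \<rho> B = 0" by auto
    then show "B \<in> null_sets (m q)" using m_le[of B q] by auto
  qed
  define D where "D q = RN_deriv \<rho> (m q)" for q
  have [measurable]: "D q \<in> borel_measurable N" for q
    using borel_measurable_RN_deriv[of \<rho> "m q"] by (simp add: D_def cong: measurable_cong_sets)
  have D_int: "(\<integral>\<^sup>+s. D q s * indicator B s \<partial>\<rho>) = emeasure (m q) B" if "B \<in> sets N" for q B
  proof -
    have "density \<rho> (D q) = m q" unfolding D_def by (rule R.density_RN_deriv[OF ac]) simp
    then show ?thesis using that by (subst emeasure_density[symmetric]) auto
  qed
  have D_fin: "(\<integral>\<^sup>+s. D q s \<partial>\<rho>) < \<infinity>" for q
  proof -
    have "(\<integral>\<^sup>+s. D q s \<partial>\<rho>) = (\<integral>\<^sup>+s. D q s * indicator (space N) s \<partial>\<rho>)"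
      by (intro nn_integral_cong) (auto simp: indicator_def)
    also have "\<dots> \<le> emeasure \<rho> (space N)" using m_le[of "space N" q] by (simp add: D_int)
    finally show ?thesis using R.emeasure_space_1 by (auto intro: le_less_trans)
  qed
  have D_mono: "AE s in \<rho>. D q s \<le> D r s" if "q \<le> r" for q r
    using that by (intro AE_le_if_nn_set_integral_le D_fin) (auto simp: D_int m_mono)
  have D_le1: "AE s in \<rho>. D q s \<le> 1" for q
    by (intro AE_le_if_nn_set_integral_le D_fin) (auto simp: D_int m_le)
  define good where "good s \<longleftrightarrow> (\<forall>q\<in>\<rat>. D q s \<le> 1 \<and> (\<forall>r\<in>\<rat>. q \<le> r \<longrightarrow> D q s \<le> D r s))" for s
  have cQ: "countable (\<rat>::real set)" by (rule countable_rat)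
  have [measurable]: "Measurable.pred N good"
    unfolding good_def using cQ by measurable
  have good: "AE s in \<rho>. good s"
    unfolding good_def using cQ by (auto simp: AE_ball_countable D_le1 D_mono)
  \<comment> \<open>The value 1 on the exceptional null set keeps bounds and monotonicity valid for
    every \<open>s\<close> and changes no integral.\<close>
  define G where "G q s = (if good s then enn2real (D q s) else 1)" for q s
  show ?thesis
  proof (intro exI[of _ G] conjI ballI allI impI)
    show "G q \<in> borel_measurable N" for q unfolding G_def by measurable
    show "0 \<le> G q s" "G q s \<le> 1" if "q \<in> \<rat>" for q s
      using that by (auto simp: G_def good_def intro: enn2real_leI)
    show "G q s \<le> G r s" if "q \<in> \<rat>" "r \<in> \<rat>" "q \<le> r" for q r s
    proof (cases "good s")
      case True
      then have "D q s \<le> D r s" "D r s \<le> 1" using that by (auto simp: good_def)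
      then show ?thesis using True by (auto simp: G_def intro!: enn2real_mono elim: le_less_trans)
    qed (simp add: G_def)
    show "(\<integral>\<^sup>+s. ennreal (G q s) * indicator B s \<partial>distr M N S) = emeasure M {\<omega> \<in> space M. X \<omega> \<le> q \<and> S \<omega> \<in> B}"
      if "q \<in> \<rat>" "B \<in> sets N" for q B
    proof -
      have "(\<integral>\<^sup>+s. ennreal (G q s) * indicator B s \<partial>\<rho>) = (\<integral>\<^sup>+s. D q s * indicator B s \<partial>\<rho>)"
      proof (rule nn_integral_cong_AE)
        show "AE s in \<rho>. ennreal (G q s) * indicator B s = D q s * indicator B s"
          using good
        proof eventually_elim
          case (elim s)
          then have "D q s \<le> 1" using that by (auto simp: good_def)
          then have "D q s < top" by (rule le_less_trans) simp
          then show ?case using elim by (simp add: G_def)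
        qed
      qed
      then show ?thesis using that by (simp add: D_int em \<rho>_def[symmetric])
    qed
  qed
qed

text \<open>For fixed \<open>s\<close>, the map \<open>g\<close> is the generalized inverse of the
  conditional distribution function at level \<open>t\<close>. The strict event
  \<open>g (s, t) < c\<close> is a countable union over rational \<open>q < c\<close>, so the values
  of \<open>G\<close> at rationals determine the law.\<close>

lemma randomization_unit_interval:
  fixes X :: "'a \<Rightarrow> real" and N :: "'s measure"
  assumes M: "prob_space M" and [measurable]: "X \<in> borel_measurable M" "S \<in> M \<rightarrow>\<^sub>M N"
    and X01: "\<And>\<omega>. \<omega> \<in> space M \<Longrightarrow> 0 \<le> X \<omega> \<and> X \<omega> < 1"
  obtains g where "g \<in> borel_measurable (N \<Otimes>\<^sub>M unit_uniform)"
    and "distr (distr M N S \<Otimes>\<^sub>M unit_uniform) (borel \<Otimes>\<^sub>M N) (\<lambda>(s, t). (g (s, t), s))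
       = distr M (borel \<Otimes>\<^sub>M N) (\<lambda>\<omega>. (X \<omega>, S \<omega>))"
proof -
  interpret prob_space M by fact
  define \<rho> where "\<rho> = distr M N S"
  interpret R: prob_space \<rho> unfolding \<rho>_def by (rule prob_space_distr) measurable
  have [measurable_cong, simp]: "sets \<rho> = sets N" by (simp add: \<rho>_def)
  have [simp]: "space \<rho> = space N" by (simp add: \<rho>_def)
  interpret T: prob_space unit_uniform by (rule prob_space_unit_uniform)
  interpret P: pair_prob_space \<rho> unit_uniform ..
  obtain G :: "real \<Rightarrow> 's \<Rightarrow> real" where G_all: "(\<forall>q\<in>\<rat>. G q \<in> borel_measurable N) \<and>
    (\<forall>q\<in>\<rat>. \<forall>s. 0 \<le> G q s \<and> G q s \<le> 1) \<and>
    (\<forall>q\<in>\<rat>. \<forall>r\<in>\<rat>. \<forall>s. q \<le> r \<longrightarrow> G q s \<le> G r s) \<and>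
    (\<forall>q\<in>\<rat>. \<forall>B\<in>sets N. (\<integral>\<^sup>+s. ennreal (G q s) * indicator B s \<partial>\<rho>)
       = emeasure M {\<omega> \<in> space M. X \<omega> \<le> q \<and> S \<omega> \<in> B})"
    using conditional_cdf_exists[OF M assms(2,3)] unfolding \<rho>_def by (rule exE)
  then have G[measurable]: "\<And>q. q \<in> \<rat> \<Longrightarrow> G q \<in> borel_measurable N"
    and G01: "\<And>q s. q \<in> \<rat> \<Longrightarrow> 0 \<le> G q s \<and> G q s \<le> 1"
    and G_mono: "\<And>q r s. q \<in> \<rat> \<Longrightarrow> r \<in> \<rat> \<Longrightarrow> q \<le> r \<Longrightarrow> G q s \<le> G r s"
    and G_int: "\<And>q B. q \<in> \<rat> \<Longrightarrow> B \<in> sets N \<Longrightarrow>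
      (\<integral>\<^sup>+s. ennreal (G q s) * indicator B s \<partial>\<rho>) = emeasure M {\<omega> \<in> space M. X \<omega> \<le> q \<and> S \<omega> \<in> B}"
    by simp_all
  \<comment> \<open>The extra point 1 keeps the set nonempty when no rational qualifies; as
    \<open>X\<close> stays below 1, capping at 1 is consistent with its law.\<close>
  define I where "I s t = insert 1 {q \<in> \<rat>. 0 \<le> q \<and> q < 1 \<and> t \<le> G q s}" for s t
  define g where "g = (\<lambda>(s, t). Inf (I s t))"
  have bdd: "bdd_below (I s t)" for s t by (rule bdd_belowI[of _ 0]) (auto simp: I_def)
  have g_less: "g (s, t) < c \<longleftrightarrow> (1 < c \<or> (\<exists>q\<in>\<rat>. 0 \<le> q \<and> q < 1 \<and> q < c \<and> t \<le> G q s))" for s t c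
    unfolding g_def using cInf_less_iff[OF _ bdd, of s t c] by (auto simp: I_def)
  have cQ: "countable (\<rat>::real set)" by (rule countable_rat)
  have [measurable]: "(\<lambda>t. t) \<in> borel_measurable unit_uniform"
    by (rule measurable_restrict_space1) simp
  have gm[measurable]: "g \<in> borel_measurable (N \<Otimes>\<^sub>M unit_uniform)"
  proof (subst borel_measurable_iff_less, rule allI)
    fix c
    have "{x \<in> space (N \<Otimes>\<^sub>M unit_uniform). g x < c} =
       {x \<in> space (N \<Otimes>\<^sub>M unit_uniform). 1 < c \<or> (\<exists>q\<in>\<rat>. 0 \<le> q \<and> q < 1 \<and> q < c \<and> snd x \<le> G q (fst x))}"
      using g_less by auto
    also have "\<dots> \<in> sets (N \<Otimes>\<^sub>M unit_uniform)" using cQ by measurable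
    finally show "{x \<in> space (N \<Otimes>\<^sub>M unit_uniform). g x < c} \<in> sets (N \<Otimes>\<^sub>M unit_uniform)" .
  qed
  let ?L = "distr (\<rho> \<Otimes>\<^sub>M unit_uniform) (borel \<Otimes>\<^sub>M N) (\<lambda>(s, t). (g (s, t), s))"
  let ?R = "distr M (borel \<Otimes>\<^sub>M N) (\<lambda>\<omega>. (X \<omega>, S \<omega>))"
  let ?E = "{a \<times> b |a b. a \<in> range (lessThan :: real \<Rightarrow> real set) \<and> b \<in> sets N}"
  have eq: "emeasure ?L ({..<c} \<times> B) = emeasure ?R ({..<c} \<times> B)" if [measurable]: "B \<in> sets N" for c B
  proof -
    have L: "emeasure ?L ({..<c} \<times> B) = emeasure (\<rho> \<Otimes>\<^sub>M unit_uniform) {x \<in> space (\<rho> \<Otimes>\<^sub>M unit_uniform). g x < c \<and> fst x \<in> B}"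
      by (subst emeasure_distr) (auto simp: space_pair_measure intro!: arg_cong[where f="emeasure _"])
    have R: "emeasure ?R ({..<c} \<times> B) = emeasure M {\<omega> \<in> space M. X \<omega> < c \<and> S \<omega> \<in> B}"
      by (subst emeasure_distr) (auto intro!: arg_cong[where f="emeasure _"])
    consider "1 < c" | "c \<le> 0" | "0 < c" "c \<le> 1" by linarith
    then show ?thesis
    proof cases
      case 1
      have "emeasure ?L ({..<c} \<times> B) = emeasure (\<rho> \<Otimes>\<^sub>M unit_uniform) (B \<times> space unit_uniform)"
        unfolding L using 1 sets.sets_into_space[OF that] g_less
        by (intro arg_cong[where f="emeasure _"]) (auto simp: space_pair_measure)
      also have "\<dots> = emeasure \<rho> B * emeasure unit_uniform (space unit_uniform)"
        by (rule T.emeasure_pair_measure_Times) (simp, rule sets.top)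
      also have "\<dots> = emeasure \<rho> B" by (simp only: T.emeasure_space_1 mult_1_right)
      also have "\<dots> = emeasure M {\<omega> \<in> space M. S \<omega> \<in> B}"
        unfolding \<rho>_def by (subst emeasure_distr) (auto intro!: arg_cong[where f="emeasure M"])
      also have "{\<omega> \<in> space M. S \<omega> \<in> B} = {\<omega> \<in> space M. X \<omega> < c \<and> S \<omega> \<in> B}"
        using X01 1 by fastforce
      finally show ?thesis unfolding R .
    next
      case 2
      have "{x \<in> space (\<rho> \<Otimes>\<^sub>M unit_uniform). g x < c \<and> fst x \<in> B} = {}"
        using g_less 2 by (auto simp: space_pair_measure)
      moreover have "{\<omega> \<in> space M. X \<omega> < c \<and> S \<omega> \<in> B} = {}" using X01 2 by force
      ultimately show ?thesis unfolding L R by (simp only: emeasure_empty)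
    next
      case 3
      have "\<exists>r. \<forall>n::nat. r n \<in> \<rat> \<and> max 0 (c - 1 / Suc n) < r n \<and> r n < c"
      proof (rule choice, rule allI)
        fix n :: nat
        show "\<exists>y. y \<in> \<rat> \<and> max 0 (c - 1 / Suc n) < y \<and> y < c"
          using Rats_dense_in_real[of "max 0 (c - 1 / Suc n)" c] 3 by auto
      qed
      then obtain r :: "nat \<Rightarrow> real" where r: "\<And>n. r n \<in> \<rat>" "\<And>n. 0 < r n" "\<And>n. c - 1 / Suc n < r n" "\<And>n. r n < c"
        by auto
      \<comment> \<open>Running maxima turn rationals within \<open>1 / Suc n\<close> of
        \<open>c\<close> into an increasing sequence with supremum \<open>c\<close>, as continuity
        from below requires.\<close>
      define q where "q n = Max (r ` {..n})" for n
      have qin: "q n \<in> r ` {..n}" for n unfolding q_def by (rule Max_in) auto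
      have q: "q n \<in> \<rat>" "0 \<le> q n" "q n < c" "q n < 1" for n
      proof -
        obtain i where i: "q n = r i" using qin[of n] by auto
        show "q n \<in> \<rat>" "0 \<le> q n" "q n < c" "q n < 1" using r(1,2,4)[of i] 3 unfolding i by auto
      qed
      have q_ge: "c - 1 / Suc n < q n" for n
        using r(3)[of n] unfolding q_def by (rule less_le_trans) auto
      have q_mono: "incseq q" unfolding q_def by (intro incseq_SucI Max_mono) auto
      have ex_n: "\<exists>n. x < q n" if xc: "x < c" for x
      proof -
        obtain n where "1 / Suc n < c - x" using xc by (metis diff_gt_0_iff_gt nat_approx_posE)
        then show ?thesis using q_ge[of n] by (intro exI[of _ n]) linarith
      qed
      have LS: "{x \<in> space (\<rho> \<Otimes>\<^sub>M unit_uniform). g x < c \<and> fst x \<in> B}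
        = (\<Union>n. {x \<in> space (\<rho> \<Otimes>\<^sub>M unit_uniform). snd x \<le> G (q n) (fst x) \<and> fst x \<in> B})"
      proof (intro set_eqI iffI)
        fix x assume x: "x \<in> {x \<in> space (\<rho> \<Otimes>\<^sub>M unit_uniform). g x < c \<and> fst x \<in> B}"
        obtain s t where st: "x = (s, t)" by force
        obtain p where p: "p \<in> \<rat>" "p < c" "t \<le> G p s" using x 3 by (auto simp: st g_less)
        obtain n where "p < q n" using ex_n[OF p(2)] ..
        then have "t \<le> G (q n) s" using G_mono[of p "q n" s] p q[of n] by auto
        then show "x \<in> (\<Union>n. {x \<in> space (\<rho> \<Otimes>\<^sub>M unit_uniform). snd x \<le> G (q n) (fst x) \<and> fst x \<in> B})"
          using x by (auto simp: st)
      next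
        fix x assume x: "x \<in> (\<Union>n. {x \<in> space (\<rho> \<Otimes>\<^sub>M unit_uniform). snd x \<le> G (q n) (fst x) \<and> fst x \<in> B})"
        obtain s t where st: "x = (s, t)" by force
        show "x \<in> {x \<in> space (\<rho> \<Otimes>\<^sub>M unit_uniform). g x < c \<and> fst x \<in> B}"
          using x q by (auto simp: st g_less)
      qed
      have RS: "{\<omega> \<in> space M. X \<omega> < c \<and> S \<omega> \<in> B} = (\<Union>n. {\<omega> \<in> space M. X \<omega> \<le> q n \<and> S \<omega> \<in> B})"
        using q(3) ex_n by (auto intro: le_less_trans) (meson less_imp_le)
      note [measurable] = G[OF q(1)]
      have each: "emeasure (\<rho> \<Otimes>\<^sub>M unit_uniform) {x \<in> space (\<rho> \<Otimes>\<^sub>M unit_uniform). snd x \<le> G (q n) (fst x) \<and> fst x \<in> B}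
        = emeasure M {\<omega> \<in> space M. X \<omega> \<le> q n \<and> S \<omega> \<in> B}" for n
      proof -
        have "emeasure (\<rho> \<Otimes>\<^sub>M unit_uniform) {x \<in> space (\<rho> \<Otimes>\<^sub>M unit_uniform). snd x \<le> G (q n) (fst x) \<and> fst x \<in> B}
          = (\<integral>\<^sup>+s. emeasure unit_uniform (Pair s -` {x \<in> space (\<rho> \<Otimes>\<^sub>M unit_uniform). snd x \<le> G (q n) (fst x) \<and> fst x \<in> B}) \<partial>\<rho>)"
          by (rule T.emeasure_pair_measure_alt) measurable
        also have "\<dots> = (\<integral>\<^sup>+s. ennreal (G (q n) s) * indicator B s \<partial>\<rho>)"
        proof (rule nn_integral_cong)
          fix s assume s: "s \<in> space \<rho>"
          have "Pair s -` {x \<in> space (\<rho> \<Otimes>\<^sub>M unit_uniform). snd x \<le> G (q n) (fst x) \<and> fst x \<in> B}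
            = (if s \<in> B then {t \<in> space unit_uniform. t \<le> G (q n) s} else {})"
            using s by (auto simp: space_pair_measure)
          then show "emeasure unit_uniform (Pair s -` {x \<in> space (\<rho> \<Otimes>\<^sub>M unit_uniform). snd x \<le> G (q n) (fst x) \<and> fst x \<in> B})
            = ennreal (G (q n) s) * indicator B s"
            using G01[OF q(1), of n s] emeasure_unit_uniform_atMost[of "G (q n) s"] by simp
        qed
        finally show ?thesis using G_int[OF q(1)] by simp
      qed
      have "emeasure ?L ({..<c} \<times> B) = (SUP n. emeasure (\<rho> \<Otimes>\<^sub>M unit_uniform) {x \<in> space (\<rho> \<Otimes>\<^sub>M unit_uniform). snd x \<le> G (q n) (fst x) \<and> fst x \<in> B})"
        unfolding L LS
      proof (rule SUP_emeasure_incseq[symmetric])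
        show "incseq (\<lambda>n. {x \<in> space (\<rho> \<Otimes>\<^sub>M unit_uniform). snd x \<le> G (q n) (fst x) \<and> fst x \<in> B})"
          using q_mono G_mono[OF q(1) q(1)] by (auto simp: incseq_def intro: order_trans)
      qed (intro image_subsetI, measurable)
      also have "\<dots> = (SUP n. emeasure M {\<omega> \<in> space M. X \<omega> \<le> q n \<and> S \<omega> \<in> B})"
        by (simp add: each)
      also have "\<dots> = emeasure M {\<omega> \<in> space M. X \<omega> < c \<and> S \<omega> \<in> B}"
        unfolding RS by (rule SUP_emeasure_incseq)
          (use q_mono in \<open>auto simp: incseq_def intro: order_trans\<close>)
      finally show ?thesis unfolding R .
    qed
  qed
  have "?L = ?R"
  proof (rule measure_eqI_generator_eq)
    show "Int_stable ?E"
    proof (rule Int_stableI)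
      fix a b assume "a \<in> ?E" "b \<in> ?E"
      then obtain c B c' B' where "a = {..<c} \<times> B" "b = {..<c'} \<times> B'" "B \<in> sets N" "B' \<in> sets N" by auto
      moreover from this have "a \<inter> b = {..<min c c'} \<times> (B \<inter> B')" by auto
      ultimately show "a \<inter> b \<in> ?E" by blast
    qed
    show "?E \<subseteq> Pow (UNIV \<times> space N)" using sets.sets_into_space by fast
    have "sets (borel \<Otimes>\<^sub>M N) = sets (sigma (space borel \<times> space N) ?E)"
    proof (rule sets_pair_eq)
      show "sets (borel::real measure) = sigma_sets (space borel) (range lessThan)"
        by (subst borel_Iio) simp
      show "sets N = sigma_sets (space N) (sets N)" by (rule sets.sigma_sets_eq[symmetric])
      show "countable (range (\<lambda>n::nat. {..<real n}))" by simp
      show "(\<Union>n. {..<real n}) = space borel" using reals_Archimedean2 by auto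
      show "countable {space N}" by simp
    qed (auto simp: sets.space_closed)
    then show "sets ?L = sigma_sets (UNIV \<times> space N) ?E" "sets ?R = sigma_sets (UNIV \<times> space N) ?E"
      using \<open>?E \<subseteq> Pow (UNIV \<times> space N)\<close> by (simp_all add: sets_measure_of)
    show "emeasure ?L A = emeasure ?R A" if "A \<in> ?E" for A using that eq by auto
    show "range (\<lambda>n::nat. {..<real n} \<times> space N) \<subseteq> ?E" by auto
    show "(\<Union>n. {..<real n} \<times> space N) = UNIV \<times> space N" using reals_Archimedean2 by auto
    interpret L: prob_space ?L by (rule P.prob_space_distr) measurable
    show "emeasure ?L ({..<real n} \<times> space N) \<noteq> \<infinity>" for n by simp
  qed
  then show thesis using that[of g] gm unfolding \<rho>_def by simp
qed

text \<open>Only the digits 0 and 1 are used in base 4, so a tail sums to at most 1/3 and never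
  carries into an earlier digit, unlike in binary expansions. A digit is the parity of a floor,
  because all earlier digits contribute multiples of 4.\<close>

lemma quaternary_digit:
  fixes b :: "nat \<Rightarrow> bool"
  defines "r \<equiv> \<Sum>k. of_bool (b k) / 4 ^ (k + 1) :: real"
  shows "0 \<le> r" "r < 1" "odd \<lfloor>4 ^ (n + 1) * r\<rfloor> \<longleftrightarrow> b n"
proof -
  have g: "(\<lambda>k. 1 / 4 ^ (k + 1) :: real) sums (1 / 3)"
    using sums_mult[OF geometric_sums[of "1 / 4 :: real"], of "1 / 4"] by (simp add: power_divide)
  have le: "of_bool (c k) / 4 ^ (k + 1) \<le> (1 / 4 ^ (k + 1) :: real)" for c and k :: nat
    by (simp add: of_bool_def)
  have sm: "summable (\<lambda>k. of_bool (c k) / 4 ^ (k + 1) :: real)" for c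
    by (rule summable_comparison_test'[OF sums_summable[OF g], of 0]) (use le in auto)
  have bd: "0 \<le> (\<Sum>k. of_bool (c k) / 4 ^ (k + 1) :: real)" "(\<Sum>k. of_bool (c k) / 4 ^ (k + 1) :: real) < 1" for c
  proof -
    show "0 \<le> (\<Sum>k. of_bool (c k) / 4 ^ (k + 1) :: real)" by (intro suminf_nonneg sm) simp
    have "(\<Sum>k. of_bool (c k) / 4 ^ (k + 1) :: real) \<le> (\<Sum>k. 1 / 4 ^ (k + 1))"
      by (intro suminf_le le sm sums_summable[OF g])
    also have "\<dots> = 1 / 3" using g by (simp add: sums_iff)
    finally show "(\<Sum>k. of_bool (c k) / 4 ^ (k + 1) :: real) < 1" by simp
  qed
  show "0 \<le> r" "r < 1" unfolding r_def by (rule bd)+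
  define tail where "tail = (\<Sum>k. of_bool (b (k + (n + 1))) / 4 ^ (k + 1) :: real)"
  have tail: "0 \<le> tail" "tail < 1" unfolding tail_def by (rule bd)+
  define I :: int where "I = (\<Sum>k<n + 1. of_bool (b k) * 4 ^ (n - k))"
  have "r = (\<Sum>k. of_bool (b (k + (n + 1))) / 4 ^ (k + (n + 1) + 1)) + (\<Sum>k<n + 1. of_bool (b k) / 4 ^ (k + 1))"
    unfolding r_def by (rule suminf_split_initial_segment[OF sm])
  also have "(\<Sum>k. of_bool (b (k + (n + 1))) / 4 ^ (k + (n + 1) + 1)) = (1 / 4 ^ (n + 1)) * tail"
    unfolding tail_def by (subst suminf_mult[OF sm, symmetric]) (simp add: power_add field_simps)
  finally have "4 ^ (n + 1) * r = tail + (\<Sum>k<n + 1. 4 ^ (n + 1) * (of_bool (b k) / 4 ^ (k + 1)))"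
    by (simp add: distrib_left sum_distrib_left)
  also have "(\<Sum>k<n + 1. 4 ^ (n + 1) * (of_bool (b k) / 4 ^ (k + 1))) = (of_int I :: real)"
    unfolding I_def of_int_sum
  proof (rule sum.cong[OF refl])
    fix k assume "k \<in> {..<n + 1}"
    then have "(4::real) ^ n = 4 ^ (n - k) * 4 ^ k" by (simp flip: power_add)
    then show "4 ^ (n + 1) * (of_bool (b k) / 4 ^ (k + 1)) = (of_int (of_bool (b k) * 4 ^ (n - k)) :: real)"
      by simp
  qed
  finally have "\<lfloor>4 ^ (n + 1) * r\<rfloor> = I" using tail by (simp add: floor_unique)
  moreover have "odd I \<longleftrightarrow> b n"
  proof -
    have "I = (\<Sum>k<n. of_bool (b k) * 4 ^ (n - k)) + of_bool (b n)" by (simp add: I_def)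
    moreover have "even (\<Sum>k<n. of_bool (b k) * 4 ^ (n - k) :: int)"
      by (rule dvd_sum) simp
    ultimately show ?thesis by simp
  qed
  ultimately show "odd \<lfloor>4 ^ (n + 1) * r\<rfloor> \<longleftrightarrow> b n" by simp
qed

text \<open>A point is determined by the truth values of the countably many comparisons
  \<open>x \<bullet> b > q\<close>, packed as digits; each coordinate is the supremum of the
  rationals below it. This reduces randomization of vectors to the unit interval.\<close>

lemma real_code_exists:
  "\<exists>(e :: 'a::euclidean_space \<Rightarrow> real) d. e \<in> borel_measurable borel \<and> d \<in> borel_measurable borel \<and>
     (\<forall>x. 0 \<le> e x \<and> e x < 1) \<and> (\<forall>x. d (e x) = x)"
proof -
  let ?C = "(Basis :: 'a set) \<times> (\<rat> :: real set)"
  have cC: "countable ?C" by (intro countable_SIGMA countable_finite countable_rat) auto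
  define B where "B n = from_nat_into ?C n" for n
  define e where "e x = (\<Sum>k. of_bool (x \<bullet> fst (B k) > snd (B k)) / 4 ^ (k + 1) :: real)" for x :: 'a
  define ix where "ix b q = to_nat_on ?C (b, q)" for b q
  have B_ix: "B (ix b q) = (b, q)" if "b \<in> Basis" "q \<in> \<rat>" for b q
    unfolding B_def ix_def using that by (intro from_nat_into_to_nat_on cC) auto
  \<comment> \<open>Extended reals make the supremum meaningful for every \<open>r\<close>,
    including numbers that code no point, which keeps \<open>d\<close> total and Borel.\<close>
  define s where "s r b q = (if odd \<lfloor>4 ^ (ix b q + 1) * r\<rfloor> then ereal q else -\<infinity>)" for r :: real and b q
  define d where "d r = (\<Sum>b\<in>Basis. real_of_ereal (SUP q\<in>\<rat>. s r b q) *\<^sub>R b)" for r :: real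
  have "e \<in> borel_measurable borel" unfolding e_def of_bool_def by measurable
  moreover have "d \<in> borel_measurable borel"
  proof -
    have [measurable]: "(\<lambda>r. s r b q) \<in> borel_measurable borel" for b q
      unfolding s_def by measurable
    have [measurable]: "(\<lambda>r. SUP q\<in>\<rat>. s r b q) \<in> borel_measurable borel" for b
      by (rule borel_measurable_SUP) (auto simp: countable_rat)
    show ?thesis unfolding d_def by measurable
  qed
  moreover have "0 \<le> e x \<and> e x < 1" for x
    unfolding e_def by (intro conjI quaternary_digit(1,2))
  moreover have "d (e x) = x" for x
  proof (rule euclidean_eqI)
    fix b :: 'a assume b: "b \<in> Basis"
    have s: "s (e x) b q = (if q < x \<bullet> b then ereal q else -\<infinity>)" if "q \<in> \<rat>" for q
      using quaternary_digit(3)[of "ix b q" "\<lambda>k. x \<bullet> fst (B k) > snd (B k)"] B_ix[OF b that]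
      by (simp add: s_def e_def)
    have "(SUP q\<in>\<rat>. s (e x) b q) = ereal (x \<bullet> b)"
    proof (rule antisym)
      show "(SUP q\<in>\<rat>. s (e x) b q) \<le> ereal (x \<bullet> b)" by (rule SUP_least) (auto simp: s)
      show "ereal (x \<bullet> b) \<le> (SUP q\<in>\<rat>. s (e x) b q)"
      proof (rule le_SUP_iff[THEN iffD2], intro allI impI)
        fix y assume y: "y < ereal (x \<bullet> b)"
        obtain q where "q \<in> \<rat>" "y < ereal q" "q < x \<bullet> b"
        proof (cases y)
          case (real r)
          then show ?thesis using y Rats_dense_in_real[of r "x \<bullet> b"] that by auto
        next
          case MInf
          then show ?thesis using Rats_dense_in_real[of "x \<bullet> b - 1" "x \<bullet> b"] that by auto
        qed (use y in auto)
        then show "\<exists>q\<in>\<rat>. y < s (e x) b q" by (intro bexI[of _ q]) (auto simp: s)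
      qed
    qed
    then show "d (e x) \<bullet> b = x \<bullet> b" using b
      by (simp add: d_def inner_sum_left inner_Basis if_distrib cong: if_cong)
  qed
  ultimately show ?thesis by blast
qed

text \<open>The value \<open>g (S, T)\<close>, with \<open>T\<close> an independent uniform variable, is the conditional quantile
  transform of \<open>X\<close> given \<open>S\<close>.\<close>

lemma randomization:
  fixes X :: "'a \<Rightarrow> 'e::euclidean_space" and N :: "'s measure"
  assumes M: "prob_space M" and [measurable]: "X \<in> borel_measurable M" "S \<in> M \<rightarrow>\<^sub>M N"
  obtains g where "g \<in> borel_measurable (N \<Otimes>\<^sub>M unit_uniform)"
    and "distr (distr M N S \<Otimes>\<^sub>M unit_uniform) (borel \<Otimes>\<^sub>M N) (\<lambda>(s, t). (g (s, t), s))
       = distr M (borel \<Otimes>\<^sub>M N) (\<lambda>\<omega>. (X \<omega>, S \<omega>))"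
proof -
  obtain e :: "'e \<Rightarrow> real" and d where [measurable]: "e \<in> borel_measurable borel" "d \<in> borel_measurable borel"
    and e01: "\<And>x. 0 \<le> e x \<and> e x < 1" and de: "\<And>x. d (e x) = x"
    using real_code_exists by metis
  have [measurable]: "(\<lambda>\<omega>. e (X \<omega>)) \<in> borel_measurable M" by measurable
  obtain g where [measurable]: "g \<in> borel_measurable (N \<Otimes>\<^sub>M unit_uniform)"
    and g: "distr (distr M N S \<Otimes>\<^sub>M unit_uniform) (borel \<Otimes>\<^sub>M N) (\<lambda>(s, t). (g (s, t), s))
       = distr M (borel \<Otimes>\<^sub>M N) (\<lambda>\<omega>. (e (X \<omega>), S \<omega>))"
    by (rule randomization_unit_interval[OF M \<open>(\<lambda>\<omega>. e (X \<omega>)) \<in> borel_measurable M\<close> assms(3)]) (use e01 in auto)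
  show thesis
  proof
    show "(\<lambda>x. d (g x)) \<in> borel_measurable (N \<Otimes>\<^sub>M unit_uniform)" by measurable
    have "distr (distr M N S \<Otimes>\<^sub>M unit_uniform) (borel \<Otimes>\<^sub>M N) (\<lambda>(s, t). (d (g (s, t)), s))
      = distr (distr (distr M N S \<Otimes>\<^sub>M unit_uniform) (borel \<Otimes>\<^sub>M N) (\<lambda>(s, t). (g (s, t), s)))
          (borel \<Otimes>\<^sub>M N) (\<lambda>(r, s). (d r, s))"
      by (subst distr_distr) (auto simp: comp_def split_beta')
    also have "\<dots> = distr M (borel \<Otimes>\<^sub>M N) (\<lambda>\<omega>. (X \<omega>, S \<omega>))"
      unfolding g by (subst distr_distr) (auto simp: comp_def de)
    finally show "distr (distr M N S \<Otimes>\<^sub>M unit_uniform) (borel \<Otimes>\<^sub>M N) (\<lambda>(s, t). (d (g (s, t)), s))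
       = distr M (borel \<Otimes>\<^sub>M N) (\<lambda>\<omega>. (X \<omega>, S \<omega>))" .
  qed
qed

section \<open>Subgradients and differentiability of convex functions\<close>

text \<open>Subgradients are taken relative to \<open>S\<close>, because the limit potentials are
  controlled only on the interior of the support.\<close>

definition subgrad :: "'a::real_inner set \<Rightarrow> ('a \<Rightarrow> real) \<Rightarrow> 'a \<Rightarrow> 'a \<Rightarrow> bool" where
  "subgrad S f x p \<longleftrightarrow> (\<forall>y\<in>S. f x + p \<bullet> (y - x) \<le> f y)"

lemma subgradD: "subgrad S f x p \<Longrightarrow> y \<in> S \<Longrightarrow> f x + p \<bullet> (y - x) \<le> f y"
  by (simp add: subgrad_def)

lemma subgrad_monotone:
  assumes "subgrad S f x p" "subgrad S f y q" "x \<in> S" "y \<in> S"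
  shows "p \<bullet> (y - x) \<le> q \<bullet> (y - x)"
  using subgradD[OF assms(1,4)] subgradD[OF assms(2,3)] by (simp add: inner_diff_right)

lemma convex_on_if_subgrad:
  assumes "convex S" and sg: "\<And>x. x \<in> S \<Longrightarrow> subgrad S f x (P x)"
  shows "convex_on S f"
proof (rule convex_onI[OF _ assms(1)])
  fix t x y assume t: "0 < t" "t < (1::real)" and xy: "x \<in> S" "y \<in> S"
  let ?m = "(1 - t) *\<^sub>R x + t *\<^sub>R y"
  have m: "?m \<in> S" using xy t \<open>convex S\<close> by (simp add: convex_alt)
  have 1: "f ?m + P ?m \<bullet> (x - ?m) \<le> f x" "f ?m + P ?m \<bullet> (y - ?m) \<le> f y"
    using subgradD[OF sg[OF m]] xy by auto
  have "f ?m = (1 - t) * (f ?m + P ?m \<bullet> (x - ?m)) + t * (f ?m + P ?m \<bullet> (y - ?m))"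
    by (simp add: inner_diff_right inner_add_right algebra_simps)
  also have "\<dots> \<le> (1 - t) * f x + t * f y"
    using 1 t by (intro add_mono mult_left_mono) auto
  finally show "f ?m \<le> (1 - t) * f x + t * f y" .
qed

lemma line_has_real_derivative:
  assumes "(f has_derivative (\<lambda>h. p \<bullet> h)) (at x)"
  shows "((\<lambda>t. f (x + (c * t) *\<^sub>R v)) has_real_derivative c * (p \<bullet> v)) (at 0)"
proof -
  have "((\<lambda>t. x + (c * t) *\<^sub>R v) has_derivative (\<lambda>t. (c * t) *\<^sub>R v)) (at (0::real))"
    by (auto intro!: derivative_eq_intros)
  from diff_chain_at[OF this, of f "\<lambda>h. p \<bullet> h"] assms
  have "((\<lambda>t. f (x + (c * t) *\<^sub>R v)) has_derivative (\<lambda>t. p \<bullet> ((c * t) *\<^sub>R v))) (at (0::real))"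
    by (simp add: comp_def)
  then show ?thesis unfolding has_field_derivative_def
    by (rule has_derivative_eq_rhs) (auto simp: fun_eq_iff mult_ac)
qed

lemma subgrad_if_has_derivative:
  assumes cv: "convex_on S f" and x: "x \<in> S" and d: "(f has_derivative (\<lambda>h. p \<bullet> h)) (at x)"
  shows "subgrad S f x p"
  unfolding subgrad_def
proof
  fix y assume y: "y \<in> S"
  let ?F = "\<lambda>t. f (x + (1 * t) *\<^sub>R (y - x))"
  have "((\<lambda>t. (?F t - ?F 0) / (t - 0)) \<longlongrightarrow> 1 * (p \<bullet> (y - x))) (at 0)"
    using line_has_real_derivative[OF d, of 1 "y - x"] by (simp add: has_field_derivative_iff)
  then have "((\<lambda>t. (?F t - ?F 0) / (t - 0)) \<longlongrightarrow> 1 * (p \<bullet> (y - x))) (at_right 0)"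
    by (rule filterlim_mono) (simp_all add: at_le)
  moreover have "eventually (\<lambda>t. (?F t - ?F 0) / (t - 0) \<le> f y - f x) (at_right 0)"
    unfolding eventually_at_right_field
  proof (intro exI[of _ 1] conjI allI impI)
    fix t :: real assume t: "0 < t" "t < 1"
    have "?F t = f ((1 - t) *\<^sub>R x + t *\<^sub>R y)" by (simp add: algebra_simps)
    also have "\<dots> \<le> (1 - t) * f x + t * f y" using convex_onD[OF cv _ _ x y, of t] t by simp
    finally show "(?F t - ?F 0) / (t - 0) \<le> f y - f x" using t by (simp add: field_simps)
  qed simp
  ultimately have "1 * (p \<bullet> (y - x)) \<le> f y - f x" by (rule tendsto_upperbound) simp
  then show "f x + p \<bullet> (y - x) \<le> f y" by simp
qed

lemma subgrad_unique_if_has_derivative: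
  assumes "open S" "x \<in> S" and d: "(f has_derivative (\<lambda>h. p \<bullet> h)) (at x)" and q: "subgrad S f x q"
  shows "q = p"
proof -
  have "((\<lambda>y. f y - q \<bullet> y) has_derivative (\<lambda>h. p \<bullet> h - q \<bullet> h)) (at x)"
    using d by (auto intro!: derivative_eq_intros)
  moreover have "eventually (\<lambda>y. f x - q \<bullet> x \<le> f y - q \<bullet> y) (at x)"
    using eventually_at_in_open'[OF assms(1,2)]
    by eventually_elim (use subgradD[OF q] in \<open>auto simp: inner_diff_right algebra_simps\<close>)
  ultimately have "(\<lambda>h. p \<bullet> h - q \<bullet> h) = (\<lambda>h. 0)" by (rule has_derivative_local_min)
  then have "p \<bullet> (p - q) - q \<bullet> (p - q) = 0" by metis
  then show ?thesis by (simp flip: inner_diff_left)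
qed

text \<open>The remainder \<open>g\<close> is convex, nonnegative near the origin and zero there, so
  one second difference bounds it linearly on a whole segment of each axis. Jensen's inequality
  carries the bound from the axes to every small vector.\<close>

lemma has_derivative_if_second_differences:
  fixes f :: "'a::euclidean_space \<Rightarrow> real"
  assumes S: "open S" and cv: "convex_on S f" and x: "x \<in> S" and p: "subgrad S f x p"
    and lim: "\<And>b. b \<in> Basis \<Longrightarrow>
      (\<lambda>n. real (Suc n) * (f (x + b /\<^sub>R Suc n) + f (x - b /\<^sub>R Suc n) - 2 * f x)) \<longlonglongrightarrow> 0"
  shows "(f has_derivative (\<lambda>h. p \<bullet> h)) (at x)"
  unfolding has_derivative_at_alt
proof (intro conjI allI impI)
  show "bounded_linear (\<lambda>h. p \<bullet> h)" by (rule bounded_linear_inner_right)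
  fix e :: real assume "0 < e"
  define g where "g h = f (x + h) - f x - p \<bullet> h" for h
  have g0: "0 \<le> g h" if "x + h \<in> S" for h using subgradD[OF p that] by (simp add: g_def)
  define s where "s n b = real (Suc n) * (g (b /\<^sub>R Suc n) + g (- b /\<^sub>R Suc n))" for n b
  have s_alt: "s n b = real (Suc n) * (f (x + b /\<^sub>R Suc n) + f (x - b /\<^sub>R Suc n) - 2 * f x)" for n b
    by (simp add: s_def g_def)
  have "(\<lambda>n. \<Sum>b\<in>Basis. s n b) \<longlonglongrightarrow> (\<Sum>b\<in>(Basis::'a set). 0)"
    unfolding s_alt by (intro tendsto_sum lim)
  then have ev1: "eventually (\<lambda>n. (\<Sum>b\<in>Basis. s n b) < e) sequentially"
    using \<open>0 < e\<close> by (intro order_tendstoD(2)[where a=e]) auto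
  obtain r where r: "0 < r" "ball x r \<subseteq> S" using S x by (meson openE)
  have ev2: "eventually (\<lambda>n. inverse (real (Suc n)) < r) sequentially"
    using LIMSEQ_inverse_real_of_nat \<open>0 < r\<close> by (rule order_tendstoD(2))
  obtain n where n: "(\<Sum>b\<in>Basis. s n b) < e" "inverse (real (Suc n)) < r"
    using eventually_happens'[OF sequentially_bot eventually_conj[OF ev1 ev2]] by blast
  define \<nu> where "\<nu> = real (Suc n)"
  have \<nu>: "0 < \<nu>" by (simp add: \<nu>_def)
  have inS: "x + c *\<^sub>R b \<in> S" if "b \<in> Basis" "\<bar>c\<bar> \<le> inverse \<nu>" for b c
    using r(2) n(2) that unfolding \<nu>_def by (intro subsetD[OF r(2)]) (auto simp: dist_norm)
  have along: "g (c *\<^sub>R b) \<le> \<bar>c\<bar> * s n b" if b: "b \<in> Basis" and c: "\<bar>c\<bar> \<le> inverse \<nu>" for b c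
  proof -
    \<comment> \<open>\<open>a\<close> is the axis point at distance \<open>inverse \<nu>\<close> on
      the side of \<open>c\<close>. Since \<open>g\<close> vanishes at the origin, convexity bounds
      \<open>g (c *\<^sub>R b)\<close> by the fraction \<open>\<bar>c\<bar> * \<nu>\<close> of
      \<open>g a\<close>.\<close>
    define a where "a = (sgn c * inverse \<nu>) *\<^sub>R b"
    have abs: "\<bar>sgn c * inverse \<nu>\<bar> \<le> inverse \<nu>" using \<nu> by (auto simp: sgn_if)
    have aS: "x + a \<in> S" unfolding a_def using b abs by (rule inS)
    let ?t = "\<bar>c\<bar> * \<nu>"
    have t: "0 \<le> ?t" "?t \<le> 1" using c \<nu> by (auto simp: field_simps)
    have ca: "c *\<^sub>R b = ?t *\<^sub>R a" using \<nu> by (simp add: a_def) (simp add: abs_mult_sgn mult.commute sgn_if)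
    have "x + c *\<^sub>R b = (1 - ?t) *\<^sub>R x + ?t *\<^sub>R (x + a)" unfolding ca by (simp add: algebra_simps)
    then have "f (x + c *\<^sub>R b) \<le> (1 - ?t) * f x + ?t * f (x + a)"
      using convex_onD[OF cv t x aS] by simp
    then have "g (c *\<^sub>R b) \<le> ?t * g a" by (simp add: g_def ca algebra_simps)
    also have "g a \<le> g (b /\<^sub>R Suc n) + g (- b /\<^sub>R Suc n)"
    proof -
      have "0 \<le> g (b /\<^sub>R Suc n)" "0 \<le> g (- b /\<^sub>R Suc n)"
        using g0[of "inverse \<nu> *\<^sub>R b"] g0[of "(- inverse \<nu>) *\<^sub>R b"] inS[OF b, of "inverse \<nu>"] inS[OF b, of "- inverse \<nu>"] \<nu>
        by (auto simp: \<nu>_def)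
      moreover have "c = 0 \<Longrightarrow> g a = 0" by (simp add: a_def g_def)
      ultimately show ?thesis by (cases "c = 0"; cases "0 < c") (auto simp: a_def \<nu>_def sgn_if)
    qed
    finally show ?thesis using \<nu> by (simp add: s_def \<nu>_def mult_left_mono)
  qed
  define d where "d = real DIM('a)"
  have d: "0 < d" by (simp add: d_def)
  show "\<exists>\<delta>>0. \<forall>y. norm (y - x) < \<delta> \<longrightarrow> norm (f y - f x - p \<bullet> (y - x)) \<le> e * norm (y - x)"
  proof (intro exI[of _ "inverse (\<nu> * d)"] conjI allI impI)
    show "0 < inverse (\<nu> * d)" using \<nu> d by simp
    fix y assume y: "norm (y - x) < inverse (\<nu> * d)"
    define h where "h = y - x"
    have hb: "\<bar>d * (h \<bullet> b)\<bar> \<le> inverse \<nu>" if "b \<in> Basis" for b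
    proof -
      have "\<bar>h \<bullet> b\<bar> \<le> inverse (\<nu> * d)" using y Basis_le_norm[OF that, of h] by (simp add: h_def)
      then show ?thesis using \<nu> d by (simp add: abs_mult field_simps)
    qed
    have "h = (\<Sum>b\<in>Basis. (h \<bullet> b) *\<^sub>R b)" by (simp add: euclidean_representation)
    \<comment> \<open>\<open>x + h\<close> is the average of \<open>d\<close> points on the axes
      through \<open>x\<close>, each displaced by \<open>d\<close> times a coordinate of
      \<open>h\<close>; hence the factor \<open>d\<close> in the radius.\<close>
    then have xh: "x + h = (\<Sum>b\<in>Basis. (1 / d) *\<^sub>R (x + (d * (h \<bullet> b)) *\<^sub>R b))"
      using d by (simp add: scaleR_add_right sum.distrib scaleR_sum_right[symmetric]) (simp add: d_def scaleR_conv_of_real sum_constant_scaleR)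
    have yS: "x + h \<in> S"
    proof -
      have "inverse (\<nu> * d) \<le> inverse \<nu>" using \<nu> d DIM_positive[where 'a='a] by (simp add: d_def field_simps)
      then have "norm (y - x) < r" using y n(2) unfolding \<nu>_def by linarith
      then show ?thesis by (intro subsetD[OF r(2)]) (simp add: h_def dist_norm norm_minus_commute)
    qed
    have "f (x + h) \<le> (\<Sum>b\<in>Basis. (1 / d) * f (x + (d * (h \<bullet> b)) *\<^sub>R b))"
      unfolding xh using d hb
      by (intro convex_on_sum[OF _ _ cv]) (auto simp: d_def intro!: inS)
    also have "\<dots> = (\<Sum>b\<in>Basis. (1 / d) * g ((d * (h \<bullet> b)) *\<^sub>R b) + (1 / d) * f x + (h \<bullet> b) * (p \<bullet> b))"
      using d by (intro sum.cong) (auto simp: g_def field_simps)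
    also have "\<dots> = (\<Sum>b\<in>Basis. (1 / d) * g ((d * (h \<bullet> b)) *\<^sub>R b)) + f x + p \<bullet> h"
      using d by (simp add: sum.distrib euclidean_inner[of p h] mult.commute) (simp add: d_def)
    finally have "g h \<le> (\<Sum>b\<in>Basis. (1 / d) * g ((d * (h \<bullet> b)) *\<^sub>R b))" by (simp add: g_def)
    also have "\<dots> \<le> (\<Sum>b\<in>Basis. norm h * s n b)"
    proof (rule sum_mono)
      fix b :: 'a assume b: "b \<in> Basis"
      have "0 \<le> g (b /\<^sub>R Suc n)" "0 \<le> g (- b /\<^sub>R Suc n)"
        using g0[of "inverse \<nu> *\<^sub>R b"] g0[of "(- inverse \<nu>) *\<^sub>R b"] inS[OF b, of "inverse \<nu>"] inS[OF b, of "- inverse \<nu>"] \<nu>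
        by (auto simp: \<nu>_def)
      then have s0: "0 \<le> s n b" by (simp add: s_def)
      have "(1 / d) * g ((d * (h \<bullet> b)) *\<^sub>R b) \<le> (1 / d) * (\<bar>d * (h \<bullet> b)\<bar> * s n b)"
        using along[OF b hb[OF b]] d by (intro mult_left_mono) auto
      also have "\<dots> = \<bar>h \<bullet> b\<bar> * s n b" using d by (simp add: abs_mult)
      also have "\<dots> \<le> norm h * s n b" using s0 Basis_le_norm[OF b] by (rule mult_right_mono[rotated])
      finally show "(1 / d) * g ((d * (h \<bullet> b)) *\<^sub>R b) \<le> norm h * s n b" .
    qed
    also have "\<dots> = norm h * (\<Sum>b\<in>Basis. s n b)" by (simp add: sum_distrib_left)
    also have "\<dots> \<le> norm h * e" using n(1) by (intro mult_left_mono) auto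
    finally show "norm (f y - f x - p \<bullet> (y - x)) \<le> e * norm (y - x)"
      using g0[OF yS] by (simp add: g_def h_def mult.commute)
  qed
qed

text \<open>Fubini in the direction \<open>b\<close>: by translation invariance, averaging the
  translates of \<open>N\<close> over \<open>t\<close> in the unit interval reproduces the measure
  of \<open>N\<close>, while for each fixed \<open>x\<close> the integral over \<open>t\<close> sees
  only a countable set.\<close>

lemma emeasure_lborel_zero_if_countable_on_lines:
  fixes N :: "'a::euclidean_space set"
  assumes [measurable]: "N \<in> sets borel" and cN: "\<And>x. countable {t. x + t *\<^sub>R b \<in> N}"
  shows "emeasure lborel N = 0"
proof -
  have tr: "(\<integral>\<^sup>+x. indicator N (x + t *\<^sub>R b) \<partial>lborel) = emeasure lborel N" for t :: real
  proof -
    have "emeasure lborel N = emeasure (distr lborel borel ((+) (t *\<^sub>R b))) N"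
      by (simp add: lborel_distr_plus)
    also have "\<dots> = (\<integral>\<^sup>+x. indicator N x \<partial>distr lborel borel ((+) (t *\<^sub>R b)))" by simp
    also have "\<dots> = (\<integral>\<^sup>+x. indicator N (x + t *\<^sub>R b) \<partial>lborel)"
      by (subst nn_integral_distr) (auto simp: add.commute)
    finally show ?thesis by simp
  qed
  have "emeasure lborel N = (\<integral>\<^sup>+t. indicator {0..1::real} t * emeasure lborel N \<partial>lborel)"
    by (simp add: nn_integral_multc)
  also have "\<dots> = (\<integral>\<^sup>+t. \<integral>\<^sup>+x. indicator {0..1::real} t * indicator N (x + t *\<^sub>R b) \<partial>lborel \<partial>lborel)"
    by (simp add: nn_integral_cmult tr)
  also have "\<dots> = (\<integral>\<^sup>+x. \<integral>\<^sup>+t. indicator {0..1::real} t * indicator N (x + t *\<^sub>R b) \<partial>lborel \<partial>lborel)"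
    by (rule lborel_pair.Fubini'[symmetric]) measurable
  also have "\<dots> = (\<integral>\<^sup>+x. 0 \<partial>(lborel :: 'a measure))"
  proof (rule nn_integral_cong)
    fix x :: 'a
    have "AE t in lborel. t \<notin> {t. x + t *\<^sub>R b \<in> N}"
      by (intro AE_not_in countable_imp_null_set_lborel cN)
    then have "(\<integral>\<^sup>+t. indicator {0..1::real} t * indicator N (x + t *\<^sub>R b) \<partial>lborel) = (\<integral>\<^sup>+t. 0 \<partial>(lborel::real measure))"
      by (intro nn_integral_cong_AE) auto
    then show "(\<integral>\<^sup>+t. indicator {0..1::real} t * indicator N (x + t *\<^sub>R b) \<partial>lborel) = 0" by simp
  qed
  finally show ?thesis by simp
qed

text \<open>Monotonicity of subgradients makes \<open>P \<bullet> b\<close> monotone on every line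
  in direction \<open>b\<close>, hence continuous along it off a countable set. Where it is
  continuous, the second difference in direction \<open>b\<close> is squeezed to zero. So each basis
  direction has a Lebesgue null bad set, and off their union the derivative exists.\<close>

lemma AE_has_derivative_if_subgrad:
  fixes f :: "'a::euclidean_space \<Rightarrow> real"
  assumes S: "open S" "convex S" and sg: "\<And>x. x \<in> S \<Longrightarrow> subgrad S f x (P x)"
  shows "AE x in lborel. x \<in> S \<longrightarrow> (f has_derivative (\<lambda>h. P x \<bullet> h)) (at x)"
proof -
  have cv: "convex_on S f" using S(2) sg by (rule convex_on_if_subgrad)
  \<comment> \<open>Extension by 0 gives a Borel function on the whole space, from which the bad
    sets \<open>N b\<close> inherit measurability; near a point of \<open>S\<close> it agrees with
    \<open>f\<close>.\<close>
  define F where "F x = (if x \<in> S then f x else 0)" for x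
  have [measurable]: "S \<in> sets borel" using S by simp
  have [measurable]: "F \<in> borel_measurable borel"
    unfolding F_def
    by (rule borel_measurable_continuous_on_if) (use convex_on_continuous[OF S(1) cv] in auto)
  define s where "s n x b = real (Suc n) * (F (x + b /\<^sub>R Suc n) + F (x - b /\<^sub>R Suc n) - 2 * F x)" for n x b
  have shift: "(\<lambda>n. x + c *\<^sub>R (b /\<^sub>R Suc n)) \<longlonglongrightarrow> x" for x b :: 'a and c
    using tendsto_add[OF tendsto_const tendsto_scaleR[OF tendsto_const tendsto_scaleR[OF LIMSEQ_inverse_real_of_nat tendsto_const]], of x c b] by simp
  have evS: "eventually (\<lambda>n. x + b /\<^sub>R Suc n \<in> S \<and> x - b /\<^sub>R Suc n \<in> S) sequentially" if "x \<in> S" for x b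
    using topological_tendstoD[OF shift[where c=1] S(1) that] topological_tendstoD[OF shift[where c="-1"] S(1) that]
    by eventually_elim auto
  define N where "N b = {x \<in> S. \<not> (\<lambda>n. s n x b) \<longlonglongrightarrow> 0}" for b
  have [measurable]: "(\<lambda>x. s n x b) \<in> borel_measurable borel" for n b unfolding s_def by measurable
  have "N b \<in> sets borel" for b
  proof -
    have *: "(\<lambda>n. s n x b) \<longlonglongrightarrow> 0 \<longleftrightarrow> (\<forall>m. \<exists>n0. \<forall>n\<ge>n0. \<bar>s n x b\<bar> < inverse (real (Suc m)))" for x
    proof
      assume "(\<lambda>n. s n x b) \<longlonglongrightarrow> 0"
      then show "\<forall>m. \<exists>n0. \<forall>n\<ge>n0. \<bar>s n x b\<bar> < inverse (real (Suc m))"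
        using LIMSEQ_D[of "\<lambda>n. s n x b" 0] by (simp add: real_norm_def)
    next
      assume *: "\<forall>m. \<exists>n0. \<forall>n\<ge>n0. \<bar>s n x b\<bar> < inverse (real (Suc m))"
      show "(\<lambda>n. s n x b) \<longlonglongrightarrow> 0"
      proof (rule LIMSEQ_I)
        fix r :: real assume "0 < r"
        then obtain m where "inverse (real (Suc m)) < r" using reals_Archimedean by blast
        moreover obtain n0 where "\<forall>n\<ge>n0. \<bar>s n x b\<bar> < inverse (real (Suc m))" using * by blast
        ultimately show "\<exists>no. \<forall>n\<ge>no. norm (s n x b - 0) < r" by (intro exI[of _ n0]) force
      qed
    qed
    have "N b = {x \<in> space borel. x \<in> S \<and> \<not> (\<forall>m. \<exists>n0. \<forall>n\<ge>n0. \<bar>s n x b\<bar> < inverse (real (Suc m)))}"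
      unfolding N_def * by auto
    also have "\<dots> \<in> sets borel" by measurable
    finally show ?thesis .
  qed
  moreover have "countable {t. x + t *\<^sub>R b \<in> N b}" for x b
  proof -
    define A where "A = {t. x + t *\<^sub>R b \<in> S}"
    have "A = (\<lambda>t. x + t *\<^sub>R b) -` S" by (auto simp: A_def)
    then have A: "open A" using S(1) by (auto intro!: open_vimage continuous_intros)
    define m where "m t = P (x + t *\<^sub>R b) \<bullet> b" for t
    have "mono_on A m"
    proof (rule mono_onI)
      fix t u assume tu: "t \<in> A" "u \<in> A" "t \<le> u"
      have "P (x + t *\<^sub>R b) \<bullet> ((u - t) *\<^sub>R b) \<le> P (x + u *\<^sub>R b) \<bullet> ((u - t) *\<^sub>R b)"
        using subgrad_monotone[OF sg sg, of "x + t *\<^sub>R b" "x + u *\<^sub>R b"] tu by (simp add: A_def scaleR_left_diff_distrib)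
      then show "m t \<le> m u" using tu by (cases "t = u") (auto simp: m_def)
    qed
    then have "countable {a\<in>A. \<not> isCont m a}" using A by (intro mono_on_ctble_discont_open)
    moreover have "{t. x + t *\<^sub>R b \<in> N b} \<subseteq> {a\<in>A. \<not> isCont m a}"
    proof (rule subsetI, rule ccontr)
      fix t assume tN: "t \<in> {t. x + t *\<^sub>R b \<in> N b}" and "t \<notin> {a\<in>A. \<not> isCont m a}"
      then have tA: "t \<in> A" and ct: "isCont m t" by (auto simp: A_def N_def)
      define y where "y = x + t *\<^sub>R b"
      have y: "y \<in> S" using tA by (simp add: A_def y_def)
      have l: "(\<lambda>n. m (t + c * inverse (real (Suc n)))) \<longlonglongrightarrow> m t" for c
        using tendsto_add[OF tendsto_const tendsto_mult[OF tendsto_const LIMSEQ_inverse_real_of_nat], of t c]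
        by (intro isCont_tendsto_compose[OF ct]) simp
      have up: "(\<lambda>n. m (t + 1 * inverse (real (Suc n))) - m (t + (-1) * inverse (real (Suc n)))) \<longlonglongrightarrow> 0"
        using tendsto_diff[OF l[of 1] l[of "-1"]] by simp
      have "eventually (\<lambda>n. 0 \<le> s n y b \<and> s n y b \<le> m (t + 1 * inverse (real (Suc n))) - m (t + (-1) * inverse (real (Suc n)))) sequentially"
        using evS[OF y, of b]
      proof eventually_elim
        case (elim n)
        define \<nu> where "\<nu> = real (Suc n)"
        have \<nu>: "0 < \<nu>" by (simp add: \<nu>_def)
        let ?u = "y + b /\<^sub>R \<nu>" and ?v = "y - b /\<^sub>R \<nu>"
        have uv: "?u \<in> S" "?v \<in> S" using elim by (auto simp: \<nu>_def)
        have mu: "m (t + 1 * inverse \<nu>) = P ?u \<bullet> b" "m (t + (-1) * inverse \<nu>) = P ?v \<bullet> b"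
          by (simp_all add: m_def y_def algebra_simps)
        have s: "s n y b = \<nu> * (f ?u + f ?v - 2 * f y)" using uv y by (simp add: s_def F_def \<nu>_def)
        \<comment> \<open>The subgradient at \<open>y\<close> gives the lower bound 0; the
          subgradients at the two displaced points give the upper bound.\<close>
        have "f y + P y \<bullet> (?u - y) \<le> f ?u" "f y + P y \<bullet> (?v - y) \<le> f ?v"
          by (rule subgradD[OF sg[OF y] uv(1)], rule subgradD[OF sg[OF y] uv(2)])
        then have "0 \<le> f ?u + f ?v - 2 * f y" by simp
        moreover have "f ?u + P ?u \<bullet> (y - ?u) \<le> f y" "f ?v + P ?v \<bullet> (y - ?v) \<le> f y"
          by (rule subgradD[OF sg[OF uv(1)] y], rule subgradD[OF sg[OF uv(2)] y])
        then have "f ?u + f ?v - 2 * f y \<le> (P ?u \<bullet> b - P ?v \<bullet> b) / \<nu>"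
          using \<nu> by (simp add: inner_diff_right field_simps)
        then have "\<nu> * (f ?u + f ?v - 2 * f y) \<le> P ?u \<bullet> b - P ?v \<bullet> b" using \<nu> by (simp add: field_simps)
        ultimately show ?case using \<nu> unfolding s \<nu>_def[symmetric] mu by simp
      qed
      then have "(\<lambda>n. s n y b) \<longlonglongrightarrow> 0"
        by (intro tendsto_sandwich[OF _ _ tendsto_const up]) (auto elim: eventually_mono)
      with tN show False by (simp add: N_def y_def)
    qed
    ultimately show ?thesis by (rule countable_subset[rotated])
  qed
  ultimately have "N b \<in> null_sets lborel" for b
    using emeasure_lborel_zero_if_countable_on_lines[of "N b" b] by auto
  then have "AE x in lborel. x \<notin> N b" for b by (rule AE_not_in)
  then have "AE x in lborel. \<forall>b\<in>Basis. x \<notin> N b" by (intro AE_finite_allI) auto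
  then show ?thesis
  proof eventually_elim
    case (elim x)
    show ?case
    proof
      assume x: "x \<in> S"
      show "(f has_derivative (\<lambda>h. P x \<bullet> h)) (at x)"
      proof (rule has_derivative_if_second_differences[OF S(1) cv x sg[OF x]])
        fix b :: 'a assume "b \<in> Basis"
        then have "(\<lambda>n. s n x b) \<longlonglongrightarrow> 0" using elim x by (auto simp: N_def)
        moreover have "eventually (\<lambda>n. s n x b = real (Suc n) * (f (x + b /\<^sub>R Suc n) + f (x - b /\<^sub>R Suc n) - 2 * f x)) sequentially"
          using evS[OF x, of b] by eventually_elim (use x in \<open>auto simp: s_def F_def\<close>)
        ultimately show "(\<lambda>n. real (Suc n) * (f (x + b /\<^sub>R Suc n) + f (x - b /\<^sub>R Suc n) - 2 * f x)) \<longlonglongrightarrow> 0"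
          by (rule Lim_transform_eventually)
      qed
    qed
  qed
qed

text \<open>Only \<open>f\<close> is differentiable at \<open>u\<close>; of \<open>f'\<close> just a
  subgradient at \<open>u\<close> is given. The exceptional null set can therefore be chosen from
  \<open>f\<close> alone, which is what convergence along the whole sequence demands.\<close>

lemma subgrad_eq_if_common_on_dense:
  fixes f f' :: "'a::euclidean_space \<Rightarrow> real"
  assumes S: "open S" and cv: "convex_on S f" and u: "u \<in> S"
    and d: "(f has_derivative (\<lambda>h. p \<bullet> h)) (at u)" and p': "subgrad S f' u p'"
    and dense: "\<And>V. open V \<Longrightarrow> V \<subseteq> S \<Longrightarrow> V \<noteq> {} \<Longrightarrow> \<exists>x\<in>V. \<exists>q. subgrad S f x q \<and> subgrad S f' x q"
  shows "p' = p"
proof -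
  have cont: "continuous_on S f" using S cv by (rule convex_on_continuous)
  define V where "V = {x \<in> S. 2 *\<^sub>R x - u \<in> S}"
  have "V = S \<inter> (\<lambda>x. 2 *\<^sub>R x - u) -` S" by (auto simp: V_def)
  then have V: "open V" using S by (auto intro!: open_Int open_vimage continuous_intros)
  have uV: "u \<in> V" using u by (simp add: V_def scaleR_2)
  \<comment> \<open>The reflection \<open>2 *\<^sub>R x - u\<close> repeats the step from
    \<open>u\<close> to \<open>x\<close>. If \<open>q\<close> is a common subgradient at
    \<open>x\<close>, this second step increases \<open>f\<close> by at least
    \<open>q \<bullet> (x - u)\<close>, which monotonicity for \<open>f'\<close> bounds below by
    \<open>p' \<bullet> (x - u)\<close>. Continuity of \<open>k\<close> extends the inequality from
    the dense set to all of \<open>V\<close>.\<close>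
  define k where "k x = f (2 *\<^sub>R x - u) - f x - p' \<bullet> (x - u)" for x
  have "continuous_on V k" unfolding k_def V_def
    by (intro continuous_intros continuous_on_compose2[OF cont]) auto
  then have "open (V \<inter> k -` {..<0})" using V by (intro continuous_open_preimage) auto
  have k0: "0 \<le> k x" if "x \<in> V" for x
  proof (rule ccontr)
    assume "\<not> 0 \<le> k x"
    then have "V \<inter> k -` {..<0} \<noteq> {}" using that by auto
    with dense[OF \<open>open (V \<inter> k -` {..<0})\<close>] obtain y q where y: "y \<in> V" "k y < 0"
      and q: "subgrad S f y q" "subgrad S f' y q" by (auto simp: V_def)
    have yS: "y \<in> S" "2 *\<^sub>R y - u \<in> S" using y by (auto simp: V_def)
    have "p' \<bullet> (y - u) \<le> q \<bullet> (y - u)" by (rule subgrad_monotone[OF p' q(2) u yS(1)])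
    moreover have "f y + q \<bullet> ((2 *\<^sub>R y - u) - y) \<le> f (2 *\<^sub>R y - u)" by (rule subgradD[OF q(1) yS(2)])
    moreover have "(2 *\<^sub>R y - u) - y = y - u" by (simp add: scaleR_2)
    ultimately show False using y(2) by (simp add: k_def)
  qed
  \<comment> \<open>In this direction the increment of \<open>f\<close> from
    \<open>u + t *\<^sub>R v\<close> to \<open>u + (2 * t) *\<^sub>R v\<close> has slope
    \<open>p \<bullet> v\<close> at \<open>t = 0\<close>; comparison with
    \<open>p' \<bullet> v\<close> leaves \<open>v \<bullet> v \<le> 0\<close>.\<close>
  define v where "v = p' - p"
  let ?F = "\<lambda>t. f (u + (2 * t) *\<^sub>R v) - f (u + (1 * t) *\<^sub>R v)"
  have "(?F has_real_derivative 2 * (p \<bullet> v) - 1 * (p \<bullet> v)) (at 0)"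
    by (intro DERIV_diff line_has_real_derivative d)
  then have "((\<lambda>t. (?F t - ?F 0) / (t - 0)) \<longlongrightarrow> 2 * (p \<bullet> v) - 1 * (p \<bullet> v)) (at 0)"
    by (simp add: has_field_derivative_iff)
  then have lim: "((\<lambda>t. (?F t - ?F 0) / (t - 0)) \<longlongrightarrow> 2 * (p \<bullet> v) - 1 * (p \<bullet> v)) (at_right 0)"
    by (rule filterlim_mono) (simp_all add: at_le)
  have "((\<lambda>t. u + t *\<^sub>R v) \<longlongrightarrow> u + 0 *\<^sub>R v) (at_right 0)" by (intro tendsto_intros)
  then have "eventually (\<lambda>t. u + t *\<^sub>R v \<in> V) (at_right 0)"
    using topological_tendstoD[OF _ V] uV by simp
  moreover have "eventually (\<lambda>t. 0 < (t::real)) (at_right 0)" by (simp add: eventually_at_right_less)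
  ultimately have "eventually (\<lambda>t. p' \<bullet> v \<le> (?F t - ?F 0) / (t - 0)) (at_right 0)"
  proof eventually_elim
    case (elim t)
    have "2 *\<^sub>R (u + t *\<^sub>R v) - u = u + (2 * t) *\<^sub>R v" by (simp add: scaleR_2 algebra_simps)
    then show ?case using k0[OF elim(1)] elim(2) by (simp add: k_def field_simps)
  qed
  with lim have "p' \<bullet> v \<le> 2 * (p \<bullet> v) - 1 * (p \<bullet> v)" by (rule tendsto_lowerbound) simp
  then have "v \<bullet> v \<le> 0" by (simp add: v_def inner_diff_left)
  then have "v = 0" using inner_gt_zero_iff[of v] by linarith
  then show ?thesis by (simp add: v_def)
qed

section \<open>Discrete targets\<close>

lemma finite_cover_selector:
  fixes L :: "'b::t1_space \<Rightarrow> 'a set"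
  assumes "finite J" and "\<And>y. y \<in> J \<Longrightarrow> L y \<in> sets M"
  shows "\<exists>Q\<in>borel_measurable M. \<forall>u\<in>(\<Union>y\<in>J. L y). Q u \<in> J \<and> u \<in> L (Q u)"
  using assms
proof (induction J)
  case empty
  show ?case by (rule bexI[of _ "\<lambda>_. undefined"]) auto
next
  case (insert y J)
  then obtain Q where [measurable]: "Q \<in> borel_measurable M"
    and Q: "\<And>u. u \<in> (\<Union>y\<in>J. L y) \<Longrightarrow> Q u \<in> J \<and> u \<in> L (Q u)"
    by auto
  have [measurable]: "L y \<in> sets M" using insert by auto
  have "(\<lambda>u. if u \<in> L y then y else Q u) \<in> borel_measurable M" by measurable
  then show ?case using Q by (intro bexI[of _ "\<lambda>u. if u \<in> L y then y else Q u"]) auto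
qed

text \<open>Laguerre cell: the region where the affine function with slope \<open>y\<close>
  dominates all those with slopes in \<open>J\<close>. Ties belong to every cell involved, which
  makes the cells closed.\<close>

definition cell :: "'a::real_inner set \<Rightarrow> ('a \<Rightarrow> real) \<Rightarrow> 'a \<Rightarrow> 'a set" where
  "cell J w y = {u. \<forall>y'\<in>J. u \<bullet> y' - w y' \<le> u \<bullet> y - w y}"

locale ac_prob_space = prob_space \<mu> for \<mu> :: "'a::euclidean_space measure" +
  assumes sets_eq[measurable_cong, simp]: "sets \<mu> = sets borel"
    and ac: "absolutely_continuous lborel \<mu>"
begin

lemma space_eq[simp]: "space \<mu> = UNIV"
  using sets_eq_imp_space_eq[OF sets_eq] by simp

lemma AE_from_lborel: "AE u in lborel. P u \<Longrightarrow> AE u in \<mu>. P u"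
  by (rule absolutely_continuous_AE[OF _ ac]) simp_all

lemma AE_not_hyperplane:
  assumes "a \<noteq> 0"
  shows "AE u in \<mu>. a \<bullet> u \<noteq> c"
proof -
  have "negligible {u. a \<bullet> u = c}" using assms by (intro negligible_hyperplane) simp
  moreover have "{u. a \<bullet> u = c} \<in> sets borel" by (intro borel_closed closed_hyperplane)
  ultimately have "{u. a \<bullet> u = c} \<in> null_sets lborel"
    by (simp add: negligible_iff_null_sets null_sets_completion_iff)
  then have "AE u in lborel. u \<notin> {u. a \<bullet> u = c}" by (rule AE_not_in)
  then show ?thesis by (intro AE_from_lborel) simp
qed

lemma cell_sets[measurable]: "finite J \<Longrightarrow> cell J w y \<in> sets borel"
proof -
  assume "finite J"
  have "cell J w y = (\<Inter>y'\<in>J. {u. u \<bullet> y' - w y' \<le> u \<bullet> y - w y})" by (auto simp: cell_def)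
  then have "closed (cell J w y)"
    by (auto intro!: closed_INT closed_Collect_le continuous_intros)
  then show ?thesis by simp
qed

lemma AE_strict_cells:
  assumes "finite J"
  shows "AE u in \<mu>. \<forall>y\<in>J. \<forall>y'\<in>J. y \<noteq> y' \<longrightarrow> u \<bullet> y' - w y' \<noteq> u \<bullet> y - w y"
proof (intro AE_finite_allI assms)
  fix y y' assume "y \<in> J" "y' \<in> J"
  show "AE u in \<mu>. y \<noteq> y' \<longrightarrow> u \<bullet> y' - w y' \<noteq> u \<bullet> y - w y"
  proof (cases "y = y'")
    case False
    then have "AE u in \<mu>. (y' - y) \<bullet> u \<noteq> w y' - w y" by (intro AE_not_hyperplane) simp
    then show ?thesis by eventually_elim (auto simp: inner_diff_left inner_diff_right inner_commute)
  qed simp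
qed

text \<open>Ties lie on finitely many hyperplanes, null by absolute continuity. Off them every
  comparison in force at \<open>w\<close> is strict and persists for large \<open>k\<close>, so the
  indicators converge, dominated by 1.\<close>

lemma measure_cell_tendsto:
  assumes J: "finite J" "y \<in> J" and W: "\<And>y. y \<in> J \<Longrightarrow> (\<lambda>k. W k y) \<longlonglongrightarrow> w y"
  shows "(\<lambda>k. measure \<mu> (cell J (W k) y)) \<longlonglongrightarrow> measure \<mu> (cell J w y)"
proof -
  have [measurable]: "cell J v y \<in> sets borel" for v using J(1) by (rule cell_sets)
  have "(\<lambda>k. \<integral>u. indicator (cell J (W k) y) u \<partial>\<mu>) \<longlonglongrightarrow> (\<integral>u. indicator (cell J w y) u \<partial>\<mu> :: real)"
  proof (rule integral_dominated_convergence[where w="\<lambda>_. 1"])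
    show "AE u in \<mu>. (\<lambda>k. indicator (cell J (W k) y) u :: real) \<longlonglongrightarrow> indicator (cell J w y) u"
      using AE_strict_cells[OF J(1), of w]
    proof eventually_elim
      case (elim u)
      have lim: "(\<lambda>k. (u \<bullet> y - W k y) - (u \<bullet> y' - W k y')) \<longlonglongrightarrow> (u \<bullet> y - w y) - (u \<bullet> y' - w y')" if "y' \<in> J" for y'
        by (intro tendsto_intros W J that)
      have "eventually (\<lambda>k. u \<in> cell J (W k) y \<longleftrightarrow> u \<in> cell J w y) sequentially"
      proof (cases "u \<in> cell J w y")
        case True
        have "eventually (\<lambda>k. u \<bullet> y' - W k y' \<le> u \<bullet> y - W k y) sequentially" if y': "y' \<in> J" for y'
        proof (cases "y' = y")
          case False
          then have "0 < (u \<bullet> y - w y) - (u \<bullet> y' - w y')" using True elim J y' by (force simp: cell_def)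
          from order_tendstoD(1)[OF lim[OF y'] this] show ?thesis by eventually_elim simp
        qed simp
        then have "eventually (\<lambda>k. \<forall>y'\<in>J. u \<bullet> y' - W k y' \<le> u \<bullet> y - W k y) sequentially"
          by (intro eventually_ball_finite J) auto
        then show ?thesis by eventually_elim (use True in \<open>auto simp: cell_def\<close>)
      next
        case False
        then obtain y' where y': "y' \<in> J" "(u \<bullet> y - w y) - (u \<bullet> y' - w y') < 0" by (auto simp: cell_def)
        from order_tendstoD(2)[OF lim[OF y'(1)] y'(2)] show ?thesis
          by eventually_elim (use False y' in \<open>auto simp: cell_def intro!: bexI[of _ y']\<close>)
      qed
      then show ?case
        by (intro tendsto_eventually) (auto elim!: eventually_mono simp: indicator_def)
    qed
  qed (auto simp: indicator_def)
  then show ?thesis by simp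
qed

text \<open>Raising the weight of one point against another pushes its cell into such a halfspace.
  This supplies both a first admissible weight and a lower bound on admissible weights.\<close>

lemma measure_halfspace_tendsto_0: "(\<lambda>k. measure \<mu> {u. real k \<le> a \<bullet> u}) \<longlonglongrightarrow> 0"
proof -
  have "(\<lambda>k. measure \<mu> {u. real k \<le> a \<bullet> u}) \<longlonglongrightarrow> measure \<mu> (\<Inter>k. {u. real k \<le> a \<bullet> u})"
    by (rule finite_Lim_measure_decseq) (auto simp: decseq_def intro: order_trans[rotated])
  moreover have "(\<Inter>k. {u. real k \<le> a \<bullet> u}) = {}"
  proof -
    have "\<exists>k. \<not> real k \<le> a \<bullet> u" for u using reals_Archimedean2[of "a \<bullet> u"] by (simp add: not_le)
    then show ?thesis by auto
  qed
  ultimately show ?thesis by simp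
qed

text \<open>The weights are found as the least element of a family of admissible weights that is closed
  under minima; shrinking one weight enlarges its own cell and shrinks all others.\<close>

lemma cell_weights_exist:
  assumes J: "finite J" "J \<noteq> {}" and pos: "\<And>y. y \<in> J \<Longrightarrow> 0 < \<nu> y" and sum1: "sum \<nu> J = 1"
  obtains w Q where "Q \<in> borel_measurable borel" "\<And>u. Q u \<in> J \<and> u \<in> cell J w (Q u)"
    "\<And>y. y \<in> J \<Longrightarrow> measure \<mu> (Q -` {y}) = \<nu> y"
proof -
  note [measurable] = cell_sets[OF J(1)]
  let ?m = "\<lambda>w y. measure \<mu> (cell J w y)"
  have cover: "(\<Union>y\<in>J. cell J w y) = UNIV" for w
  proof -
    have "\<exists>y\<in>J. u \<in> cell J w y" for u
    proof -
      have "Max ((\<lambda>y. u \<bullet> y - w y) ` J) \<in> (\<lambda>y. u \<bullet> y - w y) ` J" using J by (intro Max_in) auto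
      then obtain y where y: "y \<in> J" "Max ((\<lambda>y. u \<bullet> y - w y) ` J) = u \<bullet> y - w y" by auto
      have "u \<bullet> y' - w y' \<le> u \<bullet> y - w y" if "y' \<in> J" for y'
        unfolding y(2)[symmetric] using that J by (intro Max_ge) auto
      then show ?thesis using y(1) by (auto simp: cell_def)
    qed
    then show ?thesis by auto
  qed
  obtain y0 where y0: "y0 \<in> J" using J by auto
  \<comment> \<open>Only differences of weights matter, so the weight at \<open>y0\<close> is fixed
    to 0. The remaining cells may carry too little mass but not too much; the surplus sits in the
    cell of \<open>y0\<close>.\<close>
  define S where "S = {w. w y0 = 0 \<and> (\<forall>y\<in>J - {y0}. ?m w y \<le> \<nu> y)}"
  have S_min: "(\<lambda>y. min (w y) (v y)) \<in> S" if "w \<in> S" "v \<in> S" for w v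
  proof -
    have "?m (\<lambda>y. min (w y) (v y)) y \<le> \<nu> y" if y: "y \<in> J - {y0}" for y
    proof -
      \<comment> \<open>At \<open>y\<close> the minimum equals one of the two weights. Passing from
        that weight function to the minimum only lowers the weights of the competitors, and so can
        only shrink the cell of \<open>y\<close>.\<close>
      have "cell J (\<lambda>y. min (w y) (v y)) y \<subseteq> (if w y \<le> v y then cell J w y else cell J v y)"
      proof
        fix u assume u: "u \<in> cell J (\<lambda>y. min (w y) (v y)) y"
        have le: "u \<bullet> y' - min (w y') (v y') \<le> u \<bullet> y - min (w y) (v y)" if "y' \<in> J" for y'
          using u that by (simp add: cell_def)
        have "u \<bullet> y' - w y' \<le> u \<bullet> y - w y" if "y' \<in> J" "w y \<le> v y" for y'
          using le[OF that(1)] that(2) by linarith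
        moreover have "u \<bullet> y' - v y' \<le> u \<bullet> y - v y" if "y' \<in> J" "\<not> w y \<le> v y" for y'
          using le[OF that(1)] that(2) by linarith
        ultimately show "u \<in> (if w y \<le> v y then cell J w y else cell J v y)" by (simp add: cell_def)
      qed
      then have "?m (\<lambda>y. min (w y) (v y)) y \<le> measure \<mu> (if w y \<le> v y then cell J w y else cell J v y)"
        by (intro finite_measure_mono) auto
      also have "\<dots> \<le> \<nu> y" using that \<open>w \<in> S\<close> \<open>v \<in> S\<close> by (auto simp: S_def)
      finally show ?thesis .
    qed
    then show ?thesis using that by (auto simp: S_def)
  qed
  obtain w1 where w1: "w1 \<in> S"
  proof -
    define W where "W k y = (if y = y0 then 0 else real k)" for k :: nat and y
    have "eventually (\<lambda>k. ?m (W k) y \<le> \<nu> y) sequentially" if y: "y \<in> J - {y0}" for y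
    proof -
      have "eventually (\<lambda>k. measure \<mu> {u. real k \<le> (y - y0) \<bullet> u} < \<nu> y) sequentially"
        using y pos by (intro order_tendstoD(2)[OF measure_halfspace_tendsto_0]) auto
      then show ?thesis
      proof eventually_elim
        case (elim k)
        have "cell J (W k) y \<subseteq> {u. real k \<le> (y - y0) \<bullet> u}"
          using y y0 by (auto simp: cell_def W_def inner_diff_left inner_diff_right inner_commute dest!: bspec[where x=y0])
        then have "?m (W k) y \<le> measure \<mu> {u. real k \<le> (y - y0) \<bullet> u}" by (intro finite_measure_mono) auto
        with elim show ?case by simp
      qed
    qed
    then have "eventually (\<lambda>k. \<forall>y\<in>J - {y0}. ?m (W k) y \<le> \<nu> y) sequentially"
      by (intro eventually_ball_finite) (use J in auto)
    then obtain k where "\<forall>y\<in>J - {y0}. ?m (W k) y \<le> \<nu> y" using eventually_happens'[OF sequentially_bot] by blast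
    then have "W k \<in> S" by (auto simp: S_def W_def)
    then show thesis by (rule that)
  qed
  have cell_y0: "\<nu> y0 \<le> ?m w y0" if "w \<in> S" for w
  proof -
    have "1 = measure \<mu> (\<Union>y\<in>J. cell J w y)" unfolding cover using prob_space by simp
    also have "\<dots> \<le> (\<Sum>y\<in>J. ?m w y)" by (rule finite_measure_subadditive_finite) (use J in auto)
    also have "\<dots> = ?m w y0 + (\<Sum>y\<in>J - {y0}. ?m w y)" using J y0 by (simp add: sum.remove)
    also have "\<dots> \<le> ?m w y0 + (\<Sum>y\<in>J - {y0}. \<nu> y)" using that by (intro add_left_mono sum_mono) (auto simp: S_def)
    also have "(\<Sum>y\<in>J - {y0}. \<nu> y) = 1 - \<nu> y0" using sum1 J y0 by (simp add: sum.remove)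
    finally show ?thesis by simp
  qed
  have bdd: "bdd_below ((\<lambda>w. w y) ` S)" if y: "y \<in> J" for y
  proof (cases "y = y0")
    case True
    then show ?thesis by (intro bdd_belowI[of _ 0]) (auto simp: S_def)
  next
    case False
    \<comment> \<open>A very negative weight at \<open>y\<close> would squeeze the cell of
      \<open>y0\<close> into a far halfspace, although that cell must keep mass at least
      \<open>\<nu> y0\<close>.\<close>
    have "eventually (\<lambda>k. measure \<mu> {u. real k \<le> (y0 - y) \<bullet> u} < \<nu> y0) sequentially"
      using y0 pos by (intro order_tendstoD(2)[OF measure_halfspace_tendsto_0]) auto
    then obtain k where k: "measure \<mu> {u. real k \<le> (y0 - y) \<bullet> u} < \<nu> y0"
      using eventually_happens'[OF sequentially_bot] by blast
    have "- real k \<le> w y" if w: "w \<in> S" for w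
    proof (rule ccontr)
      assume "\<not> - real k \<le> w y"
      then have "cell J w y0 \<subseteq> {u. real k \<le> (y0 - y) \<bullet> u}"
        using y w by (auto simp: S_def cell_def inner_diff_left inner_diff_right inner_commute dest!: bspec[where x=y and A=J])
      then have "?m w y0 \<le> measure \<mu> {u. real k \<le> (y0 - y) \<bullet> u}" by (intro finite_measure_mono) auto
      with k cell_y0[OF w] show False by simp
    qed
    then show ?thesis by (intro bdd_belowI[of _ "- real k"]) auto
  qed
  define ws where "ws y = Inf ((\<lambda>w. w y) ` S)" for y
  have ws_le: "ws y \<le> w y" if "w \<in> S" "y \<in> J" for w y
    unfolding ws_def using that bdd by (intro cInf_lower) auto
  \<comment> \<open>Closure under minima lets a single admissible weight be near the infimum at all
    points of \<open>J\<close> at once, so the infimum is a limit of admissible weights.\<close>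
  have approx: "\<exists>w\<in>S. \<forall>y\<in>J'. w y < ws y + e" if "finite J'" "J' \<subseteq> J" "0 < e" for J' and e :: real
    using that(1,2)
  proof (induction J')
    case empty
    then show ?case using w1 by auto
  next
    case (insert y J')
    then obtain w where w: "w \<in> S" "\<forall>y\<in>J'. w y < ws y + e" by auto
    have "\<exists>a\<in>(\<lambda>w. w y) ` S. a < ws y + e"
      unfolding ws_def using w1 \<open>0 < e\<close> by (intro cInf_lessD) auto
    then obtain v where v: "v \<in> S" "v y < ws y + e" by auto
    show ?case using S_min[OF w(1) v(1)] w(2) v(2) by (intro bexI[of _ "\<lambda>y. min (w y) (v y)"]) auto
  qed
  have "\<exists>W. \<forall>k. W k \<in> S \<and> (\<forall>y\<in>J. W k y < ws y + inverse (real (Suc k)))"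
  proof (rule choice, rule allI)
    fix k :: nat
    show "\<exists>w. w \<in> S \<and> (\<forall>y\<in>J. w y < ws y + inverse (real (Suc k)))"
      using approx[OF J(1) subset_refl, of "inverse (real (Suc k))"] by auto
  qed
  then obtain W where W: "\<And>k. W k \<in> S" "\<And>k y. y \<in> J \<Longrightarrow> W k y < ws y + inverse (real (Suc k))"
    by blast
  have W_lim: "(\<lambda>k. W k y) \<longlonglongrightarrow> ws y" if y: "y \<in> J" for y
  proof (rule tendsto_sandwich[OF _ _ tendsto_const])
    show "eventually (\<lambda>k. ws y \<le> W k y) sequentially" using ws_le[OF W(1) y] by simp
    show "eventually (\<lambda>k. W k y \<le> ws y + inverse (real (Suc k))) sequentially"
      using W(2)[OF y] by (simp add: less_imp_le)
    show "(\<lambda>k. ws y + inverse (real (Suc k))) \<longlonglongrightarrow> ws y"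
      using tendsto_add[OF tendsto_const LIMSEQ_inverse_real_of_nat, of "ws y"] by simp
  qed
  have wsS: "ws \<in> S"
  proof -
    have "ws y0 = 0" using W_lim[OF y0] W(1) by (auto simp: S_def LIMSEQ_const_iff)
    moreover have "?m ws y \<le> \<nu> y" if y: "y \<in> J - {y0}" for y
      using measure_cell_tendsto[OF J(1) _ W_lim, of y] y W(1)
      by (intro LIMSEQ_le_const2[where X="\<lambda>k. ?m (W k) y"]) (auto simp: S_def)
    ultimately show ?thesis by (auto simp: S_def)
  qed
  have eq: "?m ws y = \<nu> y" if y: "y \<in> J - {y0}" for y
  proof (rule ccontr)
    assume "?m ws y \<noteq> \<nu> y"
    then have less: "?m ws y < \<nu> y" using wsS y by (auto simp: S_def less_le)
    \<comment> \<open>If the cell of \<open>y\<close> had room left, continuity of the masses would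
      allow a slightly smaller weight at \<open>y\<close> that is still admissible, against
      minimality.\<close>
    define V where "V k = ws(y := ws y - inverse (real (Suc k)))" for k
    have "(\<lambda>k. V k y') \<longlonglongrightarrow> ws y'" for y'
      using tendsto_diff[OF tendsto_const LIMSEQ_inverse_real_of_nat, of "ws y"] by (cases "y' = y") (auto simp: V_def)
    then have "(\<lambda>k. ?m (V k) y) \<longlonglongrightarrow> ?m ws y" using y by (intro measure_cell_tendsto J) auto
    from order_tendstoD(2)[OF this less] obtain k where k: "?m (V k) y < \<nu> y"
      using eventually_happens'[OF sequentially_bot] by blast
    have "V k \<in> S"
    proof -
      have "?m (V k) y' \<le> \<nu> y'" if y': "y' \<in> J - {y0}" for y'
      proof (cases "y' = y")
        case True
        then show ?thesis using k by simp
      next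
        case False
        have "cell J (V k) y' \<subseteq> cell J ws y'"
        proof
          fix u assume u: "u \<in> cell J (V k) y'"
          have "V k y'' \<le> ws y''" for y'' by (simp add: V_def)
          moreover have "V k y' = ws y'" using False by (simp add: V_def)
          moreover have "u \<bullet> y'' - V k y'' \<le> u \<bullet> y' - V k y'" if "y'' \<in> J" for y''
            using u that by (simp add: cell_def)
          ultimately have "u \<bullet> y'' - ws y'' \<le> u \<bullet> y' - ws y'" if "y'' \<in> J" for y''
            using that by (metis diff_left_mono order_trans)
          then show "u \<in> cell J ws y'" by (simp add: cell_def)
        qed
        then have "?m (V k) y' \<le> ?m ws y'" by (intro finite_measure_mono) auto
        moreover have "?m ws y' \<le> \<nu> y'" using wsS y' by (simp add: S_def)
        ultimately show ?thesis by linarith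
      qed
      then show ?thesis using y wsS by (auto simp: S_def V_def)
    qed
    then have "ws y \<le> V k y" using y by (intro ws_le) auto
    then show False by (simp add: V_def)
  qed
  obtain Q where Qm[measurable]: "Q \<in> borel_measurable borel" and Q: "\<And>u. Q u \<in> J \<and> u \<in> cell J ws (Q u)"
    using finite_cover_selector[OF J(1), of "cell J ws" borel] cover[of ws] by auto
  have Qm_eq: "measure \<mu> (Q -` {y}) = ?m ws y" if y: "y \<in> J" for y
  proof (rule measure_eq_AE)
    show "AE u in \<mu>. u \<in> Q -` {y} \<longleftrightarrow> u \<in> cell J ws y"
      using AE_strict_cells[OF J(1), of ws]
    proof eventually_elim
      case (elim u)
      have "u \<bullet> y - ws y \<le> u \<bullet> Q u - ws (Q u)" using Q[of u] y by (simp add: cell_def)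
      moreover have "u \<bullet> Q u - ws (Q u) \<le> u \<bullet> y - ws y" if "u \<in> cell J ws y"
        using Q[of u] that by (simp add: cell_def)
      moreover have "y = Q u" if "u \<bullet> Q u - ws (Q u) = u \<bullet> y - ws y"
        using elim y Q[of u] that by blast
      ultimately show ?case using Q[of u] by force
    qed
    show "Q -` {y} \<in> sets \<mu>" using measurable_sets[OF Qm, of "{y}"] by simp
  qed simp
  have "measure \<mu> (Q -` {y}) = \<nu> y" if y: "y \<in> J" for y
  proof (cases "y = y0")
    case True
    have "(\<Union>y\<in>J. Q -` {y}) = UNIV" using Q by auto
    then have "1 = measure \<mu> (\<Union>y\<in>J. Q -` {y})" using prob_space by simp
    also have "\<dots> = (\<Sum>y\<in>J. measure \<mu> (Q -` {y}))"
      using measurable_sets[OF Qm, of "{_}"]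
      by (intro finite_measure_finite_Union J) (auto simp: disjoint_family_on_def)
    also have "\<dots> = measure \<mu> (Q -` {y0}) + (\<Sum>y\<in>J - {y0}. \<nu> y)"
      using J y0 eq by (simp add: sum.remove Qm_eq)
    also have "(\<Sum>y\<in>J - {y0}. \<nu> y) = 1 - \<nu> y0" using sum1 J y0 by (simp add: sum.remove)
    finally show ?thesis by (simp add: True)
  qed (use eq Qm_eq y in auto)
  then show thesis by (rule that[OF Qm Q])
qed

lemma semidiscrete_transport:
  assumes J: "finite J" "J \<noteq> {}" and pos: "\<And>y. y \<in> J \<Longrightarrow> 0 < \<nu> y" and sum1: "sum \<nu> J = 1"
  obtains Q \<phi> where "Q \<in> borel_measurable borel" "\<And>u. Q u \<in> J" "\<And>u. subgrad UNIV \<phi> u (Q u)"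
    "\<And>y. y \<in> J \<Longrightarrow> measure \<mu> (Q -` {y}) = \<nu> y"
proof (rule cell_weights_exist[OF assms])
  fix w Q assume Q: "Q \<in> borel_measurable borel" "\<And>u. Q u \<in> J \<and> u \<in> cell J w (Q u)"
    "\<And>y. y \<in> J \<Longrightarrow> measure \<mu> (Q -` {y}) = \<nu> y"
  define \<phi> where "\<phi> u = Max ((\<lambda>y. u \<bullet> y - w y) ` J)" for u
  have "subgrad UNIV \<phi> u (Q u)" for u
    unfolding subgrad_def
  proof
    fix v
    have "\<phi> u = u \<bullet> Q u - w (Q u)"
      unfolding \<phi>_def using Q(2)[of u] J by (intro Max_eqI) (auto simp: cell_def)
    then have "\<phi> u + Q u \<bullet> (v - u) = v \<bullet> Q u - w (Q u)" by (simp add: inner_diff_right inner_commute)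
    also have "\<dots> \<le> \<phi> v" unfolding \<phi>_def using Q(2)[of u] J by (intro Max_ge) auto
    finally show "\<phi> u + Q u \<bullet> (v - u) \<le> \<phi> v" .
  qed
  moreover have "Q u \<in> J" for u using Q(2) by simp
  ultimately show thesis using that[of Q \<phi>] Q(1,3) by simp
qed

end

section \<open>Uniqueness and compactness tools\<close>

text \<open>Glue two copies \<open>x\<close>, \<open>m\<close> of the source along \<open>\<nabla>\<phi>(x) = \<nabla>\<psi>(m)\<close>. The subgradient inequalities give
  \<open>(\<phi> - \<psi>)(x) \<le> (\<phi> - \<psi>)(m)\<close>; both sides have the same law, so equality holds almost surely,
  and then \<open>\<nabla>\<psi>(m)\<close> is a subgradient of \<open>\<phi>\<close> at \<open>m\<close>.\<close>

lemma convex_gradient_unique: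
  fixes \<mu> :: "'a::euclidean_space measure"
  assumes "prob_space \<mu>" and sets_mu[measurable_cong, simp]: "sets \<mu> = sets borel" and Os: "open Os"
    and cv: "convex_on Os \<phi>" "convex_on Os \<psi>"
    and [measurable]: "S \<in> borel_measurable borel" "T \<in> borel_measurable borel"
    and S: "AE u in \<mu>. u \<in> Os \<and> (\<phi> has_derivative (\<lambda>h. S u \<bullet> h)) (at u)"
    and T: "AE u in \<mu>. u \<in> Os \<and> (\<psi> has_derivative (\<lambda>h. T u \<bullet> h)) (at u)"
    and eq: "distr \<mu> borel S = distr \<mu> borel T"
  shows "AE u in \<mu>. S u = T u"
proof -
  interpret prob_space \<mu> by fact
  interpret U: prob_space unit_uniform by (rule prob_space_unit_uniform)
  have [simp]: "space \<mu> = UNIV" using sets_eq_imp_space_eq[OF sets_mu] by simp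
  have [measurable]: "S \<in> borel_measurable \<mu>" "T \<in> borel_measurable \<mu>"
    by (simp_all cong: measurable_cong_sets)
  define P where "P = \<mu> \<Otimes>\<^sub>M unit_uniform"
  interpret P: pair_prob_space \<mu> unit_uniform ..
  have sets_P[measurable_cong]: "sets P = sets (borel \<Otimes>\<^sub>M unit_uniform)"
    unfolding P_def by (intro sets_pair_measure_cong) auto
  interpret PP: prob_space P unfolding P_def by unfold_locales
  obtain g where g[measurable]: "g \<in> borel_measurable (borel \<Otimes>\<^sub>M unit_uniform)"
    and g_law: "distr (distr \<mu> borel S \<Otimes>\<^sub>M unit_uniform) (borel \<Otimes>\<^sub>M borel) (\<lambda>(s, t). (g (s, t), s))
       = distr \<mu> (borel \<Otimes>\<^sub>M borel) (\<lambda>u. (u, S u))"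
    by (rule randomization[OF \<open>prob_space \<mu>\<close>, of "\<lambda>u. u" S borel]) auto
  \<comment> \<open>Given \<open>T m\<close>, the point \<open>x\<close> is drawn from the
    conditional law of \<open>u\<close> given \<open>S u\<close>. As \<open>S\<close> and
    \<open>T\<close> have the same law, \<open>x\<close> again has law \<open>\<mu>\<close>, and
    \<open>S x = T m\<close> almost surely.\<close>
  define x where "x = (\<lambda>(m, t). g (T m, t))"
  have [measurable]: "x \<in> borel_measurable P" unfolding x_def by measurable
  have [measurable]: "fst \<in> borel_measurable P" by measurable
  have "distr \<mu> borel T \<Otimes>\<^sub>M unit_uniform = distr \<mu> borel T \<Otimes>\<^sub>M distr unit_uniform unit_uniform (\<lambda>t. t)"
    by simp
  also have "\<dots> = distr P (borel \<Otimes>\<^sub>M unit_uniform) (\<lambda>(m, t). (T m, t))"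
    unfolding P_def by (rule pair_measure_distr) (auto intro: U.sigma_finite_measure_axioms)
  finally have TU: "distr \<mu> borel T \<Otimes>\<^sub>M unit_uniform = distr P (borel \<Otimes>\<^sub>M unit_uniform) (\<lambda>(m, t). (T m, t))" .
  have law: "distr P (borel \<Otimes>\<^sub>M borel) (\<lambda>w. (x w, T (fst w))) = distr \<mu> (borel \<Otimes>\<^sub>M borel) (\<lambda>u. (u, S u))"
    unfolding g_law[symmetric] eq TU
    by (subst distr_distr) (auto simp: comp_def x_def split_beta')
  have law_fst: "distr P borel fst = \<mu>"
  proof -
    have "distr P borel fst = distr P \<mu> fst" by (rule distr_cong) simp_all
    then show ?thesis unfolding P_def using U.distr_pair_fst by simp
  qed
  have law_x: "distr P borel x = \<mu>"
  proof -
    have "distr P borel x = distr (distr P (borel \<Otimes>\<^sub>M borel) (\<lambda>w. (x w, T (fst w)))) borel fst"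
      by (subst distr_distr) (auto simp: comp_def)
    also have "\<dots> = distr \<mu> borel (\<lambda>u. u)" unfolding law by (subst distr_distr) (auto simp: comp_def)
    also have "\<dots> = distr \<mu> \<mu> (\<lambda>u. u)" by (rule distr_cong) simp_all
    finally show ?thesis by simp
  qed
  define good where "good u \<longleftrightarrow> u \<in> Os \<and> (\<phi> has_derivative (\<lambda>h. S u \<bullet> h)) (at u) \<and>
    (\<psi> has_derivative (\<lambda>h. T u \<bullet> h)) (at u)" for u
  from S T have "AE u in \<mu>. good u" unfolding good_def by eventually_elim auto
  then obtain N where N: "N \<in> null_sets \<mu>" and N_good: "\<And>u. u \<in> space \<mu> - N \<Longrightarrow> good u"
    by (rule AE_E3) auto
  have Ngood: "u \<in> Os \<and> (\<phi> has_derivative (\<lambda>h. S u \<bullet> h)) (at u) \<and> (\<psi> has_derivative (\<lambda>h. T u \<bullet> h)) (at u)"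
    if "u \<notin> N" for u using N_good[of u] that by (simp add: good_def)
  have [measurable]: "N \<in> sets borel" using N by auto
  have AE_N: "AE u in \<mu>. u \<notin> N" using N by (rule AE_not_in)
  have AE_m: "AE w in P. fst w \<notin> N"
    using AE_N unfolding law_fst[symmetric] by (subst (asm) AE_distr_iff) auto
  have AE_x: "AE w in P. x w \<notin> N"
    using AE_N by (subst (asm) law_x[symmetric], subst (asm) AE_distr_iff) auto
  have AE_q: "AE w in P. S (x w) = T (fst w)"
  proof -
    have "AE v in distr \<mu> (borel \<Otimes>\<^sub>M borel) (\<lambda>u. (u, S u)). S (fst v) = snd v"
      by (subst AE_distr_iff) auto
    then show ?thesis unfolding law[symmetric] by (subst (asm) AE_distr_iff) auto
  qed
  \<comment> \<open>\<open>\<phi> - \<psi>\<close> need not be integrable. The bounded and strictly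
    increasing \<open>arctan\<close> keeps the order and makes the expectations of both copies
    finite, hence equal, so that their ordered difference vanishes almost surely.\<close>
  define H where "H u = (if u \<in> Os then arctan (\<phi> u - \<psi> u) else 0)" for u
  have [measurable]: "H \<in> borel_measurable borel" unfolding H_def
    by (rule borel_measurable_continuous_on_if)
      (use Os convex_on_continuous[OF Os cv(1)] convex_on_continuous[OF Os cv(2)] in \<open>auto intro!: continuous_intros\<close>)
  have H_bd: "\<bar>H u\<bar> \<le> pi / 2" for u using arctan_bounded[of "\<phi> u - \<psi> u"] by (auto simp: H_def)
  have intH: "integrable P (\<lambda>w. H (fst w))" "integrable P (\<lambda>w. H (x w))"
    by (rule PP.integrable_const_bound[where B="pi / 2"]; use H_bd in auto)+
  have "(\<integral>w. H (fst w) - H (x w) \<partial>P) = (\<integral>w. H (fst w) \<partial>P) - (\<integral>w. H (x w) \<partial>P)"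
    using intH by (rule Bochner_Integration.integral_diff)
  also have "(\<integral>w. H (fst w) \<partial>P) = (\<integral>u. H u \<partial>distr P borel fst)" by (subst integral_distr) auto
  also have "(\<integral>w. H (x w) \<partial>P) = (\<integral>u. H u \<partial>distr P borel x)" by (subst integral_distr) auto
  finally have int0: "(\<integral>w. H (fst w) - H (x w) \<partial>P) = 0" by (simp add: law_fst law_x)
  have ineq: "\<phi> (x w) + S (x w) \<bullet> (fst w - x w) \<le> \<phi> (fst w)" "\<psi> (fst w) - S (x w) \<bullet> (fst w - x w) \<le> \<psi> (x w)"
    if "fst w \<notin> N" "x w \<notin> N" "S (x w) = T (fst w)" for w
  proof -
    note gx = Ngood[OF that(2)] and gm = Ngood[OF that(1)]
    show "\<phi> (x w) + S (x w) \<bullet> (fst w - x w) \<le> \<phi> (fst w)"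
      using gx gm by (intro subgradD[OF subgrad_if_has_derivative[OF cv(1)]]) auto
    have "\<psi> (fst w) + T (fst w) \<bullet> (x w - fst w) \<le> \<psi> (x w)"
      using gx gm by (intro subgradD[OF subgrad_if_has_derivative[OF cv(2)]]) auto
    then show "\<psi> (fst w) - S (x w) \<bullet> (fst w - x w) \<le> \<psi> (x w)"
      unfolding that(3) by (simp add: inner_diff_right)
  qed
  have "AE w in P. 0 \<le> H (fst w) - H (x w)"
    using AE_m AE_x AE_q
  proof eventually_elim
    case (elim w)
    have "\<phi> (x w) - \<psi> (x w) \<le> \<phi> (fst w) - \<psi> (fst w)" using ineq[OF elim] by linarith
    then show ?case using Ngood[OF elim(1)] Ngood[OF elim(2)] by (simp add: H_def arctan_le_iff)
  qed
  then have "AE w in P. H (fst w) - H (x w) = 0"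
    using integral_nonneg_eq_0_iff_AE[of P "\<lambda>w. H (fst w) - H (x w)"] int0 intH by simp
  with AE_m AE_x AE_q have "AE w in P. S (fst w) = T (fst w)"
  proof eventually_elim
    case (elim w)
    note gx = Ngood[OF elim(2)] and gm = Ngood[OF elim(1)]
    have "arctan (\<phi> (fst w) - \<psi> (fst w)) = arctan (\<phi> (x w) - \<psi> (x w))" using elim(4) gx gm by (simp add: H_def)
    then have e: "\<phi> (fst w) - \<psi> (fst w) = \<phi> (x w) - \<psi> (x w)" by (simp add: arctan_eq_iff)
    have eq': "\<phi> (fst w) = \<phi> (x w) + S (x w) \<bullet> (fst w - x w)" using ineq[OF elim(1-3)] e by linarith
    have "subgrad Os \<phi> (x w) (S (x w))" using gx by (intro subgrad_if_has_derivative[OF cv(1)]) auto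
    then have "subgrad Os \<phi> (fst w) (S (x w))"
      unfolding subgrad_def eq' by (simp add: inner_diff_right algebra_simps)
    then have "S (x w) = S (fst w)" using gm by (intro subgrad_unique_if_has_derivative[OF Os]) auto
    with elim(3) show ?case by simp
  qed
  then have "AE u in distr P borel fst. S u = T u" by (subst AE_distr_iff) auto
  then show ?thesis unfolding law_fst .
qed

section \<open>Test functions, cluster points and diagonal subsequences\<close>

lemma measure_eqI_continuous:
  fixes \<mu> \<nu> :: "'a::metric_space measure"
  assumes fin: "finite_measure \<mu>" "finite_measure \<nu>"
    and sets[simp]: "sets \<mu> = sets borel" "sets \<nu> = sets borel"
    and eq: "\<And>f::'a \<Rightarrow> real. continuous_on UNIV f \<Longrightarrow> (\<And>x. 0 \<le> f x \<and> f x \<le> 1) \<Longrightarrow> (\<integral>x. f x \<partial>\<mu>) = (\<integral>x. f x \<partial>\<nu>)"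
  shows "\<mu> = \<nu>"
proof (rule measure_eqI_generator_eq[where E="{S. open S}" and \<Omega>=UNIV and A="\<lambda>_. UNIV"])
  have sp[simp]: "space \<mu> = UNIV" "space \<nu> = UNIV"
    using sets_eq_imp_space_eq[OF sets(1)] sets_eq_imp_space_eq[OF sets(2)] by auto
  show "Int_stable {S::'a set. open S}" by (auto simp: Int_stable_def)
  show "sets \<mu> = sigma_sets UNIV {S. open S}" "sets \<nu> = sigma_sets UNIV {S. open S}"
    by (simp_all add: borel_def)
  show "emeasure \<mu> UNIV \<noteq> \<infinity>" using finite_measure.emeasure_finite[OF fin(1)] by simp
  \<comment> \<open>Truncated multiples of the distance to the complement increase to the indicator
    of an open set, and open sets are a generator stable under intersection.\<close>
  have conv: "(\<lambda>k. \<integral>x. min 1 (real k * infdist x (- V)) \<partial>\<rho>) \<longlonglongrightarrow> measure \<rho> V"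
    if V: "open V" "V \<noteq> UNIV" and \<rho>: "finite_measure \<rho>" "sets \<rho> = sets borel" for V and \<rho> :: "'a measure"
  proof -
    interpret finite_measure \<rho> by fact
    note [measurable_cong] = \<rho>(2)
    have [simp]: "space \<rho> = UNIV" using sets_eq_imp_space_eq[OF \<rho>(2)] by simp
    have "(\<lambda>k. \<integral>x. min 1 (real k * infdist x (- V)) \<partial>\<rho>) \<longlonglongrightarrow> (\<integral>x. indicator V x \<partial>\<rho>)"
    proof (rule integral_dominated_convergence[where w="\<lambda>_. 1"])
      have [measurable]: "(\<lambda>x. infdist x (- V)) \<in> borel_measurable borel"
        by (intro borel_measurable_continuous_onI continuous_intros)
      show "(\<lambda>x. min 1 (real k * infdist x (- V))) \<in> borel_measurable \<rho>" for k by measurable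
      show "(indicator V :: 'a \<Rightarrow> real) \<in> borel_measurable \<rho>" using V \<rho> by (intro borel_measurable_indicator) simp
      show "AE x in \<rho>. (\<lambda>k. min 1 (real k * infdist x (- V))) \<longlonglongrightarrow> indicator V x"
      proof (rule AE_I2)
        fix x
        show "(\<lambda>k. min 1 (real k * infdist x (- V))) \<longlonglongrightarrow> indicator V x"
        proof (cases "x \<in> V")
          case True
          have "infdist x (- V) \<noteq> 0"
            using in_closed_iff_infdist_zero[of "- V" x] V True by (auto simp: closed_def)
          then have pos: "0 < infdist x (- V)" using infdist_nonneg[of x "- V"] by linarith
          obtain k0 where "1 / infdist x (- V) < real k0" using reals_Archimedean2 by blast
          then have k0: "1 < real k0 * infdist x (- V)" using pos by (simp add: field_simps)
          have "min 1 (real k * infdist x (- V)) = 1" if "k0 \<le> k" for k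
          proof -
            have "real k0 * infdist x (- V) \<le> real k * infdist x (- V)" using that pos by (intro mult_right_mono) auto
            with k0 show ?thesis by linarith
          qed
          then have "eventually (\<lambda>k. min 1 (real k * infdist x (- V)) = 1) sequentially"
            by (rule eventually_sequentiallyI)
          then show ?thesis using True by (auto intro: tendsto_eventually)
        next
          case False
          then have "infdist x (- V) = 0" by simp
          then show ?thesis using False by simp
        qed
      qed
    qed (auto intro!: AE_I2 simp: infdist_nonneg)
    then show ?thesis using V \<rho> by simp
  qed
  show "emeasure \<mu> V = emeasure \<nu> V" if "V \<in> {S. open S}" for V
  proof -
    have "measure \<mu> V = measure \<nu> V"
    \<comment> \<open>The distance to an empty complement is 0 by convention, so the whole space is
      tested with the constant 1.\<close>
    proof (cases "V = UNIV")
      case True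
      then show ?thesis using eq[of "\<lambda>_. 1"] by simp
    next
      case False
      have "(\<integral>x. min 1 (real k * infdist x (- V)) \<partial>\<mu>) = (\<integral>x. min 1 (real k * infdist x (- V)) \<partial>\<nu>)" for k
        by (intro eq continuous_intros) (auto simp: infdist_nonneg)
      then show ?thesis
        using conv[OF _ False fin(1) sets(1)] conv[OF _ False fin(2) sets(2)] that LIMSEQ_unique by auto
    qed
    then show ?thesis by (simp add: finite_measure.emeasure_eq_measure[OF fin(1)] finite_measure.emeasure_eq_measure[OF fin(2)])
  qed
qed auto

lemma eventually_bounded_convergent_subseq:
  fixes X :: "nat \<Rightarrow> 'a::euclidean_space"
  assumes "eventually (\<lambda>n. norm (X n) \<le> R) sequentially"
  shows "\<exists>l r. strict_mono r \<and> (\<lambda>n. X (r n)) \<longlonglongrightarrow> l"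
proof -
  have "Bseq X" using assms by (rule BfunI)
  then have "bounded (range X)" by (simp add: Bseq_eq_bounded)
  then show ?thesis using bounded_imp_convergent_subsequence[of X] by (auto simp: comp_def)
qed

lemma tendsto_if_unique_cluster_point:
  fixes X :: "nat \<Rightarrow> 'a::euclidean_space"
  assumes bd: "eventually (\<lambda>n. norm (X n) \<le> R) sequentially"
    and cl: "\<And>l r. strict_mono r \<Longrightarrow> (\<lambda>n. X (r n)) \<longlonglongrightarrow> l \<Longrightarrow> l = p"
  shows "X \<longlonglongrightarrow> p"
proof (rule ccontr)
  assume "\<not> X \<longlonglongrightarrow> p"
  then obtain e where e: "0 < e" "\<And>n0. \<exists>n\<ge>n0. e \<le> dist (X n) p"
    by (auto simp: lim_sequentially not_less)
  then have "infinite {n. e \<le> dist (X n) p}" by (auto simp: infinite_nat_iff_unbounded_le)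
  then obtain r where r: "strict_mono (r :: nat \<Rightarrow> nat)" "\<forall>n. e \<le> dist (X (r n)) p"
    using infinite_enumerate[of "{n. e \<le> dist (X n) p}"] by auto
  have "eventually (\<lambda>n. norm (X (r n)) \<le> R) sequentially"
    using eventually_subseq[OF r(1) bd] .
  then obtain l j where j: "strict_mono j" "(\<lambda>n. X (r (j n))) \<longlonglongrightarrow> l"
    using eventually_bounded_convergent_subseq[of "\<lambda>n. X (r n)"] by blast
  then have "l = p" using cl[of "r \<circ> j" l] r(1) by (simp add: strict_mono_o)
  have "(\<lambda>n. dist (X (r (j n))) p) \<longlonglongrightarrow> dist l p" by (intro tendsto_intros j(2))
  then have "e \<le> dist l p" by (rule LIMSEQ_le_const) (use r(2) in auto)
  then have "e \<le> 0" using \<open>l = p\<close> by simp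
  with e show False by simp
qed

lemma diagonal_convergent_subseq:
  fixes f :: "nat \<Rightarrow> 'b \<Rightarrow> real"
  assumes "countable D" and bd: "\<And>x. x \<in> D \<Longrightarrow> Bseq (\<lambda>n. f n x)"
  shows "\<exists>k. strict_mono k \<and> (\<forall>x\<in>D. convergent (\<lambda>n. f (k n) x))"
proof (cases "D = {}")
  case True
  then show ?thesis by (auto intro: exI[of _ id] strict_mono_id)
next
  case False
  define d where "d = from_nat_into D"
  have d: "d i \<in> D" for i using False by (simp add: d_def from_nat_into)
  interpret subseqs "\<lambda>i s. convergent (\<lambda>n. f (s n) (d i))"
  proof
    fix i and s :: "nat \<Rightarrow> nat" assume "strict_mono s"
    have "Bseq (\<lambda>n. f (s n) (d i))" using bd[OF d, of i] unfolding Bseq_def by blast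
    then obtain r l where "strict_mono r" "(\<lambda>n. f (s (r n)) (d i)) \<longlonglongrightarrow> l"
      using bounded_imp_convergent_subsequence[of "\<lambda>n. f (s n) (d i)"] by (auto simp: comp_def Bseq_eq_bounded)
    then show "\<exists>r'. strict_mono r' \<and> convergent (\<lambda>n. f ((s \<circ> r') n) (d i))"
      by (auto simp: convergent_def)
  qed
  have conv: "convergent (\<lambda>n. f (diagseq n) (d i))" for i
  proof -
    \<comment> \<open>From index \<open>Suc i\<close> on, the diagonal sequence is a subsequence of
      the one chosen for \<open>d i\<close>; convergence ignores what comes before.\<close>
    have "convergent (\<lambda>n. f ((diagseq \<circ> (+) (Suc i)) n) (d i))"
    proof (rule diagseq_holds)
      fix i and r s :: "nat \<Rightarrow> nat" assume "strict_mono r" "convergent (\<lambda>n. f (s n) (d i))"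
      then show "convergent (\<lambda>n. f ((s \<circ> r) n) (d i))"
        using LIMSEQ_subseq_LIMSEQ[of "\<lambda>n. f (s n) (d i)" _ r] by (auto simp: convergent_def comp_def)
    qed
    then have "convergent (\<lambda>n. f (diagseq (n + Suc i)) (d i))" by (simp add: add.commute)
    then show ?thesis by (subst (asm) convergent_ignore_initial_segment)
  qed
  have "convergent (\<lambda>n. f (diagseq n) x)" if "x \<in> D" for x
    using from_nat_into_surj[OF \<open>countable D\<close> that] conv unfolding d_def by blast
  then show ?thesis using subseq_diagseq by blast
qed

section \<open>Limits of transport maps\<close>

text \<open>These are the properties of the interior of a convex support. \<open>pos_open\<close>
  acts twice: it bounds gradients locally, because the mass of a ball cannot be sent far away, and
  it makes almost sure relations hold on a dense set.\<close>

locale transport_source = ac_prob_space \<mu> for \<mu> :: "'a::euclidean_space measure" +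
  fixes Os :: "'a set"
  assumes Os: "open Os" "convex Os" and AE_Os: "AE u in \<mu>. u \<in> Os"
    and pos_open: "\<And>V. open V \<Longrightarrow> V \<subseteq> Os \<Longrightarrow> V \<noteq> {} \<Longrightarrow> 0 < measure \<mu> V"
begin

text \<open>Subgradients are selected at every point of \<open>Os\<close>, because bounds and
  cluster points are studied pointwise. The last clause is weak convergence of the images of
  \<open>\<mu>\<close>, tested on functions with values in the unit interval.\<close>

definition approximates :: "(nat \<Rightarrow> 'a \<Rightarrow> 'a) \<Rightarrow> (nat \<Rightarrow> 'a \<Rightarrow> real) \<Rightarrow> 'a measure \<Rightarrow> bool" where
  "approximates Q \<phi> \<nu> \<longleftrightarrow> (\<forall>n. Q n \<in> borel_measurable borel) \<and>
     (\<forall>n. \<forall>u\<in>Os. subgrad Os (\<phi> n) u (Q n u)) \<and>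
     (\<forall>f::'a \<Rightarrow> real. continuous_on UNIV f \<longrightarrow> (\<forall>x. 0 \<le> f x \<and> f x \<le> 1) \<longrightarrow>
        (\<lambda>n. \<integral>u. f (Q n u) \<partial>\<mu>) \<longlonglongrightarrow> (\<integral>y. f y \<partial>\<nu>))"

lemma approximatesD:
  assumes "approximates Q \<phi> \<nu>"
  shows "Q n \<in> borel_measurable borel" "u \<in> Os \<Longrightarrow> subgrad Os (\<phi> n) u (Q n u)"
    "continuous_on UNIV f \<Longrightarrow> (\<And>x. 0 \<le> f x \<and> f x \<le> (1::real)) \<Longrightarrow> (\<lambda>n. \<integral>u. f (Q n u) \<partial>\<mu>) \<longlonglongrightarrow> (\<integral>y. f y \<partial>\<nu>)"
  using assms by (auto simp: approximates_def)

lemma approximates_subseq: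
  assumes "approximates Q \<phi> \<nu>" "strict_mono j"
  shows "approximates (\<lambda>n. Q (j n)) (\<lambda>n. \<phi> (j n)) \<nu>"
  unfolding approximates_def
proof (intro conjI allI impI ballI)
  fix f :: "'a \<Rightarrow> real" assume "continuous_on UNIV f" "\<forall>x. 0 \<le> f x \<and> f x \<le> 1"
  then show "(\<lambda>n. \<integral>u. f (Q (j n) u) \<partial>\<mu>) \<longlonglongrightarrow> (\<integral>y. f y \<partial>\<nu>)"
    using LIMSEQ_subseq_LIMSEQ[OF approximatesD(3)[OF assms(1)] assms(2)] by (simp add: comp_def)
qed (use approximatesD[OF assms(1)] in auto)

text \<open>A continuous ramp, 0 up to norm \<open>k\<close> and 1 from norm \<open>k + 1\<close>
  on, transfers the small tail of \<open>\<nu>\<close> to the image measures.\<close>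

lemma approximates_tight:
  assumes ap: "approximates Q \<phi> \<nu>" and \<nu>: "prob_space \<nu>" "sets \<nu> = sets borel" and "0 < e"
  shows "\<exists>R. eventually (\<lambda>n. measure \<mu> {u. R \<le> norm (Q n u)} < e) sequentially"
proof -
  interpret N: prob_space \<nu> by fact
  note [measurable_cong] = \<nu>(2)
  define f where "f k y = min 1 (max 0 (norm y - real k))" for k and y :: 'a
  have f01: "0 \<le> f k y \<and> f k y \<le> 1" for k y by (auto simp: f_def)
  have fc: "continuous_on UNIV (f k)" for k unfolding f_def by (intro continuous_intros)
  have [measurable]: "f k \<in> borel_measurable borel" for k using fc by (rule borel_measurable_continuous_onI)
  have "(\<lambda>k. \<integral>y. f k y \<partial>\<nu>) \<longlonglongrightarrow> (\<integral>y. (0::real) \<partial>\<nu>)"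
  proof (rule integral_dominated_convergence[where w="\<lambda>_. 1"])
    show "AE y in \<nu>. (\<lambda>k. f k y) \<longlonglongrightarrow> 0"
    proof (rule AE_I2)
      fix y :: 'a
      obtain k0 where "norm y < real k0" using reals_Archimedean2 by blast
      then have "eventually (\<lambda>k. f k y = 0) sequentially"
        by (intro eventually_sequentiallyI[of k0]) (auto simp: f_def)
      then show "(\<lambda>k. f k y) \<longlonglongrightarrow> 0" by (rule tendsto_eventually)
    qed
  qed (use f01 in \<open>auto intro!: AE_I2\<close>)
  then have "eventually (\<lambda>k. (\<integral>y. f k y \<partial>\<nu>) < e) sequentially" using \<open>0 < e\<close> by (intro order_tendstoD(2)) auto
  then obtain k where k: "(\<integral>y. f k y \<partial>\<nu>) < e" using eventually_happens'[OF sequentially_bot] by blast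
  have "eventually (\<lambda>n. (\<integral>u. f k (Q n u) \<partial>\<mu>) < e) sequentially"
    using order_tendstoD(2)[OF approximatesD(3)[OF ap fc f01] k] .
  then have "eventually (\<lambda>n. measure \<mu> {u. real k + 1 \<le> norm (Q n u)} < e) sequentially"
  proof eventually_elim
    case (elim n)
    note [measurable] = approximatesD(1)[OF ap, of n]
    have "measure \<mu> {u. real k + 1 \<le> norm (Q n u)} = (\<integral>u. indicator {u. real k + 1 \<le> norm (Q n u)} u \<partial>\<mu>)"
      by simp
    also have "\<dots> \<le> (\<integral>u. f k (Q n u) \<partial>\<mu>)"
    proof (rule integral_mono)
      show "integrable \<mu> (\<lambda>u. f k (Q n u))"
        by (rule integrable_const_bound[where B=1]) (use f01 in auto)
      show "integrable \<mu> (indicator {u. real k + 1 \<le> norm (Q n u)} :: 'a \<Rightarrow> real)"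
        by (rule integrable_const_bound[where B=1]) auto
      show "indicator {u. real k + 1 \<le> norm (Q n u)} u \<le> f k (Q n u)" for u
        by (auto simp: indicator_def f_def)
    qed
    finally show ?case using elim by simp
  qed
  then show ?thesis by blast
qed

text \<open>A large gradient \<open>p\<close> at one point forces, by monotonicity, gradients of size \<open>norm p / 3\<close> on a whole
  ball in the direction of \<open>p\<close>, which tightness of the image measures forbids.\<close>

lemma approximates_locally_bounded:
  assumes ap: "approximates Q \<phi> \<nu>" and \<nu>: "prob_space \<nu>" "sets \<nu> = sets borel" and x: "x \<in> Os"
  obtains r R where "0 < r" "ball x r \<subseteq> Os" "0 < R" "eventually (\<lambda>n. \<forall>u\<in>ball x r. norm (Q n u) \<le> R) sequentially"
proof -
  obtain s where s: "0 < s" "ball x s \<subseteq> Os" using Os(1) x by (meson openE)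
  \<comment> \<open>Balls of radius \<open>r / 2\<close> centred at distance \<open>4 * r\<close>
    from \<open>x\<close> fit inside radius \<open>6 * r\<close>.\<close>
  define r where "r = s / 6"
  have r: "0 < r" "ball x (6 * r) \<subseteq> Os" using s by (auto simp: r_def)
  have "seq_compact (sphere (0::'a) 1)" by (simp add: compact_imp_seq_compact)
  \<comment> \<open>The direction of a large gradient is arbitrary and may vary with
    \<open>n\<close>, while the mass bound has to be uniform; a finite net of directions leaves
    finitely many balls. Mesh \<open>1/8\<close> moves a centre at distance \<open>4 * r\<close> by
    at most \<open>r / 2\<close>.\<close>
  then obtain k where k: "finite k" "k \<subseteq> sphere (0::'a) 1" "sphere 0 1 \<subseteq> (\<Union>e\<in>k. ball e (1/8))"
    using seq_compact_imp_totally_bounded[of "sphere (0::'a) 1", rule_format, of "1/8"] by auto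
  define B where "B e = ball (x + (4 * r) *\<^sub>R e) (r / 2)" for e
  have B_sub: "B e \<subseteq> ball x (6 * r)" if "e \<in> k" for e
  proof
    fix u assume "u \<in> B e"
    then have "norm (u - (x + (4 * r) *\<^sub>R e)) < r / 2" by (simp add: B_def dist_norm norm_minus_commute)
    moreover have "norm ((4 * r) *\<^sub>R e) = 4 * r" using that k(2) r by auto
    moreover have "norm (u - x) \<le> norm (u - (x + (4 * r) *\<^sub>R e)) + norm ((4 * r) *\<^sub>R e)"
      using norm_triangle_ineq[of "u - (x + (4 * r) *\<^sub>R e)" "(4 * r) *\<^sub>R e"] by simp
    ultimately show "u \<in> ball x (6 * r)" using r by (simp add: dist_norm norm_minus_commute)
  qed
  have B_pos: "0 < measure \<mu> (B e)" if "e \<in> k" for e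
    using B_sub[OF that] r by (intro pos_open) (auto simp: B_def)
  define c where "c = Min (insert 1 ((\<lambda>e. measure \<mu> (B e)) ` k))"
  have c: "0 < c" unfolding c_def using k(1) B_pos by (subst Min_gr_iff) auto
  have c_le: "c \<le> measure \<mu> (B e)" if "e \<in> k" for e unfolding c_def using that k(1) by (intro Min_le) auto
  obtain R where R: "eventually (\<lambda>n. measure \<mu> {u. R \<le> norm (Q n u)} < c) sequentially"
    using approximates_tight[OF ap \<nu> c] by blast
  have sub: "ball x r \<subseteq> Os" using r by (force intro: subsetD[OF r(2)])
  from R have "eventually (\<lambda>n. \<forall>u\<in>ball x r. norm (Q n u) \<le> \<bar>3 * R\<bar> + 1) sequentially"
  proof eventually_elim
    case (elim n)
    note [measurable] = approximatesD(1)[OF ap, of n]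
    show ?case
    proof (rule ballI, rule ccontr)
      fix y assume y: "y \<in> ball x r" and "\<not> norm (Q n y) \<le> \<bar>3 * R\<bar> + 1"
      define p where "p = Q n y"
      have p: "3 * R \<le> norm p" "0 < norm p" using \<open>\<not> norm (Q n y) \<le> \<bar>3 * R\<bar> + 1\<close> by (auto simp: p_def)
      define e where "e = p /\<^sub>R norm p"
      have "e \<in> sphere 0 1" using p by (simp add: e_def)
      then obtain e' where e': "e' \<in> k" "dist e' e < 1 / 8" using k(3) by auto
      have pe: "p \<bullet> e = norm p" using p by (simp add: e_def dot_square_norm power2_eq_square)
      have "B e' \<subseteq> {u. R \<le> norm (Q n u)}"
      proof
        fix u assume u: "u \<in> B e'"
        \<comment> \<open>The errors \<open>r / 2\<close> inside the ball, \<open>r / 2\<close> from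
          the net and \<open>r\<close> from \<open>y\<close> add up to \<open>2 * r\<close>. Hence
          \<open>p \<bullet> (u - y)\<close> is at least \<open>2 * r * norm p\<close>, while
          \<open>norm (u - y)\<close> is at most \<open>6 * r\<close>; the quotient gives the factor
          1/3.\<close>
        define v where "v = u - y - (4 * r) *\<^sub>R e"
        have veq: "v = (u - (x + (4 * r) *\<^sub>R e')) + ((4 * r) *\<^sub>R (e' - e) + (x - y))"
          by (simp add: v_def algebra_simps)
        have "norm v \<le> norm (u - (x + (4 * r) *\<^sub>R e')) + (norm ((4 * r) *\<^sub>R (e' - e)) + norm (x - y))"
          using norm_triangle_ineq[of "u - (x + (4 * r) *\<^sub>R e')" "(4 * r) *\<^sub>R (e' - e) + (x - y)"]
            norm_triangle_ineq[of "(4 * r) *\<^sub>R (e' - e)" "x - y"] unfolding veq by linarith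
        moreover have "norm (u - (x + (4 * r) *\<^sub>R e')) \<le> r / 2" using u by (simp add: B_def dist_norm norm_minus_commute)
        moreover have "norm ((4 * r) *\<^sub>R (e' - e)) \<le> r / 2" using e'(2) r by (simp add: dist_norm)
        moreover have "norm (x - y) \<le> r" using y by (simp add: dist_norm)
        ultimately have v: "norm v \<le> 2 * r" by linarith
        have uy: "u - y = (4 * r) *\<^sub>R e + v" by (simp add: v_def)
        have "norm ((4 * r) *\<^sub>R e) = 4 * r" using r p by (simp add: e_def)
        then have nuy: "norm (u - y) \<le> 6 * r" unfolding uy using norm_triangle_ineq[of "(4 * r) *\<^sub>R e" v] v by linarith
        have "\<bar>p \<bullet> v\<bar> \<le> norm p * (2 * r)" using Cauchy_Schwarz_ineq2[of p v] mult_left_mono[OF v norm_ge_zero[of p]] by linarith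
        then have "2 * r * norm p \<le> p \<bullet> (u - y)" unfolding uy by (simp add: inner_add_right pe algebra_simps)
        also have "\<dots> \<le> Q n u \<bullet> (u - y)" unfolding p_def
          using u y B_sub[OF e'(1)] r sub by (intro subgrad_monotone[OF approximatesD(2)[OF ap] approximatesD(2)[OF ap]]) auto
        also have "\<dots> \<le> norm (Q n u) * norm (u - y)" by (rule norm_cauchy_schwarz)
        also have "\<dots> \<le> norm (Q n u) * (6 * r)" using nuy by (intro mult_left_mono) auto
        finally have "norm p \<le> 3 * norm (Q n u)" using r by (simp add: field_simps)
        then show "u \<in> {u. R \<le> norm (Q n u)}" using p by simp
      qed
      then have "measure \<mu> (B e') \<le> measure \<mu> {u. R \<le> norm (Q n u)}" by (intro finite_measure_mono) auto
      with c_le[OF e'(1)] elim show False by simp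
    qed
  qed
  then show thesis using that[of r "\<bar>3 * R\<bar> + 1"] r(1) sub by simp
qed

lemma approximates_bounded:
  assumes ap: "approximates Q \<phi> \<nu>" and \<nu>: "prob_space \<nu>" "sets \<nu> = sets borel" and x: "x \<in> Os"
  shows "\<exists>R. eventually (\<lambda>n. norm (Q n x) \<le> R) sequentially"
proof -
  obtain r R where "0 < r" "eventually (\<lambda>n. \<forall>u\<in>ball x r. norm (Q n u) \<le> R) sequentially"
    by (rule approximates_locally_bounded[OF assms]) auto
  then have "eventually (\<lambda>n. norm (Q n x) \<le> R) sequentially" by (auto elim!: eventually_mono)
  then show ?thesis by blast
qed

lemma approximates_increment:
  assumes ap: "approximates Q \<phi> \<nu>" and "x \<in> Os" "y \<in> Os" "norm (Q n x) \<le> R" "norm (Q n y) \<le> R"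
  shows "\<bar>\<phi> n x - \<phi> n y\<bar> \<le> R * norm (x - y)"
proof -
  have "\<phi> n x + Q n x \<bullet> (y - x) \<le> \<phi> n y" "\<phi> n y + Q n y \<bullet> (x - y) \<le> \<phi> n x"
    using subgradD[OF approximatesD(2)[OF ap]] assms by auto
  moreover have "\<bar>Q n x \<bullet> (y - x)\<bar> \<le> R * norm (x - y)" "\<bar>Q n y \<bullet> (x - y)\<bar> \<le> R * norm (x - y)"
    using Cauchy_Schwarz_ineq2[of "Q n x" "y - x"] Cauchy_Schwarz_ineq2[of "Q n y" "x - y"]
      mult_right_mono[OF assms(4), of "norm (x - y)"] mult_right_mono[OF assms(5), of "norm (x - y)"]
    by (auto simp: norm_minus_commute)
  ultimately show ?thesis by linarith
qed

text \<open>An Arzela-Ascoli argument: locally bounded gradients make the potentials locally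
  equi-Lipschitz, so convergence on a countable dense set spreads to \<open>Os\<close>. Gradients
  leave additive constants free; \<open>c n\<close> fixes them at a base point.\<close>

lemma approximates_limit_potential:
  assumes ap: "approximates Q \<phi> \<nu>" and \<nu>: "prob_space \<nu>" "sets \<nu> = sets borel"
  shows "\<exists>k c \<Phi>. strict_mono k \<and> (\<forall>x\<in>Os. (\<lambda>n. \<phi> (k n) x - c n) \<longlonglongrightarrow> \<Phi> x)"
proof (cases "Os = {}")
  case True
  then show ?thesis by (auto intro: exI[of _ id] strict_mono_id)
next
  case False
  then obtain x0 where x0: "x0 \<in> Os" by auto
  obtain D0 :: "'a set" where D0: "countable D0" "\<And>X. open X \<Longrightarrow> X \<noteq> {} \<Longrightarrow> \<exists>d\<in>D0. d \<in> X"
    using countable_dense_exists by blast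
  define D where "D = D0 \<inter> Os"
  define f where "f n x = \<phi> n x - \<phi> n x0" for n x
  have "Bseq (\<lambda>n. f n x)" if "x \<in> D" for x
  proof -
    have x: "x \<in> Os" using that by (simp add: D_def)
    obtain R R0 where R: "eventually (\<lambda>n. norm (Q n x) \<le> R) sequentially" "eventually (\<lambda>n. norm (Q n x0) \<le> R0) sequentially"
      using approximates_bounded[OF ap \<nu>] x x0 by blast
    then have "eventually (\<lambda>n. norm (f n x) \<le> max R R0 * norm (x - x0)) sequentially"
      by eventually_elim (unfold f_def real_norm_def, rule approximates_increment[OF ap x x0], auto)
    then show ?thesis by (rule BfunI)
  qed
  moreover have "countable D" using D0 by (simp add: D_def)
  ultimately obtain k where k: "strict_mono k" "\<And>x. x \<in> D \<Longrightarrow> convergent (\<lambda>n. f (k n) x)"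
    using diagonal_convergent_subseq[of D f] by blast
  note ap' = approximates_subseq[OF ap k(1)]
  have "convergent (\<lambda>n. f (k n) x)" if x: "x \<in> Os" for x
  proof (rule Cauchy_convergent, rule metric_CauchyI)
    fix e :: real assume "0 < e"
    obtain r R where r: "0 < r" "ball x r \<subseteq> Os" "0 < R" and ev: "eventually (\<lambda>n. \<forall>u\<in>ball x r. norm (Q (k n) u) \<le> R) sequentially"
      by (rule approximates_locally_bounded[OF ap' \<nu> x])
    \<comment> \<open>Two increments of at most \<open>e / 4\<close> in space and one of less than
      \<open>e / 2\<close> at the dense point add up to less than \<open>e\<close>.\<close>
    define d where "d = min r (e / (4 * R))"
    have d: "0 < d" using r \<open>0 < e\<close> by (simp add: d_def)
    then obtain y where y: "y \<in> D0" "y \<in> ball x d" using D0(2)[of "ball x d"] by auto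
    then have yO: "y \<in> Os" "y \<in> ball x r" using r by (auto simp: d_def)
    obtain N1 where N1: "\<And>n. N1 \<le> n \<Longrightarrow> \<forall>u\<in>ball x r. norm (Q (k n) u) \<le> R"
      using ev by (auto simp: eventually_sequentially)
    have "Cauchy (\<lambda>n. f (k n) y)" using k(2)[of y] y yO by (simp add: D_def convergent_Cauchy)
    then obtain N2 where N2: "\<And>m n. N2 \<le> m \<Longrightarrow> N2 \<le> n \<Longrightarrow> dist (f (k m) y) (f (k n) y) < e / 2"
      using \<open>0 < e\<close> metric_CauchyD[of "\<lambda>n. f (k n) y" "e / 2"] by auto
    have close: "\<bar>f (k n) x - f (k n) y\<bar> \<le> e / 4" if "N1 \<le> n" for n
    proof -
      have "\<bar>\<phi> (k n) x - \<phi> (k n) y\<bar> \<le> R * norm (x - y)"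
        using N1[OF that] yO r(1) by (intro approximates_increment[OF ap x yO(1)]) auto
      also have "\<dots> \<le> R * (e / (4 * R))" using y(2) r(3) by (intro mult_left_mono) (auto simp: d_def dist_norm)
      also have "\<dots> = e / 4" using r(3) by simp
      finally show ?thesis by (simp add: f_def)
    qed
    show "\<exists>M. \<forall>m\<ge>M. \<forall>n\<ge>M. dist (f (k m) x) (f (k n) x) < e"
    proof (intro exI[of _ "max N1 N2"] allI impI)
      fix m n assume "max N1 N2 \<le> m" "max N1 N2 \<le> n"
      then have mn: "N1 \<le> m" "N1 \<le> n" "N2 \<le> m" "N2 \<le> n" by auto
      show "dist (f (k m) x) (f (k n) x) < e"
        using close[OF mn(1)] close[OF mn(2)] N2[OF mn(3,4)] unfolding dist_real_def by linarith
    qed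
  qed
  then have "(\<lambda>n. \<phi> (k n) x - \<phi> (k n) x0) \<longlonglongrightarrow> lim (\<lambda>n. f (k n) x)" if "x \<in> Os" for x
    using that by (simp add: convergent_LIMSEQ_iff f_def)
  then show ?thesis using k(1) by (intro exI[of _ k] exI[of _ "\<lambda>n. \<phi> (k n) x0"] exI[of _ "\<lambda>x. lim (\<lambda>n. f (k n) x)"]) auto
qed

lemma subgrad_limit:
  assumes lim: "\<forall>x\<in>Os. (\<lambda>n. \<phi> n x - c n) \<longlonglongrightarrow> \<Phi> x" and sg: "\<And>n. subgrad Os (\<phi> n) x (q n)"
    and x: "x \<in> Os" and j: "strict_mono j" and q: "(\<lambda>n. q (j n)) \<longlonglongrightarrow> p"
  shows "subgrad Os \<Phi> x p"
  unfolding subgrad_def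
proof
  fix y assume y: "y \<in> Os"
  have l: "(\<lambda>n. \<phi> (j n) z - c (j n)) \<longlonglongrightarrow> \<Phi> z" if "z \<in> Os" for z
    using LIMSEQ_subseq_LIMSEQ[OF bspec[OF lim that] j] by (simp add: comp_def)
  show "\<Phi> x + p \<bullet> (y - x) \<le> \<Phi> y"
  proof (rule LIMSEQ_le)
    show "(\<lambda>n. (\<phi> (j n) x - c (j n)) + q (j n) \<bullet> (y - x)) \<longlonglongrightarrow> \<Phi> x + p \<bullet> (y - x)"
      by (intro tendsto_intros l x q)
    show "(\<lambda>n. \<phi> (j n) y - c (j n)) \<longlonglongrightarrow> \<Phi> y" by (rule l[OF y])
    show "\<exists>N. \<forall>n\<ge>N. (\<phi> (j n) x - c (j n)) + q (j n) \<bullet> (y - x) \<le> \<phi> (j n) y - c (j n)"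
      using subgradD[OF sg y] by (auto simp: algebra_simps)
  qed
qed

text \<open>Every cluster point of the gradients at \<open>u\<close> is a subgradient of
  \<open>\<Phi>\<close>, so where \<open>\<Phi>\<close> is differentiable there is only one and the
  bounded sequence converges. The last clause is exported so that cluster points can be compared
  with limits along other subsequences.\<close>

lemma approximates_limit_gradient:
  assumes ap: "approximates Q \<phi> \<nu>" and \<nu>: "prob_space \<nu>" "sets \<nu> = sets borel"
  obtains k :: "nat \<Rightarrow> nat" and \<Phi> g where "strict_mono k" "convex_on Os \<Phi>" "g \<in> borel_measurable borel"
    "AE u in \<mu>. u \<in> Os \<and> (\<Phi> has_derivative (\<lambda>h. g u \<bullet> h)) (at u)"
    "distr \<mu> borel g = \<nu>"
    "\<And>u j p. u \<in> Os \<Longrightarrow> strict_mono j \<Longrightarrow> (\<lambda>n. Q (k (j n)) u) \<longlonglongrightarrow> p \<Longrightarrow> subgrad Os \<Phi> u p"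
proof -
  interpret N: prob_space \<nu> by fact
  obtain k c \<Phi> where k: "strict_mono k" and lim: "\<forall>x\<in>Os. (\<lambda>n. \<phi> (k n) x - c n) \<longlonglongrightarrow> \<Phi> x"
    using approximates_limit_potential[OF assms] by blast
  note ap' = approximates_subseq[OF ap k]
  have sgl: "subgrad Os \<Phi> u p" if "u \<in> Os" "strict_mono j" "(\<lambda>n. Q (k (j n)) u) \<longlonglongrightarrow> p" for u j p
    using subgrad_limit[OF lim approximatesD(2)[OF ap' that(1)] that] .
  have "\<exists>p. subgrad Os \<Phi> x p" if x: "x \<in> Os" for x
  proof -
    obtain R where "eventually (\<lambda>n. norm (Q (k n) x) \<le> R) sequentially"
      using approximates_bounded[OF ap' \<nu> x] by blast
    from eventually_bounded_convergent_subseq[OF this] show ?thesis using sgl[OF x] by blast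
  qed
  then obtain P where P: "\<And>x. x \<in> Os \<Longrightarrow> subgrad Os \<Phi> x (P x)" by metis
  have cv: "convex_on Os \<Phi>" using Os(2) P by (rule convex_on_if_subgrad)
  define g where "g u = lim (\<lambda>n. Q (k n) u)" for u
  have [measurable]: "Q n \<in> borel_measurable borel" for n using approximatesD(1)[OF ap] .
  have [measurable]: "g \<in> borel_measurable borel" unfolding g_def by measurable
  have AE_diff: "AE u in \<mu>. u \<in> Os \<longrightarrow> (\<Phi> has_derivative (\<lambda>h. P u \<bullet> h)) (at u)"
    by (intro AE_from_lborel AE_has_derivative_if_subgrad Os P)
  have conv: "AE u in \<mu>. u \<in> Os \<and> (\<Phi> has_derivative (\<lambda>h. g u \<bullet> h)) (at u) \<and> (\<lambda>n. Q (k n) u) \<longlonglongrightarrow> g u"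
    using AE_Os AE_diff
  proof eventually_elim
    case (elim u)
    then have d: "(\<Phi> has_derivative (\<lambda>h. P u \<bullet> h)) (at u)" by simp
    obtain R where "eventually (\<lambda>n. norm (Q (k n) u) \<le> R) sequentially"
      using approximates_bounded[OF ap' \<nu> elim(1)] by blast
    then have "(\<lambda>n. Q (k n) u) \<longlonglongrightarrow> P u"
      by (rule tendsto_if_unique_cluster_point)
        (rule subgrad_unique_if_has_derivative[OF Os(1) elim(1) d sgl[OF elim(1)]])
    moreover from this have "g u = P u" unfolding g_def by (rule limI)
    ultimately show ?case using d elim(1) by simp
  qed
  have law: "distr \<mu> borel g = \<nu>"
  proof (rule measure_eqI_continuous)
    show "finite_measure (distr \<mu> borel g)" by (intro finite_measure_distr) simp
    show "finite_measure \<nu>" by unfold_locales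
    show "sets \<nu> = sets borel" by fact
    fix f :: "'a \<Rightarrow> real" assume f: "continuous_on UNIV f" "\<And>x. 0 \<le> f x \<and> f x \<le> 1"
    have [measurable]: "f \<in> borel_measurable borel" using f(1) by (rule borel_measurable_continuous_onI)
    have "(\<lambda>n. \<integral>u. f (Q (k n) u) \<partial>\<mu>) \<longlonglongrightarrow> (\<integral>u. f (g u) \<partial>\<mu>)"
    proof (rule integral_dominated_convergence[where w="\<lambda>_. 1"])
      show "AE u in \<mu>. (\<lambda>n. f (Q (k n) u)) \<longlonglongrightarrow> f (g u)"
        using conv
      proof eventually_elim
        case (elim u)
        show ?case using elim f(1) by (intro continuous_on_tendsto_compose[OF f(1)]) auto
      qed
    qed (use f(2) in auto)
    moreover have "(\<lambda>n. \<integral>u. f (Q (k n) u) \<partial>\<mu>) \<longlonglongrightarrow> (\<integral>y. f y \<partial>\<nu>)" by (rule approximatesD(3)[OF ap' f])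
    ultimately have "(\<integral>u. f (g u) \<partial>\<mu>) = (\<integral>y. f y \<partial>\<nu>)" by (rule LIMSEQ_unique)
    then show "(\<integral>y. f y \<partial>distr \<mu> borel g) = (\<integral>y. f y \<partial>\<nu>)" by (subst integral_distr) auto
  qed simp
  have diff: "AE u in \<mu>. u \<in> Os \<and> (\<Phi> has_derivative (\<lambda>h. g u \<bullet> h)) (at u)"
    using conv by eventually_elim auto
  show thesis
  proof (rule that[OF k cv \<open>g \<in> borel_measurable borel\<close> diff law])
    fix u j p assume "u \<in> Os" "strict_mono j" "(\<lambda>n. Q (k (j n)) u) \<longlonglongrightarrow> p"
    then show "subgrad Os \<Phi> u p" by (rule sgl)
  qed
qed

text \<open>One subsequence gives the candidate \<open>g\<close>. A cluster point \<open>p\<close>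
  at \<open>u\<close> arises along some \<open>j\<close>, whose own limit potential
  \<open>\<Psi>\<close> has the same gradient almost everywhere by uniqueness. The good points
  \<open>u\<close> are fixed by \<open>\<Phi>\<close> before \<open>j\<close> is chosen, so the null
  set is independent of \<open>j\<close>.\<close>

lemma approximates_gradient:
  assumes ap: "approximates Q \<phi> \<nu>" and \<nu>: "prob_space \<nu>" "sets \<nu> = sets borel"
  obtains \<Phi> where "convex_on Os \<Phi>"
    "AE u in \<mu>. u \<in> Os \<and> (\<Phi> has_derivative (\<lambda>h. lim (\<lambda>n. Q n u) \<bullet> h)) (at u)"
    "distr \<mu> borel (\<lambda>u. lim (\<lambda>n. Q n u)) = \<nu>"
proof (rule approximates_limit_gradient[OF assms])
  fix k \<Phi> g
  assume cv: "convex_on Os \<Phi>" and g[measurable]: "g \<in> borel_measurable borel"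
    and d: "AE u in \<mu>. u \<in> Os \<and> (\<Phi> has_derivative (\<lambda>h. g u \<bullet> h)) (at u)"
    and law: "distr \<mu> borel g = \<nu>"
  have [measurable]: "Q n \<in> borel_measurable borel" for n using approximatesD(1)[OF ap] .
  have "AE u in \<mu>. (\<lambda>n. Q n u) \<longlonglongrightarrow> g u"
    using d
  proof eventually_elim
    case (elim u)
    obtain R where "eventually (\<lambda>n. norm (Q n u) \<le> R) sequentially"
      using approximates_bounded[OF ap \<nu>] elim by blast
    then show ?case
    proof (rule tendsto_if_unique_cluster_point)
      fix p j assume j: "strict_mono (j :: nat \<Rightarrow> nat)" and p: "(\<lambda>n. Q (j n) u) \<longlonglongrightarrow> p"
      show "p = g u"
      proof (rule approximates_limit_gradient[OF approximates_subseq[OF ap j] \<nu>])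
        fix k' \<Psi> g'
        assume k': "strict_mono (k' :: nat \<Rightarrow> nat)" and cv': "convex_on Os \<Psi>" and g': "g' \<in> borel_measurable borel"
          and d': "AE u in \<mu>. u \<in> Os \<and> (\<Psi> has_derivative (\<lambda>h. g' u \<bullet> h)) (at u)"
          and law': "distr \<mu> borel g' = \<nu>"
          and cl: "\<And>u i p. u \<in> Os \<Longrightarrow> strict_mono i \<Longrightarrow> (\<lambda>n. Q (j (k' (i n))) u) \<longlonglongrightarrow> p \<Longrightarrow> subgrad Os \<Psi> u p"
        have "AE u in \<mu>. g u = g' u"
          using law law' by (intro convex_gradient_unique[OF prob_space_axioms sets_eq Os(1) cv cv' g g' d d']) simp
        with d d' have "AE u in \<mu>. subgrad Os \<Phi> u (g u) \<and> subgrad Os \<Psi> u (g u)"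
          by eventually_elim (auto intro!: subgrad_if_has_derivative[OF cv] subgrad_if_has_derivative[OF cv'])
        then have dense: "\<exists>x\<in>V. \<exists>q. subgrad Os \<Phi> x q \<and> subgrad Os \<Psi> x q" if V: "open V" "V \<subseteq> Os" "V \<noteq> {}" for V
        proof (rule contrapos_pp)
          assume none: "\<not> (\<exists>x\<in>V. \<exists>q. subgrad Os \<Phi> x q \<and> subgrad Os \<Psi> x q)"
          show "\<not> (AE u in \<mu>. subgrad Os \<Phi> u (g u) \<and> subgrad Os \<Psi> u (g u))"
          proof
            assume "AE u in \<mu>. subgrad Os \<Phi> u (g u) \<and> subgrad Os \<Psi> u (g u)"
            then have "AE u in \<mu>. u \<notin> V" by eventually_elim (use none in blast)
            then have "measure \<mu> V = 0" using V by (intro measure_eq_0_null_sets) (simp add: AE_iff_null_sets)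
            then show False using pos_open[OF V] by simp
          qed
        qed
        have "(\<lambda>n. Q (j (k' (id n))) u) \<longlonglongrightarrow> p"
          using LIMSEQ_subseq_LIMSEQ[OF p k'] by (simp add: comp_def)
        then have "subgrad Os \<Psi> u p" using elim by (intro cl) (auto simp: strict_mono_id)
        then show "p = g u" using elim dense by (intro subgrad_eq_if_common_on_dense[OF Os(1) cv]) auto
      qed
    qed
  qed
  then have eq: "AE u in \<mu>. lim (\<lambda>n. Q n u) = g u" by eventually_elim (rule limI)
  show thesis
  proof (rule that[OF cv])
    show "AE u in \<mu>. u \<in> Os \<and> (\<Phi> has_derivative (\<lambda>h. lim (\<lambda>n. Q n u) \<bullet> h)) (at u)"
      using d eq by eventually_elim simp
    have "distr \<mu> borel (\<lambda>u. lim (\<lambda>n. Q n u)) = distr \<mu> borel g"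
      by (rule distr_cong_AE) (use eq in auto)
    then show "distr \<mu> borel (\<lambda>u. lim (\<lambda>n. Q n u)) = \<nu>" using law by simp
  qed
qed

end

section \<open>Measurable families of targets\<close>

lemma integral_finite_range:
  fixes f :: "'b::t1_space \<Rightarrow> real"
  assumes "finite_measure M" and h: "h \<in> borel_measurable M" and J: "finite J" "\<And>x. h x \<in> J"
  shows "(\<integral>x. f (h x) \<partial>M) = (\<Sum>y\<in>J. f y * measure M (h -` {y} \<inter> space M))"
proof -
  interpret finite_measure M by fact
  have s: "h -` {y} \<inter> space M \<in> sets M" for y using h by (rule measurable_sets) simp
  have "(\<integral>x. f (h x) \<partial>M) = (\<integral>x. (\<Sum>y\<in>J. f y * indicator (h -` {y} \<inter> space M) x) \<partial>M)"
  proof (rule Bochner_Integration.integral_cong[OF refl])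
    fix x assume "x \<in> space M"
    then have "(\<Sum>y\<in>J. f y * indicator (h -` {y} \<inter> space M) x) = (\<Sum>y\<in>J. if y = h x then f y else 0)"
      by (intro sum.cong) (auto simp: indicator_def)
    then show "f (h x) = (\<Sum>y\<in>J. f y * indicator (h -` {y} \<inter> space M) x)" using J by simp
  qed
  also have "\<dots> = (\<Sum>y\<in>J. \<integral>x. f y * indicator (h -` {y} \<inter> space M) x \<partial>M)"
    using s by (intro Bochner_Integration.integral_sum) (auto intro!: integrable_real_indicator simp: emeasure_eq_measure)
  also have "\<dots> = (\<Sum>y\<in>J. f y * measure M (h -` {y} \<inter> space M))"
    using s by (simp add: Int_absorb2)
  finally show ?thesis .
qed

text \<open>Equal totals turn a one-sided bound into a two-sided one, since the absolute value of
  \<open>t\<close> is \<open>2 * max 0 t - t\<close>. Rounding masses upwards and renormalising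
  controls only one side directly.\<close>

lemma sum_abs_diff_le:
  fixes p a :: "'b \<Rightarrow> real"
  assumes "sum p J = sum a J" and "\<And>y. y \<in> J \<Longrightarrow> p y - a y \<le> e" and "0 \<le> e"
  shows "(\<Sum>y\<in>J. \<bar>p y - a y\<bar>) \<le> 2 * (real (card J) * e)"
proof -
  have "(\<Sum>y\<in>J. \<bar>p y - a y\<bar>) = (\<Sum>y\<in>J. 2 * max 0 (p y - a y) - (p y - a y))"
    by (intro sum.cong) (auto simp: max_def abs_if)
  also have "\<dots> = 2 * (\<Sum>y\<in>J. max 0 (p y - a y)) - (sum p J - sum a J)"
    by (simp add: sum_subtractf sum_distrib_left)
  also have "(\<Sum>y\<in>J. max 0 (p y - a y)) \<le> (\<Sum>y\<in>J. e)" using assms by (intro sum_mono) auto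
  finally show ?thesis using assms(1) by simp
qed

context transport_source
begin

text \<open>Rounding the masses to \<open>c y / sum c\<close> with natural \<open>c\<close> leaves only countably many discrete targets, so
  that the discrete transport maps can be chosen arbitrarily without spoiling joint measurability.\<close>

lemma transport_kernel:
  fixes K :: "'w \<Rightarrow> 'a measure" and N :: "'w measure"
  assumes K: "\<And>w. prob_space (K w)" "\<And>w. sets (K w) = sets borel"
    and Km: "\<And>A. A \<in> sets borel \<Longrightarrow> (\<lambda>w. measure (K w) A) \<in> borel_measurable N"
  shows "\<exists>Q. Q \<in> borel_measurable (borel \<Otimes>\<^sub>M N) \<and>
    (\<forall>w. \<exists>\<Phi>. convex_on Os \<Phi> \<and> (AE u in \<mu>. u \<in> Os \<and> (\<Phi> has_derivative (\<lambda>h. Q (u, w) \<bullet> h)) (at u))) \<and>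
    (\<forall>w. distr \<mu> borel (\<lambda>u. Q (u, w)) = K w)"
proof -
  have spK[simp]: "space (K w) = UNIV" for w using sets_eq_imp_space_eq[OF K(2)[of w]] by simp
  obtain D :: "'a set" where D: "countable D" "\<And>X. open X \<Longrightarrow> X \<noteq> {} \<Longrightarrow> \<exists>d\<in>D. d \<in> X"
    using countable_dense_exists by blast
  have "D \<noteq> {}" using D(2)[of UNIV] by auto
  define d where "d = from_nat_into D"
  have d: "\<exists>i. d i \<in> X" if X: "open X" "X \<noteq> {}" for X
  proof -
    obtain y where "y \<in> D" "y \<in> X" using D(2)[OF X] by blast
    then show ?thesis using from_nat_into_surj[OF D(1) \<open>y \<in> D\<close>] by (auto simp: d_def)
  qed
  define J where "J n = d ` {..n}" for n :: nat
  have J: "finite (J n)" "J n \<noteq> {}" "card (J n) \<le> Suc n" for n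
    using card_image_le[of "{..n}" d] by (auto simp: J_def)
  \<comment> \<open>Nearest-point maps onto the first points of a dense sequence take finitely many
    values, are Borel, and converge to the identity.\<close>
  have "\<exists>T. T \<in> borel_measurable borel \<and> (\<forall>x. T x \<in> J n \<and> (\<forall>y\<in>J n. dist x (T x) \<le> dist x y))" for n
  proof -
    define L where "L y = {x::'a. \<forall>y'\<in>J n. dist x y \<le> dist x y'}" for y
    have L: "L y \<in> sets borel" for y
    proof -
      have "L y = (\<Inter>y'\<in>J n. {x. dist x y \<le> dist x y'})" by (auto simp: L_def)
      then have "closed (L y)" by (auto intro!: closed_INT closed_Collect_le continuous_intros)
      then show ?thesis by simp
    qed
    obtain T where T: "T \<in> borel_measurable borel" "\<forall>x\<in>(\<Union>y\<in>J n. L y). T x \<in> J n \<and> x \<in> L (T x)"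
      using finite_cover_selector[OF J(1), of n L borel] L by blast
    have "(\<Union>y\<in>J n. L y) = UNIV"
    proof -
      have "\<exists>y\<in>J n. x \<in> L y" for x
        using arg_min_if_finite[OF J(1)[of n] J(2)[of n], of "dist x"] unfolding L_def
        by (intro bexI[of _ "arg_min_on (dist x) (J n)"]) (auto simp: not_less)
      then show ?thesis by auto
    qed
    then show ?thesis using T by (auto simp: L_def)
  qed
  then obtain T where "\<forall>n. T n \<in> borel_measurable borel \<and> (\<forall>x. T n x \<in> J n \<and> (\<forall>y\<in>J n. dist x (T n x) \<le> dist x y))"
    by metis
  then have Tm[measurable]: "T n \<in> borel_measurable borel" and TJ: "T n x \<in> J n"
    and T_le: "y \<in> J n \<Longrightarrow> dist x (T n x) \<le> dist x y" for n x y by auto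
  have T_lim: "(\<lambda>n. T n x) \<longlonglongrightarrow> x" for x
  proof (rule metric_LIMSEQ_I)
    fix e :: real assume "0 < e"
    then obtain i where i: "d i \<in> ball x e" using d[of "ball x e"] by auto
    have "dist (T n x) x < e" if "i \<le> n" for n
      using T_le[of "d i" n x] i that by (auto simp: J_def dist_commute intro: le_less_trans)
    then show "\<exists>no. \<forall>n\<ge>no. dist (T n x) x < e" by blast
  qed
  define a where "a n w y = measure (K w) (T n -` {y})" for n w y
  have Ts: "T n -` {y} \<in> sets borel" for n y using measurable_sets[OF Tm, of "{y}" n] by simp
  have am[measurable]: "(\<lambda>w. a n w y) \<in> borel_measurable N" for n y unfolding a_def by (rule Km[OF Ts])
  have a_sum: "(\<Sum>y\<in>J n. a n w y) = 1" for n w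
    using integral_finite_range[of "K w" "T n" "J n" "\<lambda>_. 1"] J TJ K[of w] prob_space.prob_space[OF K(1)[of w]]
    by (simp add: a_def prob_space.finite_measure cong: measurable_cong_sets)
  \<comment> \<open>At most \<open>Suc n\<close> atoms each gain at most \<open>1 / r n\<close>; the
    square makes the total error at most \<open>2 / Suc n\<close>, which vanishes.\<close>
  define r where "r n = real (Suc n) * real (Suc n)" for n
  have r_pos: "0 < r n" for n by (simp add: r_def)
  \<comment> \<open>Adding 1 keeps every mass positive, as the discrete construction requires;
    \<open>restrict\<close> confines the values to the countable set \<open>I n\<close>.\<close>
  define c where "c n w = restrict (\<lambda>y. nat \<lfloor>r n * a n w y\<rfloor> + 1) (J n)" for n w
  define I where "I n = (J n \<rightarrow>\<^sub>E {1::nat..})" for n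
  have cI: "c n w \<in> I n" for n w by (auto simp: c_def I_def)
  define ok where "ok n b G F \<longleftrightarrow> G \<in> borel_measurable borel \<and> (\<forall>u. G u \<in> J n) \<and> (\<forall>u. subgrad UNIV F u (G u)) \<and>
      (\<forall>y\<in>J n. measure \<mu> (G -` {y}) = real (b y) / (\<Sum>y\<in>J n. real (b y)))"
    for n and b :: "'a \<Rightarrow> nat" and G F
  have ok: "\<exists>G F. ok n b G F" if b: "b \<in> I n" for n b
  proof -
    have pos: "0 < real (b y)" if "y \<in> J n" for y using b that by (fastforce simp: I_def PiE_iff)
    then have S: "0 < (\<Sum>y\<in>J n. real (b y))" using J by (intro sum_pos) auto
    show ?thesis
    proof (rule semidiscrete_transport[OF J(1) J(2), of n "\<lambda>y. real (b y) / (\<Sum>y\<in>J n. real (b y))"])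
      show "0 < real (b y) / (\<Sum>y\<in>J n. real (b y))" if "y \<in> J n" for y using pos[OF that] S by simp
      show "(\<Sum>y\<in>J n. real (b y) / (\<Sum>y\<in>J n. real (b y))) = 1" using S by (simp flip: sum_divide_distrib)
    qed (auto simp: ok_def)
  qed
  define GF where "GF n b = (SOME x. ok n b (fst x) (snd x))" for n b
  define G where "G n b = fst (GF n b)" for n b
  define F where "F n b = snd (GF n b)" for n b
  have GF: "ok n b (G n b) (F n b)" if b: "b \<in> I n" for n b
  proof -
    have "\<exists>x. ok n b (fst x) (snd x)" using ok[OF b] by simp
    then show ?thesis unfolding G_def F_def GF_def by (rule someI_ex)
  qed
  have Gm: "G n (c n w) \<in> borel_measurable borel" and GJ: "G n (c n w) u \<in> J n"
    and Gsub: "subgrad UNIV (F n (c n w)) u (G n (c n w) u)"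
    and Glaw: "y \<in> J n \<Longrightarrow> measure \<mu> (G n (c n w) -` {y}) = real (c n w y) / (\<Sum>y\<in>J n. real (c n w y))"
    for n w u y using GF[OF cI[of n w]] by (auto simp: ok_def)
  define R where "R n x = G n (c n (snd x)) (fst x)" for n x
  have Rm[measurable]: "R n \<in> borel_measurable (borel \<Otimes>\<^sub>M N)" for n
  proof -
    have cnt: "countable (I n)" unfolding I_def using J by (intro countable_PiE) auto
    have "c n \<in> N \<rightarrow>\<^sub>M count_space (I n)"
      unfolding measurable_count_space_eq_countable[OF cnt]
    proof (intro conjI ballI)
      show "c n \<in> space N \<rightarrow> I n" using cI by auto
      fix b assume b: "b \<in> I n"
      have "c n -` {b} \<inter> space N = {w \<in> space N. \<forall>y\<in>J n. nat \<lfloor>r n * a n w y\<rfloor> + 1 = b y}"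
        using b by (auto simp: c_def I_def PiE_def extensional_def fun_eq_iff)
      also have "\<dots> \<in> sets N" using J(1)[of n] by measurable
      finally show "c n -` {b} \<inter> space N \<in> sets N" .
    qed
    then have g: "(\<lambda>x. c n (snd x)) \<in> (borel \<Otimes>\<^sub>M N) \<rightarrow>\<^sub>M count_space (I n)"
      by (rule measurable_compose[OF measurable_snd])
    show ?thesis unfolding R_def
    proof (rule measurable_compose_countable'[OF _ g cnt])
      fix b assume "b \<in> I n"
      then have "G n b \<in> borel_measurable borel" using GF by (simp add: ok_def)
      then show "(\<lambda>x. G n b (fst x)) \<in> borel_measurable (borel \<Otimes>\<^sub>M N)" by measurable
    qed
  qed
  have close: "\<bar>(\<integral>u. f (R n (u, w)) \<partial>\<mu>) - (\<integral>x. f (T n x) \<partial>K w)\<bar> \<le> 2 / real (Suc n)"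
    if f: "\<And>x. 0 \<le> f x \<and> f x \<le> 1" for f :: "'a \<Rightarrow> real" and n w
  proof -
    define C where "C = (\<Sum>y\<in>J n. real (c n w y))"
    define p where "p y = real (c n w y) / C" for y
    have c_ge: "r n * a n w y \<le> real (c n w y)" "real (c n w y) \<le> r n * a n w y + 1" if "y \<in> J n" for y
    proof -
      have "0 \<le> r n * a n w y" by (simp add: a_def r_def)
      then show "r n * a n w y \<le> real (c n w y)" "real (c n w y) \<le> r n * a n w y + 1"
        using that by (simp_all add: c_def) linarith+
    qed
    have "r n = (\<Sum>y\<in>J n. r n * a n w y)" using a_sum[of n w] by (simp flip: sum_distrib_left)
    also have "\<dots> \<le> C" unfolding C_def using c_ge by (intro sum_mono)
    finally have C: "r n \<le> C" .
    then have C0: "0 < C" using r_pos[of n] by linarith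
    have p_sum: "sum p (J n) = sum (a n w) (J n)"
      unfolding a_sum p_def using C0 by (simp add: C_def flip: sum_divide_distrib)
    have pa: "p y - a n w y \<le> 1 / r n" if "y \<in> J n" for y
    proof -
      have "p y \<le> real (c n w y) / r n" unfolding p_def using C r_pos[of n] by (intro divide_left_mono) auto
      also have "\<dots> \<le> (r n * a n w y + 1) / r n" using c_ge(2)[OF that] r_pos[of n] by (intro divide_right_mono) auto
      also have "\<dots> = a n w y + 1 / r n" using r_pos[of n] by (simp add: field_simps)
      finally show ?thesis by simp
    qed
    have "(\<integral>u. f (R n (u, w)) \<partial>\<mu>) = (\<Sum>y\<in>J n. f y * p y)"
      unfolding R_def fst_conv snd_conv using Gm[of n w] GJ[of n w] J(1)[of n] Glaw[of _ n w]
      by (subst integral_finite_range[of \<mu> _ "J n"])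
        (auto simp: finite_measure_axioms p_def C_def cong: measurable_cong_sets)
    moreover have "(\<integral>x. f (T n x) \<partial>K w) = (\<Sum>y\<in>J n. f y * a n w y)"
      using J(1)[of n] TJ[of n] K[of w]
      by (subst integral_finite_range[of _ _ "J n"])
        (auto simp: a_def prob_space.finite_measure cong: measurable_cong_sets)
    ultimately have "\<bar>(\<integral>u. f (R n (u, w)) \<partial>\<mu>) - (\<integral>x. f (T n x) \<partial>K w)\<bar> = \<bar>\<Sum>y\<in>J n. f y * (p y - a n w y)\<bar>"
      by (simp add: sum_subtractf right_diff_distrib)
    also have "\<dots> \<le> (\<Sum>y\<in>J n. \<bar>f y * (p y - a n w y)\<bar>)" by (rule sum_abs)
    also have "\<dots> \<le> (\<Sum>y\<in>J n. \<bar>p y - a n w y\<bar>)"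
      using f by (intro sum_mono) (simp add: abs_mult mult_left_le_one_le)
    also have "\<dots> \<le> 2 * (real (card (J n)) * (1 / r n))"
      using p_sum pa r_pos[of n] by (intro sum_abs_diff_le) auto
    also have "\<dots> \<le> 2 * (real (Suc n) * (1 / r n))"
      using J(3)[of n] r_pos[of n] by (intro mult_left_mono mult_right_mono) auto
    also have "\<dots> = 2 / real (Suc n)" by (simp add: r_def)
    finally show ?thesis .
  qed
  have ap: "approximates (\<lambda>n u. R n (u, w)) (\<lambda>n. F n (c n w)) (K w)" for w
    unfolding approximates_def
  proof (intro conjI allI ballI impI)
    show "(\<lambda>u. R n (u, w)) \<in> borel_measurable borel" for n using Gm by (simp add: R_def)
    show "subgrad Os (F n (c n w)) u (R n (u, w))" for n u using Gsub[of n w u] by (simp add: R_def subgrad_def)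
    fix f :: "'a \<Rightarrow> real" assume f: "continuous_on UNIV f" "\<forall>x. 0 \<le> f x \<and> f x \<le> 1"
    interpret KW: prob_space "K w" by (rule K)
    note [measurable_cong] = K(2)[of w]
    have [measurable]: "f \<in> borel_measurable borel" using f(1) by (rule borel_measurable_continuous_onI)
    have "(\<lambda>n. \<integral>x. f (T n x) \<partial>K w) \<longlonglongrightarrow> (\<integral>x. f x \<partial>K w)"
    proof (rule integral_dominated_convergence[where w="\<lambda>_. 1"])
      show "AE x in K w. (\<lambda>n. f (T n x)) \<longlonglongrightarrow> f x"
        using f(1) T_lim by (intro AE_I2 continuous_on_tendsto_compose[OF f(1)]) auto
    qed (use f(2) in auto)
    moreover have "(\<lambda>n. (\<integral>u. f (R n (u, w)) \<partial>\<mu>) - (\<integral>x. f (T n x) \<partial>K w)) \<longlonglongrightarrow> 0"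
    proof (rule Lim_null_comparison)
      show "eventually (\<lambda>n. norm ((\<integral>u. f (R n (u, w)) \<partial>\<mu>) - (\<integral>x. f (T n x) \<partial>K w)) \<le> 2 * inverse (real (Suc n))) sequentially"
        using close f(2) by (simp add: divide_inverse)
      show "(\<lambda>n. 2 * inverse (real (Suc n))) \<longlonglongrightarrow> 0"
        using tendsto_mult[OF tendsto_const LIMSEQ_inverse_real_of_nat, of 2] by simp
    qed
    ultimately show "(\<lambda>n. \<integral>u. f (R n (u, w)) \<partial>\<mu>) \<longlonglongrightarrow> (\<integral>x. f x \<partial>K w)"
      using tendsto_add[of "\<lambda>n. \<integral>x. f (T n x) \<partial>K w" _ sequentially] by fastforce
  qed
  \<comment> \<open>Convergence holds off a null set of \<open>u\<close> that depends on
    \<open>w\<close>; \<open>lim\<close> is jointly Borel whatever its value where the sequence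
    diverges.\<close>
  define Q where "Q x = lim (\<lambda>n. R n x)" for x
  show ?thesis
  proof (intro exI[of _ Q] conjI allI)
    show "Q \<in> borel_measurable (borel \<Otimes>\<^sub>M N)" unfolding Q_def by measurable
    fix w
    show "\<exists>\<Phi>. convex_on Os \<Phi> \<and> (AE u in \<mu>. u \<in> Os \<and> (\<Phi> has_derivative (\<lambda>h. Q (u, w) \<bullet> h)) (at u))"
      unfolding Q_def by (rule approximates_gradient[OF ap K(1) K(2)]) blast
    show "distr \<mu> borel (\<lambda>u. Q (u, w)) = K w"
      unfolding Q_def by (rule approximates_gradient[OF ap K(1) K(2)])
  qed
qed

end

section \<open>Supports and distribution functions\<close>

lemma closed_supp_measure:
  fixes M :: "'a::metric_space measure"
  assumes sets: "sets M = sets borel"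
  shows "closed (supp_measure M)"
  unfolding closed_def open_dist
proof
  fix x assume "x \<in> - supp_measure M"
  then obtain e where e: "0 < e" "emeasure M (ball x e) = 0" by (auto simp: supp_measure_def)
  have "y \<in> - supp_measure M" if y: "dist y x < e" for y
  proof -
    have "ball y (e - dist y x) \<subseteq> ball x e"
    proof
      fix v assume "v \<in> ball y (e - dist y x)"
      then show "v \<in> ball x e" using dist_triangle[of x v y] by (simp add: dist_commute)
    qed
    then have "emeasure M (ball y (e - dist y x)) \<le> 0" unfolding e(2)[symmetric] by (rule emeasure_mono) (simp add: sets)
    then show ?thesis using y by (auto simp: supp_measure_def intro!: exI[of _ "e - dist y x"])
  qed
  then show "\<exists>e>0. \<forall>y. dist y x < e \<longrightarrow> y \<in> - supp_measure M" using e(1) by blast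
qed

text \<open>The complement of the support is covered by null balls, and by the Lindelof property
  countably many of them suffice.\<close>

lemma AE_supp_measure:
  fixes M :: "'a::{metric_space, second_countable_topology} measure"
  assumes sets: "sets M = sets borel"
  shows "AE x in M. x \<in> supp_measure M"
proof -
  define \<F> where "\<F> = {B::'a set. \<exists>x e. 0 < e \<and> B = ball x e \<and> emeasure M B = 0}"
  have "open B" if "B \<in> \<F>" for B using that by (auto simp: \<F>_def)
  from Lindelof[OF this] obtain \<G> where \<G>: "\<G> \<subseteq> \<F>" "countable \<G>" "\<Union>\<G> = \<Union>\<F>" by metis
  have "\<Union>\<G> \<in> null_sets M"
    using \<G>(1,2) by (intro null_sets_UN'[of \<G> "\<lambda>B. B", simplified]) (auto simp: \<F>_def null_sets_def sets)
  then have "AE x in M. x \<notin> \<Union>\<F>" unfolding \<G>(3)[symmetric] by (rule AE_not_in)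
  then show ?thesis
  proof eventually_elim
    case (elim x)
    show ?case
    proof (rule ccontr)
      assume "x \<notin> supp_measure M"
      then obtain e where "0 < e" "emeasure M (ball x e) = 0" by (auto simp: supp_measure_def)
      then have "ball x e \<in> \<F>" by (auto simp: \<F>_def)
      then show False using elim \<open>0 < e\<close> by (auto dest: spec[of _ "ball x e"])
    qed
  qed
qed

text \<open>The frontier of a convex set is Lebesgue null, so absolute continuity leaves all mass in
  the interior of the support. Open subsets are charged because they contain a ball around a point
  of the support.\<close>

lemma transport_source_interior_supp:
  fixes M :: "'a::euclidean_space measure"
  assumes "prob_space M" and sets: "sets M = sets borel" and ac: "absolutely_continuous lborel M"
    and cv: "convex (supp_measure M)"
  shows "transport_source M (interior (supp_measure M))"
proof -
  interpret prob_space M by fact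
  interpret ac_prob_space M using sets ac by unfold_locales
  show ?thesis
  proof
    show "open (interior (supp_measure M))" "convex (interior (supp_measure M))" using cv by (auto intro: convex_interior)
    have "frontier (supp_measure M) \<in> null_sets lborel"
      using negligible_convex_frontier[OF cv] by (simp add: negligible_iff_null_sets null_sets_completion_iff)
    then have "AE x in M. x \<notin> frontier (supp_measure M)" by (intro AE_from_lborel AE_not_in)
    with AE_supp_measure[OF sets] show "AE x in M. x \<in> interior (supp_measure M)"
      by eventually_elim (use closure_subset in \<open>auto simp: frontier_def\<close>)
    fix V assume V: "open V" "V \<subseteq> interior (supp_measure M)" "V \<noteq> {}"
    then obtain x e where x: "x \<in> V" "0 < e" "ball x e \<subseteq> V" by (meson all_not_in_conv openE)
    then have "x \<in> supp_measure M" using V interior_subset by blast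
    then have "0 < emeasure M (ball x e)" using x by (simp add: supp_measure_def)
    also have "\<dots> \<le> emeasure M V" using x V by (intro emeasure_mono) (auto simp: sets)
    finally show "0 < measure M V" by (simp add: emeasure_eq_measure)
  qed
qed

text \<open>Lower orthants generate the Borel sets and are stable under intersection through
  \<open>inf\<close>. Distribution functions as in part (i) thus become equalities of laws, the form
  in which uniqueness is proved.\<close>

lemma measure_eqI_atMost:
  fixes M N :: "'a::ordered_euclidean_space measure"
  assumes "prob_space M" "prob_space N" and sets: "sets M = sets borel" "sets N = sets borel"
    and eq: "\<And>y. measure M {..y} = measure N {..y}"
  shows "M = N"
proof (rule measure_eqI_generator_eq[where E="range atMost" and \<Omega>=UNIV and A="\<lambda>n. {..real n *\<^sub>R One}"])
  interpret M: prob_space M by fact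
  interpret N: prob_space N by fact
  show "Int_stable (range (atMost :: 'a \<Rightarrow> 'a set))"
  proof (rule Int_stableI)
    fix a b :: "'a set" assume "a \<in> range atMost" "b \<in> range atMost"
    then obtain x y where "a = {..x}" "b = {..y}" by auto
    then have "a \<inter> b = {..inf x y}" by auto
    then show "a \<inter> b \<in> range atMost" by blast
  qed
  show "sets M = sigma_sets UNIV (range atMost)" "sets N = sigma_sets UNIV (range atMost)"
    unfolding sets by (subst borel_eq_atMost, simp)+
  show "emeasure M X = emeasure N X" if "X \<in> range atMost" for X
    using that eq by (auto simp: M.emeasure_eq_measure N.emeasure_eq_measure)
  show "(\<Union>n. {..real n *\<^sub>R One}) = (UNIV :: 'a set)"
  proof -
    have "\<exists>n. x \<le> real n *\<^sub>R One" for x :: 'a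
    proof -
      obtain n where n: "norm x < real n" using reals_Archimedean2 by blast
      have "x \<bullet> i \<le> (real n *\<^sub>R One) \<bullet> i" if "i \<in> Basis" for i
        using Basis_le_norm[OF that, of x] n that by simp
      then show ?thesis by (auto simp: eucl_le[where 'a='a])
    qed
    then show ?thesis by auto
  qed
  show "emeasure M {..real n *\<^sub>R One} \<noteq> \<infinity>" for n by simp
qed auto

section \<open>Conditional vector quantiles\<close>

text \<open>On a rectangle both sides integrate the kernel mass of \<open>A\<close> over
  \<open>B\<close> against the law of \<open>Z\<close>, and rectangles generate. So independent
  \<open>u\<close> and \<open>z\<close> yield a copy of \<open>(Y, Z)\<close>.\<close>

lemma distr_pair_eq_of_cond_distr:
  fixes FU :: "'u measure" and Y :: "'b \<Rightarrow> 'y::second_countable_topology" and Z :: "'b \<Rightarrow> 'z::second_countable_topology"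
  assumes M: "prob_space M" and Y[measurable]: "Y \<in> borel_measurable M" and Z[measurable]: "Z \<in> borel_measurable M"
    and K: "is_cond_distr M Y Z K" and FU: "prob_space FU"
    and Q[measurable]: "Q \<in> borel_measurable (FU \<Otimes>\<^sub>M borel)"
    and QK: "\<And>z. distr FU borel (\<lambda>u. Q (u, z)) = K z"
  shows "distr (FU \<Otimes>\<^sub>M distr M borel Z) (borel \<Otimes>\<^sub>M borel) (\<lambda>(u, z). (Q (u, z), z))
    = distr M (borel \<Otimes>\<^sub>M borel) (\<lambda>\<omega>. (Y \<omega>, Z \<omega>))"
proof -
  interpret M: prob_space M by fact
  interpret FU: prob_space FU by fact
  define FZ where "FZ = distr M borel Z"
  interpret FZ: prob_space FZ unfolding FZ_def by (rule M.prob_space_distr) measurable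
  have sets_FZ[measurable_cong, simp]: "sets FZ = sets borel" by (simp add: FZ_def)
  have [simp]: "space FZ = UNIV" by (simp add: FZ_def)
  interpret P: pair_prob_space FU FZ ..
  have Q'[measurable]: "Q \<in> borel_measurable (FU \<Otimes>\<^sub>M FZ)" by measurable
  let ?L = "distr (FU \<Otimes>\<^sub>M FZ) (borel \<Otimes>\<^sub>M borel) (\<lambda>(u, z). (Q (u, z), z))"
  let ?R = "distr M (borel \<Otimes>\<^sub>M borel) (\<lambda>\<omega>. (Y \<omega>, Z \<omega>))"
  let ?E = "{A \<times> B |A B. A \<in> sets borel \<and> B \<in> sets borel} :: ('y \<times> 'z) set set"
  have eq: "emeasure ?L (A \<times> B) = emeasure ?R (A \<times> B)"
    if [measurable]: "A \<in> sets borel" "B \<in> sets borel" for A :: "'y set" and B :: "'z set"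
  proof -
    have Km[measurable]: "(\<lambda>z. measure (K z) A) \<in> borel_measurable borel"
      using K that by (auto simp: is_cond_distr_def)
    have pK: "prob_space (K z)" for z using K by (auto simp: is_cond_distr_def)
    have sec: "(\<lambda>u. Q (u, z)) \<in> borel_measurable FU" for z by measurable
    have "emeasure ?L (A \<times> B) = emeasure (FU \<Otimes>\<^sub>M FZ) {x \<in> space (FU \<Otimes>\<^sub>M FZ). Q x \<in> A \<and> snd x \<in> B}"
      by (subst emeasure_distr) (auto intro!: arg_cong[where f="emeasure _"])
    also have "\<dots> = (\<integral>\<^sup>+z. emeasure FU ((\<lambda>u. (u, z)) -` {x \<in> space (FU \<Otimes>\<^sub>M FZ). Q x \<in> A \<and> snd x \<in> B}) \<partial>FZ)"
      by (rule P.emeasure_pair_measure_alt2) measurable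
    also have "\<dots> = (\<integral>\<^sup>+z. ennreal (indicator B z * measure (K z) A) \<partial>FZ)"
    proof (rule nn_integral_cong)
      fix z
      have "(\<lambda>u. (u, z)) -` {x \<in> space (FU \<Otimes>\<^sub>M FZ). Q x \<in> A \<and> snd x \<in> B}
        = (if z \<in> B then (\<lambda>u. Q (u, z)) -` A \<inter> space FU else {})"
        by (auto simp: space_pair_measure)
      moreover have "emeasure FU ((\<lambda>u. Q (u, z)) -` A \<inter> space FU) = ennreal (measure (K z) A)"
        using emeasure_distr[OF sec that(1), of z] prob_space.finite_measure[OF pK[of z]]
        by (simp add: QK finite_measure.emeasure_eq_measure)
      ultimately show "emeasure FU ((\<lambda>u. (u, z)) -` {x \<in> space (FU \<Otimes>\<^sub>M FZ). Q x \<in> A \<and> snd x \<in> B})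
        = ennreal (indicator B z * measure (K z) A)" by simp
    qed
    also have "\<dots> = ennreal (\<integral>z. indicator B z * measure (K z) A \<partial>FZ)"
    proof (rule nn_integral_eq_integral)
      show "integrable FZ (\<lambda>z. indicator B z * measure (K z) A)"
        by (rule FZ.integrable_const_bound[where B=1])
          (auto simp: indicator_def intro!: AE_I2 prob_space.prob_le_1[OF pK])
    qed simp
    also have "(\<integral>z. indicator B z * measure (K z) A \<partial>FZ) = measure M {\<omega> \<in> space M. Y \<omega> \<in> A \<and> Z \<omega> \<in> B}"
      using K that unfolding is_cond_distr_def by (simp add: set_lebesgue_integral_def FZ_def)
    also have "ennreal \<dots> = emeasure ?R (A \<times> B)"
      by (subst emeasure_distr) (auto simp: M.emeasure_eq_measure intro!: arg_cong[where f="measure _"])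
    finally show ?thesis .
  qed
  have "?L = ?R"
  proof (rule measure_eqI_generator_eq[where E="?E" and \<Omega>=UNIV and A="\<lambda>_. UNIV"])
    show "Int_stable ?E"
    proof (rule Int_stableI)
      fix a b assume "a \<in> ?E" "b \<in> ?E"
      then obtain A B A' B' where "a = A \<times> B" "b = A' \<times> B'" and s: "A \<in> sets borel" "B \<in> sets borel" "A' \<in> sets borel" "B' \<in> sets borel"
        by blast
      then have "a \<inter> b = (A \<inter> A') \<times> (B \<inter> B')" by auto
      then show "a \<inter> b \<in> ?E" using s by blast
    qed
    show "sets ?L = sigma_sets UNIV ?E" "sets ?R = sigma_sets UNIV ?E"
      by (simp_all add: sets_pair_measure)
    show "emeasure ?L X = emeasure ?R X" if "X \<in> ?E" for X using that eq by blast
    show "range (\<lambda>_. UNIV) \<subseteq> ?E" by (auto intro!: exI[of _ UNIV])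
    interpret L: prob_space ?L by (rule P.prob_space_distr) measurable
    show "emeasure ?L UNIV \<noteq> \<infinity>" by simp
  qed auto
  then show ?thesis by (simp add: FZ_def)
qed

theorem theorem2p1:
  fixes M0 :: "'a measure" and M1 :: "'b measure"
    and Y :: "'b \<Rightarrow> real^'d" and Z :: "'b \<Rightarrow> real^'k"
    and K :: "real^'k \<Rightarrow> (real^'d) measure"
    and FU :: "(real^'d) measure"
  defines "FZ \<equiv> distr M1 borel Z"
    and "\<UU> \<equiv> supp_measure FU"
    and "\<ZZ> \<equiv> supp_measure (distr M1 borel Z)"
    and "UZ \<equiv> supp_measure (FU \<Otimes>\<^sub>M distr M1 borel Z)"
    and "\<Omega> \<equiv> completion (M0 \<Otimes>\<^sub>M (M1 \<Otimes>\<^sub>M restrict_space lborel {0<..<(1::real)}))"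
  assumes M0: "prob_space M0" and M1: "prob_space M1"
    and YZ: "Y \<in> borel_measurable M1" "Z \<in> borel_measurable M1"
    and K: "is_cond_distr M1 Y Z K"
    and FU: "prob_space FU" "sets FU = sets borel"
    and FU_dens: "\<exists>f\<in>borel_measurable borel. FU = density lborel f"
    and FU_conv: "convex \<UU>"
    and M0_carries: "\<exists>V\<in>borel_measurable M0. distr M0 borel V = FU"
  shows "\<exists>Q :: ((real^'d) \<times> (real^'k)) \<Rightarrow> real^'d.
     Q \<in> borel_measurable (restrict_space (borel \<Otimes>\<^sub>M borel) UZ) \<and>
     (\<forall>z\<in>\<ZZ>.
        grad_convex_ae FU \<UU> (\<lambda>u. Q (u, z)) \<and>
        (\<forall>y. measure (K z) {x. x \<le> y} = measure FU {u\<in>\<UU>. Q (u, z) \<le> y}) \<and>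
        (\<forall>G. G \<in> borel_measurable (restrict_space borel \<UU>) \<longrightarrow>
             grad_convex_ae FU \<UU> G \<longrightarrow>
             (\<forall>y. measure (K z) {x. x \<le> y} = measure FU {u\<in>\<UU>. G u \<le> y}) \<longrightarrow>
             (AE u in FU. G u = Q (u, z)))) \<and>
     (\<exists>U :: ('a \<times> 'b \<times> real) \<Rightarrow> real^'d.
        U \<in> borel_measurable \<Omega> \<and>
        (AE \<omega> in \<Omega>. Y (fst (snd \<omega>)) = Q (U \<omega>, Z (fst (snd \<omega>)))) \<and>
        is_cond_distr \<Omega> U (\<lambda>\<omega>. Z (fst (snd \<omega>))) (\<lambda>_. FU))"
proof -
  interpret FU: prob_space FU by (rule FU(1))
  note [measurable_cong] = FU(2)
  have sp[simp]: "space FU = UNIV" using sets_eq_imp_space_eq[OF FU(2)] by simp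
  have ac: "absolutely_continuous lborel FU"
  proof -
    obtain f where "f \<in> borel_measurable borel" "FU = density lborel f" using FU_dens by blast
    then show ?thesis by (auto intro!: absolutely_continuousI_density)
  qed
  interpret T: transport_source FU "interior \<UU>"
    using transport_source_interior_supp[OF FU(1,2) ac] FU_conv unfolding \<UU>_def by simp
  have pK: "prob_space (K z)" and sK: "sets (K z) = sets borel"
    and mK: "A \<in> sets borel \<Longrightarrow> (\<lambda>z. measure (K z) A) \<in> borel_measurable borel" for z A
    using K by (auto simp: is_cond_distr_def)
  obtain Q where Q_all: "Q \<in> borel_measurable (borel \<Otimes>\<^sub>M borel) \<and>
    (\<forall>z. \<exists>\<Phi>. convex_on (interior \<UU>) \<Phi> \<and>
      (AE u in FU. u \<in> interior \<UU> \<and> (\<Phi> has_derivative (\<lambda>h. Q (u, z) \<bullet> h)) (at u))) \<and>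
    (\<forall>z. distr FU borel (\<lambda>u. Q (u, z)) = K z)"
    using T.transport_kernel[OF pK sK mK] by (rule exE)
  then have Qm[measurable]: "Q \<in> borel_measurable (borel \<Otimes>\<^sub>M borel)"
    and Q_grad: "\<And>z. \<exists>\<Phi>. convex_on (interior \<UU>) \<Phi> \<and>
      (AE u in FU. u \<in> interior \<UU> \<and> (\<Phi> has_derivative (\<lambda>h. Q (u, z) \<bullet> h)) (at u))"
    and Q_law: "\<And>z. distr FU borel (\<lambda>u. Q (u, z)) = K z"
    by blast+
  have \<UU>_borel[measurable]: "\<UU> \<in> sets borel"
    unfolding \<UU>_def using closed_supp_measure[OF FU(2)] by simp
  have AE_\<UU>: "AE u in FU. u \<in> \<UU>" unfolding \<UU>_def by (rule AE_supp_measure[OF FU(2)])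
  have Qz[measurable]: "(\<lambda>u. Q (u, z)) \<in> borel_measurable borel" for z by measurable
  have le_sets[measurable]: "{x::real^'d. x \<le> y} \<in> sets borel" for y by (simp flip: atMost_def)

  have part1: "grad_convex_ae FU \<UU> (\<lambda>u. Q (u, z))" for z
    using Q_grad unfolding grad_convex_ae_def by blast
  have part2: "measure (K z) {x. x \<le> y} = measure FU {u\<in>\<UU>. Q (u, z) \<le> y}" for z y
  proof -
    have "measure (K z) {x. x \<le> y} = measure FU {u. Q (u, z) \<le> y}"
      unfolding Q_law[symmetric, of z] by (subst measure_distr) (auto simp: vimage_def)
    also have "\<dots> = measure FU {u\<in>\<UU>. Q (u, z) \<le> y}"
    proof (rule measure_eq_AE)
      show "AE u in FU. u \<in> {u. Q (u, z) \<le> y} \<longleftrightarrow> u \<in> {u\<in>\<UU>. Q (u, z) \<le> y}"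
        using AE_\<UU> by eventually_elim simp
      have "{u. Q (u, z) \<le> y} = (\<lambda>u. Q (u, z)) -` {x. x \<le> y} \<inter> space borel" by auto
      then show *: "{u. Q (u, z) \<le> y} \<in> sets FU" using measurable_sets[OF Qz le_sets] FU(2) by simp
      have "{u\<in>\<UU>. Q (u, z) \<le> y} = \<UU> \<inter> {u. Q (u, z) \<le> y}" by auto
      then show "{u\<in>\<UU>. Q (u, z) \<le> y} \<in> sets FU" using * FU(2) by auto
    qed
    finally show ?thesis .
  qed
  have part3: "AE u in FU. G u = Q (u, z)"
    if G: "G \<in> borel_measurable (restrict_space borel \<UU>)" "grad_convex_ae FU \<UU> G"
      "\<forall>y. measure (K z) {x. x \<le> y} = measure FU {u\<in>\<UU>. G u \<le> y}" for G z
  proof -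
    \<comment> \<open>A competitor is measurable only on \<open>\<UU>\<close>; extension by 0 makes
      it Borel and changes it at most on a null set.\<close>
    define G' where "G' u = indicator \<UU> u *\<^sub>R G u" for u
    have [measurable]: "G' \<in> borel_measurable borel"
      using G(1) unfolding G'_def by (subst (asm) borel_measurable_restrict_space_iff) auto
    have G'_eq: "AE u in FU. G' u = G u" using AE_\<UU> by eventually_elim (simp add: G'_def)
    have "distr FU borel G' = K z"
    proof (rule measure_eqI_atMost)
      show "prob_space (distr FU borel G')" by (rule FU.prob_space_distr) simp
      fix y
      have "measure (distr FU borel G') {..y} = measure FU (G' -` {..y})"
        by (subst measure_distr) auto
      also have "\<dots> = measure FU {u\<in>\<UU>. G u \<le> y}"
      proof (rule measure_eq_AE)
        show "AE u in FU. u \<in> G' -` {..y} \<longleftrightarrow> u \<in> {u\<in>\<UU>. G u \<le> y}"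
          using AE_\<UU> by eventually_elim (simp add: G'_def)
        have G's: "G' -` {..y} \<in> sets borel" using measurable_sets[of G' borel borel "{..y}"] by simp
        then show "G' -` {..y} \<in> sets FU" using FU(2) by simp
        have "{u\<in>\<UU>. G u \<le> y} = \<UU> \<inter> G' -` {..y}" by (auto simp: G'_def)
        then show "{u\<in>\<UU>. G u \<le> y} \<in> sets FU" using G's FU(2) by auto
      qed
      also have "\<dots> = measure (K z) {..y}" using G(3) by (simp add: atMost_def)
      finally show "measure (distr FU borel G') {..y} = measure (K z) {..y}" .
    qed (use pK sK in auto)
    then have law: "distr FU borel G' = distr FU borel (\<lambda>u. Q (u, z))" by (simp add: Q_law)
    obtain \<phi> where \<phi>: "convex_on (interior \<UU>) \<phi>"
      "AE u in FU. u \<in> interior \<UU> \<and> (\<phi> has_derivative (\<lambda>h. G u \<bullet> h)) (at u)"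
      using G(2) by (auto simp: grad_convex_ae_def)
    obtain \<psi> where \<psi>: "convex_on (interior \<UU>) \<psi>"
      "AE u in FU. u \<in> interior \<UU> \<and> (\<psi> has_derivative (\<lambda>h. Q (u, z) \<bullet> h)) (at u)"
      using Q_grad by blast
    have "AE u in FU. G' u = Q (u, z)"
    proof (rule convex_gradient_unique[OF FU open_interior \<phi>(1) \<psi>(1) _ Qz _ \<psi>(2) law])
      show "AE u in FU. u \<in> interior \<UU> \<and> (\<phi> has_derivative (\<lambda>h. G' u \<bullet> h)) (at u)"
        using \<phi>(2) G'_eq by eventually_elim simp
    qed simp
    with G'_eq show ?thesis by eventually_elim simp
  qed

  \<comment> \<open>Construction of the random vector \<open>U\<close>\<close>
  interpret M0: prob_space M0 by (rule M0)
  interpret M1: prob_space M1 by (rule M1)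
  note [measurable] = YZ
  interpret UF: prob_space unit_uniform by (rule prob_space_unit_uniform)
  have FZ': "prob_space FZ" unfolding FZ_def by (rule M1.prob_space_distr) simp
  interpret FZ: prob_space FZ by (rule FZ')
  have sets_FZ[measurable_cong, simp]: "sets FZ = sets borel" by (simp add: FZ_def)
  have sp_FZ[simp]: "space FZ = UNIV" by (simp add: FZ_def)
  interpret P: pair_prob_space FU FZ ..
  let ?N = "borel \<Otimes>\<^sub>M borel :: ((real^'d) \<times> (real^'k)) measure"
  have QP[measurable]: "Q \<in> borel_measurable (FU \<Otimes>\<^sub>M borel)" "Q \<in> borel_measurable (FU \<Otimes>\<^sub>M FZ)" by measurable
  define S where "S = (\<lambda>(u, z). (Q (u, z), z))"
  have Sm[measurable]: "S \<in> FU \<Otimes>\<^sub>M FZ \<rightarrow>\<^sub>M ?N" unfolding S_def by measurable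
  have fstm: "fst \<in> borel_measurable (FU \<Otimes>\<^sub>M FZ)" by measurable
  \<comment> \<open>\<open>g\<close> resamples \<open>u\<close> from \<open>(Q (u, z), z)\<close>
    and an independent uniform variable, reproducing the joint law of \<open>u\<close> with that
    pair.\<close>
  obtain g where gm[measurable]: "g \<in> borel_measurable (?N \<Otimes>\<^sub>M unit_uniform)"
    and g_law: "distr (distr (FU \<Otimes>\<^sub>M FZ) ?N S \<Otimes>\<^sub>M unit_uniform) (borel \<Otimes>\<^sub>M ?N) (\<lambda>(s, t). (g (s, t), s))
       = distr (FU \<Otimes>\<^sub>M FZ) (borel \<Otimes>\<^sub>M ?N) (\<lambda>x. (fst x, S x))"
    by (rule randomization[OF P.prob_space_axioms fstm Sm])
  \<comment> \<open>\<open>(Y, Z)\<close> has the law of the conditioning pair, so it may be fed to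
    \<open>g\<close> in its place.\<close>
  have S_law: "distr (FU \<Otimes>\<^sub>M FZ) ?N S = distr M1 ?N (\<lambda>\<omega>. (Y \<omega>, Z \<omega>))"
    unfolding S_def FZ_def using distr_pair_eq_of_cond_distr[OF M1 YZ K FU(1) QP(1) Q_law] .

  \<comment> \<open>Laws are computed on the product before completion; measurability, null sets and
    measures of events are carried over at the end.\<close>
  define \<Omega>0 where "\<Omega>0 = M0 \<Otimes>\<^sub>M (M1 \<Otimes>\<^sub>M unit_uniform)"
  interpret R: pair_prob_space M1 unit_uniform ..
  interpret O0: pair_prob_space M0 "M1 \<Otimes>\<^sub>M unit_uniform" ..
  interpret \<Omega>0: prob_space \<Omega>0 unfolding \<Omega>0_def by unfold_locales
  have \<Omega>: "\<Omega> = completion \<Omega>0" by (simp add: \<Omega>_def \<Omega>0_def)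
  define W where "W = (\<lambda>\<omega> :: 'a \<times> 'b \<times> real. ((Y (fst (snd \<omega>)), Z (fst (snd \<omega>))), snd (snd \<omega>)))"
  have Wm[measurable]: "W \<in> \<Omega>0 \<rightarrow>\<^sub>M ?N \<Otimes>\<^sub>M unit_uniform" unfolding W_def \<Omega>0_def by measurable
  have Zm[measurable]: "(\<lambda>\<omega>. Z (fst (snd \<omega>))) \<in> borel_measurable \<Omega>0"
    and Ym[measurable]: "(\<lambda>\<omega>. Y (fst (snd \<omega>))) \<in> borel_measurable \<Omega>0" unfolding \<Omega>0_def by measurable
  have W_law: "distr \<Omega>0 (?N \<Otimes>\<^sub>M unit_uniform) W = distr M1 ?N (\<lambda>\<omega>. (Y \<omega>, Z \<omega>)) \<Otimes>\<^sub>M unit_uniform"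
  proof -
    have "distr M1 ?N (\<lambda>\<omega>. (Y \<omega>, Z \<omega>)) \<Otimes>\<^sub>M unit_uniform
      = distr M1 ?N (\<lambda>\<omega>. (Y \<omega>, Z \<omega>)) \<Otimes>\<^sub>M distr unit_uniform unit_uniform (\<lambda>t. t)" by simp
    also have "\<dots> = distr (M1 \<Otimes>\<^sub>M unit_uniform) (?N \<Otimes>\<^sub>M unit_uniform) (\<lambda>(\<omega>, t). ((Y \<omega>, Z \<omega>), t))"
      by (rule pair_measure_distr) (auto intro: UF.sigma_finite_measure_axioms)
    also have "M1 \<Otimes>\<^sub>M unit_uniform = distr \<Omega>0 (M1 \<Otimes>\<^sub>M unit_uniform) snd"
    proof (rule measure_eqI)
      fix A assume "A \<in> sets (M1 \<Otimes>\<^sub>M unit_uniform)"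
      then have A[measurable]: "A \<in> sets (M1 \<Otimes>\<^sub>M unit_uniform)" .
      have "emeasure (distr \<Omega>0 (M1 \<Otimes>\<^sub>M unit_uniform) snd) A = emeasure \<Omega>0 (space M0 \<times> A)"
        using sets.sets_into_space[OF A] unfolding \<Omega>0_def
        by (subst emeasure_distr) (auto simp: space_pair_measure intro!: arg_cong[where f="emeasure _"])
      also have "\<dots> = emeasure (M1 \<Otimes>\<^sub>M unit_uniform) A"
        unfolding \<Omega>0_def by (subst R.emeasure_pair_measure_Times) (auto simp: M0.emeasure_space_1)
      finally show "emeasure (M1 \<Otimes>\<^sub>M unit_uniform) A = emeasure (distr \<Omega>0 (M1 \<Otimes>\<^sub>M unit_uniform) snd) A" ..
    qed simp
    also have "distr \<dots> (?N \<Otimes>\<^sub>M unit_uniform) (\<lambda>(\<omega>, t). ((Y \<omega>, Z \<omega>), t)) = distr \<Omega>0 (?N \<Otimes>\<^sub>M unit_uniform) W"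
      unfolding \<Omega>0_def by (subst distr_distr) (auto simp: comp_def W_def split_beta')
    finally show ?thesis ..
  qed
  define U where "U \<omega> = g (W \<omega>)" for \<omega>
  have Um[measurable]: "U \<in> borel_measurable \<Omega>0" unfolding U_def by measurable
  \<comment> \<open>Both remaining claims are read off from this law: under
    \<open>FU \<Otimes>\<^sub>M FZ\<close> the identity for \<open>Y\<close> holds at every point,
    and \<open>u\<close> is independent of \<open>z\<close>.\<close>
  have U_law: "distr \<Omega>0 (borel \<Otimes>\<^sub>M ?N) (\<lambda>\<omega>. (U \<omega>, (Y (fst (snd \<omega>)), Z (fst (snd \<omega>)))))
    = distr (FU \<Otimes>\<^sub>M FZ) (borel \<Otimes>\<^sub>M ?N) (\<lambda>x. (fst x, S x))"
    unfolding g_law[symmetric] S_law W_law[symmetric]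
    by (subst distr_distr) (auto simp: comp_def U_def W_def split_beta' intro: Wm[unfolded W_def])
  have AE_Y: "AE \<omega> in \<Omega>0. Y (fst (snd \<omega>)) = Q (U \<omega>, Z (fst (snd \<omega>)))"
  proof -
    have "AE x in distr (FU \<Otimes>\<^sub>M FZ) (borel \<Otimes>\<^sub>M ?N) (\<lambda>x. (fst x, S x)). fst (snd x) = Q (fst x, snd (snd x))"
      by (subst AE_distr_iff) (auto simp: S_def split_beta')
    then show ?thesis unfolding U_law[symmetric] by (subst (asm) AE_distr_iff) auto
  qed
  have joint: "measure \<Omega>0 {\<omega> \<in> space \<Omega>0. U \<omega> \<in> A \<and> Z (fst (snd \<omega>)) \<in> B} = measure FU A * measure FZ B"
    if [measurable]: "A \<in> sets borel" "B \<in> sets borel" for A B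
  proof -
    have "measure \<Omega>0 {\<omega> \<in> space \<Omega>0. U \<omega> \<in> A \<and> Z (fst (snd \<omega>)) \<in> B}
      = measure (distr \<Omega>0 (borel \<Otimes>\<^sub>M ?N) (\<lambda>\<omega>. (U \<omega>, (Y (fst (snd \<omega>)), Z (fst (snd \<omega>)))))) (A \<times> (UNIV \<times> B))"
      by (subst measure_distr) (auto intro!: arg_cong[where f="measure _"])
    also have "\<dots> = measure (FU \<Otimes>\<^sub>M FZ) (A \<times> B)"
      unfolding U_law by (subst measure_distr) (auto simp: S_def space_pair_measure intro!: arg_cong[where f="measure _"])
    also have "\<dots> = measure FU A * measure FZ B"
      using FU(2) by (simp add: measure_def FZ.emeasure_pair_measure_Times enn2real_mult)
    finally show ?thesis .
  qed
  have part4: "is_cond_distr \<Omega> U (\<lambda>\<omega>. Z (fst (snd \<omega>))) (\<lambda>_. FU)"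
    unfolding is_cond_distr_def
  proof (intro conjI allI ballI)
    fix A :: "(real^'d) set" and B :: "(real^'k) set" assume A[measurable]: "A \<in> sets borel" and B[measurable]: "B \<in> sets borel"
    have Z\<Omega>: "(\<lambda>\<omega>. Z (fst (snd \<omega>))) \<in> borel_measurable \<Omega>" unfolding \<Omega> by (rule measurable_completion[OF Zm])
    have joint': "measure \<Omega> {\<omega> \<in> space \<Omega>. U \<omega> \<in> A \<and> Z (fst (snd \<omega>)) \<in> B} = measure FU A * measure FZ B"
      if [measurable]: "A \<in> sets borel" for A
      unfolding \<Omega> space_completion by (subst measure_completion) (auto simp: joint)
    \<comment> \<open>Taking \<open>UNIV\<close> for \<open>A\<close> in the joint formula gives the
      law of \<open>Z\<close> on the completed space; the constant kernel then integrates to a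
      product.\<close>
    have "measure (distr \<Omega> borel (\<lambda>\<omega>. Z (fst (snd \<omega>)))) B = measure \<Omega> {\<omega> \<in> space \<Omega>. U \<omega> \<in> UNIV \<and> Z (fst (snd \<omega>)) \<in> B}"
      using Z\<Omega> by (subst measure_distr) (auto intro!: arg_cong[where f="measure _"])
    also have "\<dots> = measure FZ B" using FU.prob_space by (subst joint') simp_all
    finally have Z_law: "measure (distr \<Omega> borel (\<lambda>\<omega>. Z (fst (snd \<omega>)))) B = measure FZ B" .
    have "(\<integral>w\<in>B. measure FU A \<partial>distr \<Omega> borel (\<lambda>\<omega>. Z (fst (snd \<omega>)))) = measure FU A * measure FZ B"
      unfolding set_lebesgue_integral_def by (simp add: Z_law)
    then show "measure \<Omega> {\<omega> \<in> space \<Omega>. U \<omega> \<in> A \<and> Z (fst (snd \<omega>)) \<in> B}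
      = (\<integral>w\<in>B. measure FU A \<partial>distr \<Omega> borel (\<lambda>\<omega>. Z (fst (snd \<omega>))))" by (simp add: joint')
  qed (use FU in auto)
  have "U \<in> borel_measurable \<Omega>" unfolding \<Omega> by (rule measurable_completion[OF Um])
  moreover have "AE \<omega> in \<Omega>. Y (fst (snd \<omega>)) = Q (U \<omega>, Z (fst (snd \<omega>)))"
    unfolding \<Omega> by (rule AE_completion[OF AE_Y])
  moreover have "Q \<in> borel_measurable (restrict_space (borel \<Otimes>\<^sub>M borel) UZ)"
    using Qm by (rule measurable_restrict_space1)
  ultimately show ?thesis using part1 part2 part3 part4
    by (intro exI[of _ Q] conjI ballI allI impI exI[of _ U]) auto
qed

end
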